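(* Let $E\subseteq\mathbb{R}^n$ be a convex body with nonempty interior and let $\Omega\subseteq\mathbb{S}^{n-1}$ be a set that contains the origin in the interior of its convex hull. Then a convex body $\tilde K\subseteq\mathbb{R}^n$ with nonempty interior is a minimizer of the relative isoperimetric quotient $\mathrm{I}(K;E)$ among all convex bodies $K\subseteq\mathbb{R}^n$ with nonempty interior that are determined by $\Omega$ if and only if $\tilde K$ is homothetic to the tangential body $E^\Omega$ of $E$. In particular, that minimal quotient is $\mathrm{I}(E^\Omega;E)=n^n\,\mathrm{vol}(E^\Omega)$.
   Context: A convex body is a nonempty compact convex subset of $\mathbb{R}^n$; $\mathbb{S}^{n-1}$ is the Euclidean unit sphere; $\mathrm{vol}$ is $n$-dimensional Lebesgue measure. $h_K(u)=\sup\{\langle x,u\rangle:x\in K\}$ is the support function of $K$. A set $\Omega\subseteq\mathbb{S}^{n-1}$ determines $K$ if $K=\{x\in\mathbb{R}^n:\langle x,u\rangle\le h_K(u)\text{ for all }u\in\Omega\}$. $E^\Omega=\{x\in\mathbb{R}^n:\langle x,u\rangle\le h_E(u)\text{ for all }u\in\Omega\}$. A convex body $L\supseteq E$ with nonempty interior is a tangential body of $E$ if through each boundary point of $L$ there is a supporting hyperplane of $L$ that also supports $E$. The relative quermassintegrals $\mathrm{W}_i(K;E)$ are the coefficients in the relative Steiner formula $\mathrm{vol}(K+\lambda E)=\sum_{i=0}^n\binom{n}{i}\mathrm{W}_i(K;E)\lambda^i$, $\lambda\ge 0$; the surface area of $K$ relative to $E$ is $\mathrm{S}(K;E)=n\mathrm{W}_1(K;E)$,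 and $\mathrm{I}(K;E)=\mathrm{S}(K;E)^n/\mathrm{vol}(K)^{n-1}$. Two convex bodies $K,L$ are homothetic if $L=\alpha K+x$ for some $\alpha>0$ and $x\in\mathbb{R}^n$. A minimizer among the bodies determined by $\Omega$ is itself a body of that class. *)

theory Defs
  imports "HOL-Analysis.Analysis"
begin

definition convex_body :: "'a::euclidean_space set \<Rightarrow> bool" where
  "convex_body K \<longleftrightarrow> K \<noteq> {} \<and> compact K \<and> convex K"

definition support_function :: "'a::euclidean_space set \<Rightarrow> 'a \<Rightarrow> real" where
  "support_function K u = (SUP x\<in>K. x \<bullet> u)"

definition determines :: "'a::euclidean_space set \<Rightarrow> 'a set \<Rightarrow> bool" where
  "determines \<Omega> K \<longleftrightarrow> K = {x. \<forall>u\<in>\<Omega>. x \<bullet> u \<le> support_function K u}"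

text \<open>The set written $E^\Omega$ in the literature.\<close>

definition outer_body :: "'a::euclidean_space set \<Rightarrow> 'a set \<Rightarrow> 'a set" where
  "outer_body \<Omega> E = {x. \<forall>u\<in>\<Omega>. x \<bullet> u \<le> support_function E u}"

text \<open>Requiring \<open>L\<close> to lie in one particular closed half-space bounded by \<open>H\<close> is no restriction,
  since \<open>u\<close> and \<open>c\<close> may be replaced by \<open>-u\<close> and \<open>-c\<close>.\<close>

definition supporting_hyperplane :: "'a::euclidean_space set \<Rightarrow> 'a set \<Rightarrow> bool" where
  "supporting_hyperplane H L \<longleftrightarrow>
     (\<exists>u c. u \<noteq> 0 \<and> H = {y. y \<bullet> u = c} \<and> H \<inter> L \<noteq> {} \<and> L \<subseteq> {y. y \<bullet> u \<le> c})"

definition tangential_body :: "'a::euclidean_space set \<Rightarrow> 'a set \<Rightarrow> bool" where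
  "tangential_body L E \<longleftrightarrow>
     convex_body L \<and> interior L \<noteq> {} \<and> E \<subseteq> L \<and>
     (\<forall>x\<in>frontier L. \<exists>H. x \<in> H \<and> supporting_hyperplane H L \<and> supporting_hyperplane H E)"

text \<open>The coefficients in the relative Steiner formula.  The sum of sets is the Minkowski sum.
  A polynomial is determined by its values for nonnegative \<open>l\<close>, so at most one sequence \<open>W\<close>
  satisfies the description once the irrelevant entries beyond the dimension are set to \<open>0\<close>;
  it exists for convex bodies by Minkowski's theorem.\<close>

definition quermassintegral :: "nat \<Rightarrow> 'a::euclidean_space set \<Rightarrow> 'a set \<Rightarrow> real" where
  "quermassintegral i K E =
     (THE W :: nat \<Rightarrow> real.
        (\<forall>j>DIM('a). W j = 0) \<and>
        (\<forall>l\<ge>0. measure lebesgue (K + (*\<^sub>R) l ` E) =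
                 (\<Sum>j\<le>DIM('a). of_nat (DIM('a) choose j) * W j * l ^ j))) i"

definition relative_surface_area :: "'a::euclidean_space set \<Rightarrow> 'a set \<Rightarrow> real" where
  "relative_surface_area K E = of_nat DIM('a) * quermassintegral 1 K E"

definition isoperimetric_quotient :: "'a::euclidean_space set \<Rightarrow> 'a set \<Rightarrow> real" where
  "isoperimetric_quotient K E =
     relative_surface_area K E ^ DIM('a) / measure lebesgue K ^ (DIM('a) - 1)"

definition homothetic :: "'a::euclidean_space set \<Rightarrow> 'a set \<Rightarrow> bool" where
  "homothetic K L \<longleftrightarrow> (\<exists>\<alpha> x. \<alpha> > 0 \<and> L = (\<lambda>y. \<alpha> *\<^sub>R y + x) ` K)"

definition isoperimetric_minimizer ::
    "'a::euclidean_space set \<Rightarrow> 'a set \<Rightarrow> 'a set \<Rightarrow> bool" where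
  "isoperimetric_minimizer \<Omega> E K \<longleftrightarrow>
     is_arg_min (\<lambda>L. isoperimetric_quotient L E)
       (\<lambda>L. convex_body L \<and> interior L \<noteq> {} \<and> determines \<Omega> L) K"

end

theory Submission
  imports Defs "HOL-Probability.Distribution_Functions"
begin

text \<open>
  Let \<open>L\<close> be the body \<open>outer_body \<Omega> E\<close>.  For \<open>K\<close> determined by \<open>\<Omega>\<close> the relative surface areas with respect to \<open>E\<close>
  and to \<open>L\<close> agree, because \<open>E\<close> and \<open>L\<close> have the same support function on \<open>\<Omega>\<close>.  If \<open>K\<close> is cut out by finitely many
  directions this holds since \<open>K + l L\<close> and \<open>K + l E\<close> differ only near the faces of codimension two, by a set of
  volume \<open>O(l\<^sup>2)\<close>; the general case follows by approximating \<open>K\<close> from outside, as the coefficients of the Steiner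
  polynomial depend continuously on \<open>K\<close>.  The claim is then Minkowski's first inequality for \<open>K\<close> and \<open>L\<close> with its
  equality case, i.e. the Brunn--Minkowski inequality with its equality case.

  The volume of \<open>conv P + l (conv Q)\<close> is a polynomial in \<open>l\<close> since the cone over
  \<open>P \<times> {(1,0)} \<union> Q \<times> {(0,1)}\<close> is a disjoint union of relatively open simplicial cones, and the slice of each
  at height \<open>(1,l)\<close> has volume \<open>c l\<^sup>k\<close>.

  For the equality case, let \<open>W x\<close> and \<open>V x\<close> be the heights at which hyperplanes orthogonal to \<open>u\<close> cut the fraction
  \<open>x\<^sup>n\<close> off \<open>K\<close> and \<open>L\<close>.  The inequality for the two pieces on each side gives \<open>W x + V y \<ge> W m + V m\<close> with
  \<open>m = (x + y)/2\<close>, which forces \<open>W - V\<close> to be constant; comparing centroids shows that the constant is linear in \<open>u\<close>.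
\<close>

text \<open>Quermassintegrals are given by a \<open>THE\<close>, so nothing is known about them
  until a Steiner polynomial has been exhibited; this is why polynomiality is proved before any
  inequality. Afterwards only the coefficient of \<open>l\<close> counts, and it is compared through
  volumes for small \<open>l\<close>, where errors of order l^2 do no harm. Outside approximation is
  forced: the polytopes have to be cut out by directions of \<Omega>, where the support functions of
  \<open>E\<close> and \<open>L\<close> agree, while inscribed polytopes have other facet normals.
  The exponent in \<open>x\<^sup>n\<close> makes Brunn--Minkowski additive. If both bodies have
  volume v and their sum has volume 2^n v, then at least (x + y)^n v of the sum lies below height
  \<open>W x + V y\<close>, and at most (2 m)^n v lies below height \<open>W m + V m\<close>, by the
  inequality for the upper pieces. For 2 m = x + y the two bounds coincide, which orders the two
  heights.\<close>

abbreviation (input) vol :: "'a::euclidean_space set \<Rightarrow> real" where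
  "vol \<equiv> measure lebesgue"

section \<open>Volume of linear images\<close>

lemma vol_mono: "A \<subseteq> B \<Longrightarrow> A \<in> lmeasurable \<Longrightarrow> B \<in> lmeasurable \<Longrightarrow> vol A \<le> vol B"
  by (intro measure_mono_fmeasurable) (auto intro: fmeasurableD)

text \<open>The factor is |det f|. Only its independence of the set is recorded, not its value or
  sign.\<close>

definition scales_volume :: "('a::euclidean_space \<Rightarrow> 'a) \<Rightarrow> bool" where
  "scales_volume f \<longleftrightarrow> (\<exists>m. \<forall>S\<in>lmeasurable. f ` S \<in> lmeasurable \<and> vol (f ` S) = m * vol S)"

lemma scales_volumeI_cbox:
  assumes "linear f" "\<And>a b. vol (f ` cbox a b) = m * vol (cbox a b)"
  shows "scales_volume f"
  unfolding scales_volume_def using measure_linear_sufficient[OF assms(1) _ assms(2)] by metis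

text \<open>Linear maps are generated by singular maps killing a coordinate, stretches,
  transpositions and shears, and the factors multiply under composition. For the last two kinds
  boxes suffice.\<close>

lemma linear_scales_volume:
  fixes f :: "real^'n \<Rightarrow> real^'n"
  assumes "linear f"
  shows "scales_volume f"
proof (rule induct_linear_elementary [OF assms])
  fix f g :: "real^'n \<Rightarrow> real^'n"
  assume "scales_volume f" "scales_volume g"
  then obtain m1 m2
    where "\<forall>S\<in>lmeasurable. f ` S \<in> lmeasurable \<and> vol (f ` S) = m1 * vol S"
      and "\<forall>S\<in>lmeasurable. g ` S \<in> lmeasurable \<and> vol (g ` S) = m2 * vol S"
    unfolding scales_volume_def by blast
  then show "scales_volume (f \<circ> g)"
    unfolding scales_volume_def image_comp [symmetric] by (intro exI[of _ "m1 * m2"]) simp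
next
  fix f :: "real^'n \<Rightarrow> real^'n" and i
  assume lin: "linear f" and 0: "\<And>x. f x $ i = 0"
  then have "\<not> inj f"
    by (metis (full_types) linear_injective_imp_surjective one_neq_zero surjE vec_component)
  then have "negligible (f ` S)" for S
    using lin negligible_linear_singular_image by blast
  then show "scales_volume f"
    unfolding scales_volume_def by (intro exI[of _ 0]) (simp add: negligible_iff_measure)
next
  fix c :: "'n \<Rightarrow> real"
  show "scales_volume (\<lambda>x::real^'n. \<chi> i. c i * x $ i)"
    unfolding scales_volume_def using measurable_stretch measure_stretch by blast
next
  fix m n :: 'n
  assume "m \<noteq> n"
  let ?h = "\<lambda>v::real^'n. \<chi> i. v $ Transposition.transpose m n i"
  have lin: "linear ?h"
    by (rule linearI) (simp_all add: plus_vec_def scaleR_vec_def)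
  have "vol (?h ` cbox a b) = 1 * vol (cbox a b)" for a b
  proof (cases "cbox a b = {}")
    case False
    have eq: "?h ` cbox a b = cbox (?h a) (?h b)"
      by (auto simp: image_iff lambda_swap_Galois mem_box_cart) (metis transpose_involutory)+
    then show ?thesis
      using prod.permute [OF permutes_swap_id, where S=UNIV and g="\<lambda>i. (b - a)$i", of m n]
        False image_is_empty[of ?h "cbox a b"] unfolding eq by (simp add: content_cbox_cart)
  qed auto
  then show "scales_volume ?h" by (rule scales_volumeI_cbox[OF lin])
next
  fix m n :: 'n
  assume mn: "m \<noteq> n"
  define h where "h = (\<lambda>v::real^'n. \<chi> i. if i = m then v $ m + v $ n else v $ i)"
  have lin: "linear h" unfolding h_def
    by (rule linearI) (auto simp: algebra_simps plus_vec_def scaleR_vec_def vec_eq_iff)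
  have "vol (h ` cbox a b) = 1 * vol (cbox a b)" for a b
  proof (cases "cbox a b = {}")
    case False
    \<comment> \<open>The shear formula wants a nonnegative lower corner in coordinate
      \<open>n\<close>, so the box is first moved to the origin.\<close>
    have box: "cbox a b = (+) a ` cbox 0 (b - a)"
      using cbox_translation[of a 0 "b - a"] by simp
    have "h ` cbox a b = (+) (h a) ` h ` cbox 0 (b - a)"
      unfolding box image_image by (simp add: linear_add[OF lin])
    then have "vol (h ` cbox a b) = vol (h ` cbox 0 (b - a))"
      using measure_translation[of "h a" "h ` cbox 0 (b - a)"] by presburger
    also have "\<dots> = vol (cbox 0 (b - a))"
      unfolding h_def
    proof (rule measure_shear_interval[OF mn])
      show "cbox 0 (b - a) \<noteq> {}" using False box by force
    qed simp
    also have "\<dots> = vol (cbox a b)"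
      unfolding box by (rule measure_translation [symmetric])
    finally show ?thesis by simp
  qed simp
  then have "scales_volume h" by (rule scales_volumeI_cbox[OF lin])
  then show "scales_volume (\<lambda>v::real^'n. \<chi> i. if i = m then v $ m + v $ n else v $ i)"
    by (simp only: h_def)
qed

section \<open>Simplicial decomposition of finitely generated cones\<close>

text \<open>All coefficients are strictly positive: relatively open cones can be disjoint where
  closed ones would share faces. The empty set gives the apex {0}.\<close>

definition open_cone :: "'a::real_vector set \<Rightarrow> 'a set" where
  "open_cone S = {\<Sum>a\<in>S. t a *\<^sub>R a | t. \<forall>a\<in>S. t a > 0}"

lemma open_cone_subset_hull:
  assumes "finite S" shows "open_cone S \<subseteq> convex_cone hull S"
proof
  fix z assume "z \<in> open_cone S"
  then obtain t where t: "z = (\<Sum>a\<in>S. t a *\<^sub>R a)" "\<forall>a\<in>S. t a > 0"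
    by (auto simp: open_cone_def)
  have "t a *\<^sub>R a \<in> convex_cone hull S" if "a \<in> S" for a
    using that t by (intro convex_cone_hull_mul hull_inc) (auto intro: less_imp_le)
  have "(\<Sum>a\<in>T. t a *\<^sub>R a) \<in> convex_cone hull S" if "T \<subseteq> S" for T
    using finite_subset[OF that assms] that \<open>\<And>a. a \<in> S \<Longrightarrow> t a *\<^sub>R a \<in> convex_cone hull S\<close>
    by (induction T rule: finite_induct) (auto intro: convex_cone_hull_contains_0 convex_cone_hull_add)
  then show "z \<in> convex_cone hull S" unfolding t by blast
qed

lemma open_cone_insert:
  assumes "finite S" "a \<notin> S"
  shows "z \<in> open_cone (insert a S) \<longleftrightarrow> (\<exists>w\<in>open_cone S. \<exists>s>0. z = w + s *\<^sub>R a)"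
proof
  assume "z \<in> open_cone (insert a S)"
  then obtain t where "z = (\<Sum>a\<in>insert a S. t a *\<^sub>R a)" "\<forall>b\<in>insert a S. t b > 0"
    by (auto simp: open_cone_def)
  then show "\<exists>w\<in>open_cone S. \<exists>s>0. z = w + s *\<^sub>R a"
    using assms by (intro bexI[of _ "\<Sum>a\<in>S. t a *\<^sub>R a"] exI[of _ "t a"]) (auto simp: open_cone_def)
next
  assume "\<exists>w\<in>open_cone S. \<exists>s>0. z = w + s *\<^sub>R a"
  then obtain t s where ts: "z = (\<Sum>a\<in>S. t a *\<^sub>R a) + s *\<^sub>R a" "\<forall>b\<in>S. t b > 0" "s > 0"
    by (auto simp: open_cone_def)
  have "(\<Sum>b\<in>S. (t(a:=s)) b *\<^sub>R b) = (\<Sum>a\<in>S. t a *\<^sub>R a)"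
    using assms by (intro sum.cong) auto
  then show "z \<in> open_cone (insert a S)"
    using ts assms unfolding open_cone_def by (intro CollectI exI[of _ "t(a:=s)"]) auto
qed

text \<open>Strictly positive coefficients stay positive under a small perturbation along
  \<open>S\<close>. This is openness of the cone in its span, expressed along a ray.\<close>

lemma open_cone_span_nudge:
  assumes "finite S" "z \<in> open_cone S" "y \<in> span S"
  shows "\<exists>e>0. \<forall>d. 0 \<le> d \<and> d \<le> e \<longrightarrow> z + d *\<^sub>R y \<in> open_cone S"
proof -
  obtain t where t: "z = (\<Sum>a\<in>S. t a *\<^sub>R a)" "\<forall>a\<in>S. t a > 0"
    using assms by (auto simp: open_cone_def)
  obtain u where u: "y = (\<Sum>a\<in>S. u a *\<^sub>R a)"
    using assms span_finite by blast
  have "\<exists>e>0. \<forall>a\<in>S. \<forall>d. 0 \<le> d \<and> d \<le> e \<longrightarrow> t a + d * u a > 0"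
    using assms(1) t(2)
  proof (induction S)
    case empty show ?case by (intro exI[of _ 1]) simp
  next
    case (insert b S)
    then obtain e where e: "e > 0" "\<forall>a\<in>S. \<forall>d. 0 \<le> d \<and> d \<le> e \<longrightarrow> t a + d * u a > 0" by auto
    \<comment> \<open>The summand 1 avoids division by zero and makes the bound strict.\<close>
    define e' where "e' = t b / (1 + \<bar>u b\<bar>)"
    have e': "e' > 0" using insert by (auto simp: e'_def)
    have "t b + d * u b > 0" if "0 \<le> d" "d \<le> e'" for d
    proof -
      have "d * \<bar>u b\<bar> \<le> e' * \<bar>u b\<bar>" using that by (intro mult_right_mono) auto
      also have "\<dots> < e' * (1 + \<bar>u b\<bar>)" using e' by auto
      also have "\<dots> = t b" unfolding e'_def by (smt (verit) abs_ge_zero nonzero_eq_divide_eq)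
      moreover have "d * (- u b) \<le> d * \<bar>u b\<bar>" using that by (intro mult_left_mono) auto
      ultimately show ?thesis by simp
    qed
    then show ?case using e e' by (intro exI[of _ "min e e'"]) simp
  qed
  then obtain e where e: "e > 0" "\<forall>a\<in>S. \<forall>d. 0 \<le> d \<and> d \<le> e \<longrightarrow> t a + d * u a > 0" by blast
  have eq: "z + d *\<^sub>R y = (\<Sum>a\<in>S. (t a + d * u a) *\<^sub>R a)" for d
    by (simp add: t(1) u scaleR_sum_right sum.distrib algebra_simps)
  show ?thesis
  proof (intro exI[of _ e] conjI allI impI e(1))
    fix d assume "0 \<le> d \<and> d \<le> e"
    then show "z + d *\<^sub>R y \<in> open_cone S"
      unfolding open_cone_def eq using e(2) by (intro CollectI exI[of _ "\<lambda>a. t a + d * u a"]) simp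
  qed
qed

lemma convex_cone_hull_insertE:
  assumes "z \<in> convex_cone hull (insert a A)"
  obtains w s where "w \<in> convex_cone hull A" "s \<ge> 0" "z = w + s *\<^sub>R a"
proof -
  have "z \<in> convex_cone hull (A \<union> {a})" using assms by simp
  then obtain w y where w: "w \<in> convex_cone hull A" and y: "y \<in> convex_cone hull {a}" and z: "z = w + y"
    unfolding convex_cone_hull_Un by blast
  from y have "\<exists>s\<ge>0. y = s *\<^sub>R a"
    unfolding convex_cone_hull_convex_hull by (auto intro: exI[of _ 0])
  with w z that show ?thesis by blast
qed

text \<open>The placing triangulation: the new point is joined to the cells from which it is visible.\<close>

proposition simplicial_cone_decomposition:
  fixes A :: "'a::euclidean_space set"
  assumes "finite A"
  shows "\<exists>\<B>. (\<forall>S\<in>\<B>. S \<subseteq> A \<and> independent S) \<and> convex_cone hull A = (\<Union>S\<in>\<B>. open_cone S) \<and>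
    (\<forall>S\<in>\<B>. \<forall>T\<in>\<B>. S \<noteq> T \<longrightarrow> open_cone S \<inter> open_cone T = {})"
  using assms
proof (induction A)
  case empty
  show ?case
    by (intro exI[of _ "{{}}"]) (auto simp: open_cone_def independent_empty)
next
  case (insert a A)
  from insert.IH obtain \<B> where B: "\<forall>S\<in>\<B>. S \<subseteq> A \<and> independent S"
    and cover: "convex_cone hull A = (\<Union>S\<in>\<B>. open_cone S)"
    and B_disj: "\<forall>S\<in>\<B>. \<forall>T\<in>\<B>. S \<noteq> T \<longrightarrow> open_cone S \<inter> open_cone T = {}"
    by (elim exE conjE) (rule that)
  have sub: "S \<subseteq> A" and ind: "independent S" if "S \<in> \<B>" for S
    using B that by blast+
  have disj: "open_cone S \<inter> open_cone T = {}" if "S \<in> \<B>" "T \<in> \<B>" "S \<noteq> T" for S T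
    using B_disj that by blast
  define C where "C = convex_cone hull A"
  note cadd = convex_cone_hull_add[of _ A, folded C_def]
  note cmul = convex_cone_hull_mul[of _ A, folded C_def]
  have fin: "finite S" if "S \<in> \<B>" for S
    using insert.hyps(1) sub[OF that] finite_subset by blast
  have conv: "convex C" by (simp add: C_def convex_convex_cone_hull)
  have closedC: "closed C" using insert.hyps by (simp add: C_def closed_convex_cone_hull)
  \<comment> \<open>One witness per cell is enough, since \<open>vis\<close> carries the property
    over to every point of the cell.\<close>
  define \<V> where "\<V> = {S\<in>\<B>. \<exists>z\<in>open_cone S. \<forall>\<eta>>0. z + \<eta> *\<^sub>R a \<notin> C}"
  \<comment> \<open>If \<open>z - e w\<close> is still in the cell, then z + e \<eta> a = (z - e w)
    + e (w + \<eta> a) would lie in \<open>C\<close> together with w + \<eta> a.\<close>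
  have vis: "w + \<eta> *\<^sub>R a \<notin> C" if S: "S \<in> \<V>" and w: "w \<in> open_cone S" and \<eta>: "\<eta> > 0" for S w \<eta>
  proof
    assume wC: "w + \<eta> *\<^sub>R a \<in> C"
    from S obtain z where SB: "S \<in> \<B>" and z: "z \<in> open_cone S" "\<And>\<eta>. \<eta> > 0 \<Longrightarrow> z + \<eta> *\<^sub>R a \<notin> C"
      by (auto simp: \<V>_def)
    have "- w \<in> span S"
      using w unfolding open_cone_def by (auto intro: span_neg span_sum span_scale span_base)
    then obtain e where e: "e > 0" "\<forall>d. 0 \<le> d \<and> d \<le> e \<longrightarrow> z + d *\<^sub>R (- w) \<in> open_cone S"
      using open_cone_span_nudge[OF fin[OF SB] z(1)] by blast
    then have "z + e *\<^sub>R (- w) \<in> open_cone S" by simp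
    then have "z + e *\<^sub>R (- w) \<in> C" using cover SB unfolding C_def by blast
    then have "(z + e *\<^sub>R (- w)) + e *\<^sub>R (w + \<eta> *\<^sub>R a) \<in> C"
      using cadd[OF _ cmul[OF wC]] e by simp
    then have "z + (e * \<eta>) *\<^sub>R a \<in> C" by (simp add: algebra_simps)
    with z(2)[of "e * \<eta>"] e \<eta> show False by auto
  qed
  have Vsub: "S \<in> \<B>" if "S \<in> \<V>" for S using that by (simp add: \<V>_def)
  have aspan: "a \<notin> span S" if S: "S \<in> \<V>" for S
  proof
    assume "a \<in> span S"
    obtain z where "z \<in> open_cone S" using S by (auto simp: \<V>_def)
    then obtain e where e: "e > 0" "\<forall>d. 0 \<le> d \<and> d \<le> e \<longrightarrow> z + d *\<^sub>R a \<in> open_cone S"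
      using open_cone_span_nudge[OF fin[OF Vsub[OF S]] _ \<open>a \<in> span S\<close>] by blast
    then have "z + e *\<^sub>R a \<in> open_cone S" by simp
    then show False using vis[OF S \<open>z \<in> open_cone S\<close> e(1)] cover Vsub[OF S] by (auto simp: C_def)
  qed
  have anot: "a \<notin> S" if "S \<in> \<B>" for S using sub[OF that] insert.hyps by blast
  define \<B>' where "\<B>' = \<B> \<union> insert a ` \<V>"
  have "convex_cone hull (insert a A) = (\<Union>S\<in>\<B>'. open_cone S)"
  proof
    show "(\<Union>S\<in>\<B>'. open_cone S) \<subseteq> convex_cone hull (insert a A)"
    proof (rule UN_least)
      fix S assume "S \<in> \<B>'"
      then have "S \<subseteq> insert a A" "finite S" using sub Vsub fin by (auto simp: \<B>'_def)
      then show "open_cone S \<subseteq> convex_cone hull (insert a A)"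
        using open_cone_subset_hull hull_mono by (metis order_trans)
    qed
    show "convex_cone hull (insert a A) \<subseteq> (\<Union>S\<in>\<B>'. open_cone S)"
    proof
      fix z assume "z \<in> convex_cone hull (insert a A)"
      then obtain w0 s0 where w0: "w0 \<in> C" "s0 \<ge> 0" "z = w0 + s0 *\<^sub>R a"
        unfolding C_def by (rule convex_cone_hull_insertE)
      \<comment> \<open>Walk from \<open>z\<close> in direction \<open>-a\<close> until
        \<open>C\<close> is first met. From that contact point every step back towards
        \<open>z\<close> leaves \<open>C\<close>, so the cell of the contact point is
        visible.\<close>
      define X where "X = {0..s0} \<inter> (\<lambda>s. z - s *\<^sub>R a) -` C"
      have "closed ((\<lambda>s. z - s *\<^sub>R a) -` C)"
        by (rule closed_vimage[OF closedC]) (intro continuous_intros)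
      then have "compact X" unfolding X_def by (rule compact_Int_closed[OF compact_Icc])
      moreover have "s0 \<in> X" using w0 by (simp add: X_def)
      ultimately have "\<exists>s\<in>X. \<forall>r\<in>X. s \<le> r"
        by (intro compact_attains_inf) auto
      then obtain s where s: "s \<in> X" "\<And>r. r \<in> X \<Longrightarrow> s \<le> r"
        by blast
      define w where "w = z - s *\<^sub>R a"
      have w: "w \<in> C" using s by (auto simp: X_def w_def)
      then obtain S where S: "S \<in> \<B>" "w \<in> open_cone S" using cover by (auto simp: C_def)
      show "z \<in> (\<Union>S\<in>\<B>'. open_cone S)"
      proof (cases "s = 0")
        case True then show ?thesis using S by (auto simp: w_def \<B>'_def)
      next
        case False
        then have sp: "s > 0" using s by (auto simp: X_def)
        have "w + \<eta> *\<^sub>R a \<notin> C" if "\<eta> > 0" for \<eta>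
        proof
          assume wC: "w + \<eta> *\<^sub>R a \<in> C"
          \<comment> \<open>The minimum keeps \<open>s - d\<close> nonnegative; convexity of
            \<open>C\<close> passes from the step \<eta> to the shorter step \<open>d\<close>,
            contradicting minimality of \<open>s\<close>.\<close>
          define d where "d = min \<eta> s"
          have d: "0 < d" "d \<le> \<eta>" "d \<le> s" using that sp by (auto simp: d_def)
          have "(1 - d/\<eta>) *\<^sub>R w + (d/\<eta>) *\<^sub>R (w + \<eta> *\<^sub>R a) \<in> C"
            using wC w conv d that by (intro convexD) auto
          then have "w + d *\<^sub>R a \<in> C" using that by (simp add: algebra_simps)
          then have "s - d \<in> X" using d s(1) by (auto simp: X_def w_def algebra_simps)
          from s(2)[OF this] d show False by simp
        qed
        then have "S \<in> \<V>" using S by (auto simp: \<V>_def)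
        moreover have "z \<in> open_cone (insert a S)"
          unfolding open_cone_insert[OF fin[OF S(1)] anot[OF S(1)]]
          using S(2) sp by (intro bexI[of _ w] exI[of _ s]) (auto simp: w_def)
        ultimately show ?thesis by (auto simp: \<B>'_def)
      qed
    qed
  qed
  moreover have "independent S \<and> S \<subseteq> insert a A" if SB': "S \<in> \<B>'" for S
  proof (cases "S \<in> \<B>")
    case True then show ?thesis using sub ind by blast
  next
    case False
    then obtain T where "T \<in> \<V>" "S = insert a T" using SB' unfolding \<B>'_def by blast
    then show ?thesis using sub[OF Vsub] ind[OF Vsub] aspan anot[OF Vsub] by (auto simp: independent_insert)
  qed
  moreover have "open_cone S \<inter> open_cone T = {}" if ST: "S \<in> \<B>'" "T \<in> \<B>'" "S \<noteq> T" for S T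
  proof -
    \<comment> \<open>Joined cells lie outside \<open>C\<close> by \<open>vis\<close>, and the old
      cells lie inside it.\<close>
    have one: False if S: "S \<in> \<B>" and T: "T \<in> \<V>" and z: "z \<in> open_cone S" "z \<in> open_cone (insert a T)" for S T z
    proof -
      obtain w s where w: "w \<in> open_cone T" "s > 0" "z = w + s *\<^sub>R a"
        using z(2) open_cone_insert[OF fin[OF Vsub] anot[OF Vsub], OF T T] by blast
      have "z \<in> C" using S z(1) cover unfolding C_def by blast
      then show False using vis[OF T w(1,2)] w(3) by simp
    qed
    have two: "S = T" if S: "S \<in> \<V>" and T: "T \<in> \<V>" and z: "z \<in> open_cone (insert a S)" "z \<in> open_cone (insert a T)" for S T z
    proof -
      obtain w s where w: "w \<in> open_cone S" "s > 0" "z = w + s *\<^sub>R a"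
        using z(1) open_cone_insert[OF fin[OF Vsub] anot[OF Vsub], OF S S] by blast
      obtain v r where v: "v \<in> open_cone T" "r > 0" "z = v + r *\<^sub>R a"
        using z(2) open_cone_insert[OF fin[OF Vsub] anot[OF Vsub], OF T T] by blast
      have C: "w \<in> C" "v \<in> C" using cover w v Vsub S T by (auto simp: C_def)
      \<comment> \<open>Otherwise one of \<open>w\<close>, \<open>v\<close> arises from the other by
        adding a positive multiple of \<open>a\<close>, although both belong to
        \<open>C\<close>.\<close>
      have "s = r"
      proof (rule ccontr)
        assume "s \<noteq> r"
        then consider "s > r" | "r > s" by linarith
        then show False
        proof cases
          case 1
          have "w + (s - r) *\<^sub>R a = v" using w v by (simp add: algebra_simps)
          then show False using vis[OF S w(1), of "s - r"] 1 C by simp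
        next
          case 2
          have "v + (r - s) *\<^sub>R a = w" using w v by (simp add: algebra_simps)
          then show False using vis[OF T v(1), of "r - s"] 2 C by simp
        qed
      qed
      then have "w = v" using w v by simp
      then show ?thesis using disj[OF Vsub Vsub, OF S T] w v by blast
    qed
    show ?thesis
    proof (rule ccontr)
      assume "open_cone S \<inter> open_cone T \<noteq> {}"
      then obtain z where z: "z \<in> open_cone S" "z \<in> open_cone T" by blast
      from ST(1,2) consider "S \<in> \<B>" "T \<in> \<B>" | T' where "S \<in> \<B>" "T' \<in> \<V>" "T = insert a T'"
        | S' where "S' \<in> \<V>" "S = insert a S'" "T \<in> \<B>"
        | S' T' where "S' \<in> \<V>" "S = insert a S'" "T' \<in> \<V>" "T = insert a T'"
        unfolding \<B>'_def by blast
      then show False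
      proof cases
        case 1 then show False using disj ST(3) z by blast
      next
        case 2 then show False using one z by simp
      next
        case 3 then show False using one z by simp
      next
        case 4 then show False using two[of S' T' z] z ST(3) by simp
      qed
    qed
  qed
  ultimately show ?case by (intro exI[of _ \<B>'] conjI ballI impI) simp_all
qed

section \<open>The Steiner polynomial\<close>

text \<open>The last two coordinates force the coefficients of the two distinguished generators, and
  their positivity turns into the two strict sum bounds. The remaining coefficients are free;
  \<open>v z\<close> is p - p0 or q - q0, depending on the kind of \<open>z\<close>.\<close>

lemma cell_param:
  fixes S :: "('a::real_vector \<times> real \<times> real) set"
  assumes fin: "finite S" and S: "S \<subseteq> P \<times> {(1,0)} \<union> Q \<times> {(0,1)}"
    and p0: "(p0,1,0) \<in> S" and q0: "(q0,0,1) \<in> S"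
    and S'_def: "S' = S - {(p0,1,0),(q0,0,1)}"
    and v_def: "\<And>z. v z = fst z - fst (snd z) *\<^sub>R p0 - snd (snd z) *\<^sub>R q0"
  shows "(x,1,l) \<in> open_cone S \<longleftrightarrow> (\<exists>t. (\<forall>z\<in>S'. t z > 0) \<and> (\<Sum>z\<in>S'. t z * fst (snd z)) < 1 \<and>
     (\<Sum>z\<in>S'. t z * snd (snd z)) < l \<and> x = p0 + l *\<^sub>R q0 + (\<Sum>z\<in>S'. t z *\<^sub>R v z))" (is "_ \<longleftrightarrow> ?R")
proof -
  let ?p = "(p0,1,0) :: 'a \<times> real \<times> real" and ?q = "(q0,0,1) :: 'a \<times> real \<times> real"
  let ?A = "\<lambda>t. \<Sum>z\<in>S'. t z * fst (snd z)" and ?B = "\<lambda>t. \<Sum>z\<in>S'. t z * snd (snd z)"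
  let ?F = "\<lambda>t. \<Sum>z\<in>S'. t z *\<^sub>R fst z" and ?V = "\<lambda>t. \<Sum>z\<in>S'. t z *\<^sub>R v z"
  have S_eq: "S = insert ?p (insert ?q S')" and notin: "?p \<notin> insert ?q S'" "?q \<notin> S'" "finite S'"
    using p0 q0 fin by (auto simp: S'_def)
  have sumS: "(\<Sum>z\<in>S. t z *\<^sub>R z) = t ?p *\<^sub>R ?p + (t ?q *\<^sub>R ?q + (\<Sum>z\<in>S'. t z *\<^sub>R z))" for t
    using notin by (simp add: S_eq)
  have c1: "fst (\<Sum>z\<in>S'. t z *\<^sub>R z) = ?F t"
    "fst (snd (\<Sum>z\<in>S'. t z *\<^sub>R z)) = ?A t"
    "snd (snd (\<Sum>z\<in>S'. t z *\<^sub>R z)) = ?B t" for t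
    by (simp_all add: fst_sum snd_sum)
  have sumv: "?V t = ?F t - ?A t *\<^sub>R p0 -
     ?B t *\<^sub>R q0" for t
    by (simp add: v_def scaleR_diff_right sum_subtractf scaleR_sum_left)
  have eq: "(x,1,l) = (\<Sum>z\<in>S. t z *\<^sub>R z) \<longleftrightarrow> x = p0 + l *\<^sub>R q0 + ?V t \<and>
      t ?p = 1 - ?A t \<and> t ?q = l - ?B t" for t
  proof -
    have "(x,1,l) = (\<Sum>z\<in>S. t z *\<^sub>R z) \<longleftrightarrow>
       t ?p = 1 - ?A t \<and> t ?q = l - ?B t \<and>
       x = t ?p *\<^sub>R p0 + (t ?q *\<^sub>R q0 + ?F t)"
      unfolding sumS by (auto simp: prod_eq_iff c1)
    also have "\<dots> \<longleftrightarrow> t ?p = 1 - ?A t \<and> t ?q = l - ?B t \<and>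
       x = p0 + l *\<^sub>R q0 + ?V t"
    proof (intro conj_cong refl)
      assume p: "t ?p = 1 - ?A t" and q: "t ?q = l - ?B t"
      show "x = t ?p *\<^sub>R p0 + (t ?q *\<^sub>R q0 + ?F t) \<longleftrightarrow>
        x = p0 + l *\<^sub>R q0 + ?V t"
        unfolding sumv p q by (simp add: algebra_simps)
    qed
    finally show ?thesis by blast
  qed
  show ?thesis
  proof
    assume "(x,1,l) \<in> open_cone S"
    then obtain t where "(x,1,l) = (\<Sum>z\<in>S. t z *\<^sub>R z)" "\<forall>z\<in>S. t z > 0"
      by (auto simp: open_cone_def)
    moreover from this have "t ?p > 0" "t ?q > 0" using p0 q0 by blast+
    ultimately show ?R
      unfolding eq by (intro exI[of _ t]) (auto simp: S'_def)
  next
    assume ?R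
    then obtain t where t: "\<forall>z\<in>S'. t z > 0" "?A t < 1"
     "?B t < l" "x = p0 + l *\<^sub>R q0 + ?V t" by blast
    define u where "u = t(?p := 1 - ?A t, ?q := l - ?B t)"
    have u: "u z = t z" if "z \<in> S'" for z using that by (auto simp: u_def S'_def)
    have "(x,1,l) = (\<Sum>z\<in>S. u z *\<^sub>R z)"
      unfolding eq by (simp add: u t(4)) (simp add: u_def)
    moreover have "\<forall>z\<in>S. u z > 0"
      unfolding S_eq using t u by (auto simp: u_def)
    ultimately show "(x,1,l) \<in> open_cone S" unfolding open_cone_def by blast
  qed
qed

text \<open>A cell with generators of one kind only misses the level (1,l). Otherwise independence
  in dimension n + 2 leaves at most n free coefficients. With fewer than n the slice lies in a
  proper affine subspace; with exactly n it is an affine image of a product of two open simplices,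
  one of them of size \<open>l\<close>. So \<open>k\<close> counts the free generators coming from
  \<open>Q\<close>.\<close>

lemma cell_volume:
  fixes S :: "((real^'n) \<times> real \<times> real) set"
  assumes S: "S \<subseteq> P \<times> {(1,0)} \<union> Q \<times> {(0,1)}" and ind: "independent S"
  shows "\<exists>c k. k \<le> CARD('n) \<and> (\<forall>l>0. {x. (x,1,l) \<in> open_cone S} \<in> lmeasurable \<and>
     vol {x. (x,1,l) \<in> open_cone S} = c * l ^ k)"
proof (cases "\<exists>p0 q0. (p0,1,0) \<in> S \<and> (q0,0,1) \<in> S")
  case False
  have "{x. (x,1,l) \<in> open_cone S} = {}" if "l > 0" for l
  proof (rule ccontr)
    assume "{x. (x,1,l) \<in> open_cone S} \<noteq> {}"
    then obtain x t where xt: "(x,1,l) = (\<Sum>z\<in>S. t z *\<^sub>R z)" by (auto simp: open_cone_def)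
    from arg_cong[OF xt, of "\<lambda>z. fst (snd z)"] have 1: "1 = (\<Sum>z\<in>S. t z * fst (snd z))"
      by (simp add: fst_sum snd_sum)
    from arg_cong[OF xt, of "\<lambda>z. snd (snd z)"] have 2: "l = (\<Sum>z\<in>S. t z * snd (snd z))"
      by (simp add: fst_sum snd_sum)
    from False consider "\<forall>z\<in>S. fst (snd z) = 0" | "\<forall>z\<in>S. snd (snd z) = 0" using S by fastforce
    then show False using 1 2 that by cases simp_all
  qed
  then show ?thesis by (intro exI[of _ 0]) auto
next
  case True
  then obtain p0 q0 where p0: "(p0,1,0) \<in> S" and q0: "(q0,0,1) \<in> S" by blast
  have fin: "finite S" and cardS: "card S \<le> CARD('n) + 2"
    using independent_bound[OF ind] by auto
  define S' where "S' = S - {(p0,1,0),(q0,0,1)}"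
  define v where "v z = fst z - fst (snd z) *\<^sub>R p0 - snd (snd z) *\<^sub>R q0" for z :: "(real^'n) \<times> real \<times> real"
  note param = cell_param[OF fin S p0 q0 S'_def v_def]
  have finS': "finite S'" using fin by (simp add: S'_def)
  have "card S' = card S - 2" using p0 q0 fin by (simp add: S'_def card_Diff_subset)
  then have card: "card S' \<le> CARD('n)" using cardS by linarith
  have bas: "fst (snd z) = 1 \<and> snd (snd z) = 0 \<or> fst (snd z) = 0 \<and> snd (snd z) = 1" if "z \<in> S'" for z
    using that S by (auto simp: S'_def)
  show ?thesis
  proof (cases "card S' < CARD('n)")
    case True
    have "negligible {x. (x,1,l) \<in> open_cone S}" for l
    proof -
      have "{x. (x,1,l) \<in> open_cone S} \<subseteq> (+) (p0 + l *\<^sub>R q0) ` span (v ` S')"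
      proof
        fix x assume "x \<in> {x. (x,1,l) \<in> open_cone S}"
        then obtain t where "x = p0 + l *\<^sub>R q0 + (\<Sum>z\<in>S'. t z *\<^sub>R v z)" unfolding param by blast
        moreover have "(\<Sum>z\<in>S'. t z *\<^sub>R v z) \<in> span (v ` S')"
          by (intro span_sum span_scale span_base imageI)
        ultimately show "x \<in> (+) (p0 + l *\<^sub>R q0) ` span (v ` S')" by blast
      qed
      moreover have "dim (span (v ` S')) < DIM(real^'n)"
        using True card_image_le[OF finS', of v] dim_le_card'[of "v ` S'"] finS' by (simp add: dim_span)
      ultimately show ?thesis
        using negligible_lowdim negligible_subset negligible_translation by blast
    qed
    then show ?thesis
      by (intro exI[of _ 0]) (auto simp: negligible_iff_measure)
  next
    case False
    then have "card S' = card (UNIV :: 'n set)" using card by simp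
    then obtain b :: "'n \<Rightarrow> _" where b: "bij_betw b UNIV S'"
      using finite_same_card_bij[OF finite finS'] by metis
    define J where "J = {i. snd (snd (b i)) = 1}"
    define B where "B y = (\<Sum>i\<in>UNIV. y $ i *\<^sub>R v (b i))" for y :: "real^'n"
    have linB: "linear B"
      unfolding B_def by (rule linearI) (simp_all add: algebra_simps sum.distrib scaleR_sum_right)
    obtain m where m: "\<And>T. T \<in> lmeasurable \<Longrightarrow> B ` T \<in> lmeasurable \<and> vol (B ` T) = m * vol T"
      using linear_scales_volume[OF linB] unfolding scales_volume_def by blast
    \<comment> \<open>Dividing the coefficients indexed by \<open>J\<close> by \<open>l\<close>
      makes the parameter domain \<Delta> independent of \<open>l\<close>; stretching back
      contributes the factor \<open>l ^ card J\<close>.\<close>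
    define D where "D l y = (\<chi> i. (if i \<in> J then l else 1) * y $ i)" for l and y :: "real^'n"
    define \<Delta> where "\<Delta> = {y :: real^'n. (\<forall>i. y $ i > 0) \<and> (\<Sum>i\<in>- J. y $ i) < 1 \<and> (\<Sum>i\<in>J. y $ i) < 1}"
    have "\<Delta> \<subseteq> cbox 0 1"
    proof
      fix y assume y: "y \<in> \<Delta>"
      have "y $ i \<le> 1" for i
      proof (cases "i \<in> J")
        case True
        then have "y $ i \<le> (\<Sum>i\<in>J. y $ i)" using y by (intro member_le_sum) (auto simp: \<Delta>_def intro: less_imp_le)
        then show ?thesis using y by (simp add: \<Delta>_def)
      next
        case False
        then have "y $ i \<le> (\<Sum>i\<in>-J. y $ i)" using y by (intro member_le_sum) (auto simp: \<Delta>_def intro: less_imp_le)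
        then show ?thesis using y by (simp add: \<Delta>_def)
      qed
      then show "y \<in> cbox 0 1" using y by (auto simp: mem_box_cart \<Delta>_def intro: less_imp_le)
    qed
    then have "bounded \<Delta>" using bounded_cbox bounded_subset by blast
    moreover have "open \<Delta>"
      unfolding \<Delta>_def Collect_conj_eq Collect_all_eq
      by (intro open_Int open_INT open_Collect_less continuous_intros ballI) auto
    ultimately have \<Delta>: "\<Delta> \<in> lmeasurable" by (rule lmeasurable_open)
    have reidx: "(\<Sum>z\<in>S'. h z) = (\<Sum>i\<in>UNIV. h (b i))" for h :: "_ \<Rightarrow> 'c::comm_monoid_add"
      using sum.reindex_bij_betw[OF b] by metis
    have bS: "b i \<in> S'" for i using b by (auto simp: bij_betw_def)
    have ab: "fst (snd (b i)) = (if i \<in> J then 0 else 1)" "snd (snd (b i)) = (if i \<in> J then 1 else 0)" for i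
      using bas[OF bS[of i]] by (auto simp: J_def)
    have cell: "{x. (x,1,l) \<in> open_cone S} = (+) (p0 + l *\<^sub>R q0) ` B ` D l ` \<Delta>" if l: "l > 0" for l
    proof (rule set_eqI)
      fix x
      define Q where "Q t \<longleftrightarrow> (\<forall>i. t (b i) > 0) \<and> (\<Sum>i\<in>-J. t (b i)) < 1 \<and> (\<Sum>i\<in>J. t (b i)) < l \<and>
        x = p0 + l *\<^sub>R q0 + (\<Sum>i\<in>UNIV. t (b i) *\<^sub>R v (b i))" for t
      have "(\<forall>z\<in>S'. t z > 0) \<longleftrightarrow> (\<forall>i. t (b i) > 0)" for t :: "_ \<Rightarrow> real"
        using b by (auto simp: bij_betw_def)
      then have "x \<in> {x. (x,1,l) \<in> open_cone S} \<longleftrightarrow> (\<exists>t. Q t)"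
        unfolding mem_Collect_eq param reidx ab Q_def
        by (simp add: if_distrib sum.If_cases Compl_eq cong: if_cong)
      also have "\<dots> \<longleftrightarrow> (\<exists>y\<in>\<Delta>. x = p0 + l *\<^sub>R q0 + B (D l y))"
      proof
        assume "\<exists>t. Q t"
        then obtain t where t: "\<forall>i. t (b i) > 0" "(\<Sum>i\<in>-J. t (b i)) < 1"
         "(\<Sum>i\<in>J. t (b i)) < l" "x = p0 + l *\<^sub>R q0 + (\<Sum>i\<in>UNIV. t (b i) *\<^sub>R v (b i))"
          unfolding Q_def by blast
        define y where "y = (\<chi> i. t (b i) / (if i \<in> J then l else 1))"
        have "(\<Sum>i\<in>J. y $ i) = (\<Sum>i\<in>J. t (b i)) / l" by (simp add: y_def sum_divide_distrib)
        then have "y \<in> \<Delta>" using t l by (simp add: \<Delta>_def) (simp add: y_def)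
        moreover have "D l y $ i = t (b i)" for i using l by (simp add: D_def y_def)
        then have "B (D l y) = (\<Sum>i\<in>UNIV. t (b i) *\<^sub>R v (b i))" by (simp add: B_def)
        ultimately show "\<exists>y\<in>\<Delta>. x = p0 + l *\<^sub>R q0 + B (D l y)" using t(4) by metis
      next
        assume "\<exists>y\<in>\<Delta>. x = p0 + l *\<^sub>R q0 + B (D l y)"
        then obtain y where y: "y \<in> \<Delta>" "x = p0 + l *\<^sub>R q0 + B (D l y)" by blast
        define t where "t z = D l y $ (the_inv_into UNIV b z)" for z
        have t: "t (b i) = (if i \<in> J then l else 1) * y $ i" for i
          using b by (simp add: t_def the_inv_into_f_f bij_betw_def D_def)
        have "(\<Sum>i\<in>J. t (b i)) = l * (\<Sum>i\<in>J. y $ i)" by (simp add: t sum_distrib_left)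
        also have "\<dots> < l * 1" using y(1) l by (intro mult_strict_left_mono) (auto simp: \<Delta>_def)
        finally have "(\<Sum>i\<in>J. t (b i)) < l" by simp
        moreover have "(\<Sum>i\<in>-J. t (b i)) < 1" using y(1) by (simp add: t \<Delta>_def)
        moreover have "\<forall>i. t (b i) > 0" using y(1) l by (simp add: t \<Delta>_def)
        moreover have "x = p0 + l *\<^sub>R q0 + (\<Sum>i\<in>UNIV. t (b i) *\<^sub>R v (b i))"
          using y(2) by (simp add: B_def t D_def)
        ultimately show "\<exists>t. Q t" unfolding Q_def by blast
      qed
      also have "\<dots> \<longleftrightarrow> x \<in> (+) (p0 + l *\<^sub>R q0) ` B ` D l ` \<Delta>" by blast
      finally show "x \<in> {x. (x,1,l) \<in> open_cone S} \<longleftrightarrow> x \<in> (+) (p0 + l *\<^sub>R q0) ` B ` D l ` \<Delta>" .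
    qed
    have "{x. (x,1,l) \<in> open_cone S} \<in> lmeasurable \<and>
      vol {x. (x,1,l) \<in> open_cone S} = m * vol \<Delta> * l ^ card J" if l: "l > 0" for l
    proof -
      have D: "D l ` \<Delta> \<in> lmeasurable"
        "vol (D l ` \<Delta>) = \<bar>\<Prod>i\<in>UNIV. if i \<in> J then l else 1\<bar> * vol \<Delta>"
        using measurable_stretch[OF \<Delta>, of "\<lambda>i. if i \<in> J then l else 1"]
          measure_stretch[OF \<Delta>, of "\<lambda>i. if i \<in> J then l else 1"]
        unfolding D_def[abs_def] by blast+
      have "(\<Prod>i\<in>UNIV. if i \<in> J then l else 1) = l ^ card J"
        by (simp add: prod.If_cases)
      then show ?thesis unfolding cell[OF l] measure_translation
        using D l m[OF D(1)] measurable_translation[of "B ` D l ` \<Delta>"] by simp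
    qed
    then show ?thesis
      by (intro exI[of _ "m * vol \<Delta>"] exI[of _ "card J"]) (auto intro: card_mono)
  qed
qed

lemma mem_cone_level:
  fixes P :: "'a::real_vector set"
  assumes "P \<noteq> {}"
  shows "z \<in> convex_cone hull (P \<times> {w}) \<longleftrightarrow> (\<exists>y\<in>convex hull P. \<exists>c\<ge>0. z = (c *\<^sub>R y, c *\<^sub>R w))"
proof -
  have "P \<times> {w} \<noteq> {}" using assms by auto
  from convex_cone_hull_convex_hull_nonempty[OF this] show ?thesis
    by (auto simp: convex_hull_Times)
qed

text \<open>The Cayley trick: a point of the cone is a multiple of some (y,1,0) plus a multiple of
  some (y',0,1), and the level (1,l) fixes the multipliers as 1 and \<open>l\<close>.\<close>

lemma mem_cayley_cone:
  fixes P Q :: "'a::real_vector set"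
  assumes "P \<noteq> {}" "Q \<noteq> {}" "l > 0"
  shows "(x,1::real,l) \<in> convex_cone hull (P \<times> {(1,0)} \<union> Q \<times> {(0,1)}) \<longleftrightarrow>
    x \<in> convex hull P + (*\<^sub>R) l ` (convex hull Q)"
proof -
  have "(x,1::real,l) \<in> convex_cone hull (P \<times> {(1,0)} \<union> Q \<times> {(0,1)}) \<longleftrightarrow>
    (\<exists>z\<in>convex_cone hull (P \<times> {(1,0)}). \<exists>z'\<in>convex_cone hull (Q \<times> {(0,1)}). (x,1::real,l) = z + z')"
    unfolding convex_cone_hull_Un by (simp only: UN_iff singleton_iff)
  also have "\<dots> \<longleftrightarrow> (\<exists>y\<in>convex hull P. \<exists>y'\<in>convex hull Q. x = y + l *\<^sub>R y')" (is "?L \<longleftrightarrow> ?R")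
  proof
    assume ?L then show ?R
      using assms by (auto simp: mem_cone_level[OF assms(1)] mem_cone_level[OF assms(2)]) blast
  next
    assume ?R
    then obtain y y' where y: "y \<in> convex hull P" "y' \<in> convex hull Q" "x = y + l *\<^sub>R y'" by blast
    show ?L
    proof (intro bexI)
      show "(x,1::real,l) = (1 *\<^sub>R y, 1 *\<^sub>R (1,0)) + (l *\<^sub>R y', l *\<^sub>R (0,1))" using y by simp
      show "(1 *\<^sub>R y, 1 *\<^sub>R (1,0)) \<in> convex_cone hull (P \<times> {(1,0)})"
        unfolding mem_cone_level[OF assms(1)] using y by (intro bexI[of _ y] exI[of _ 1]) simp_all
      show "(l *\<^sub>R y', l *\<^sub>R (0,1)) \<in> convex_cone hull (Q \<times> {(0,1)})"
        unfolding mem_cone_level[OF assms(2)] using y assms by (intro bexI[of _ y'] exI[of _ l]) simp_all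
    qed
  qed
  also have "\<dots> \<longleftrightarrow> x \<in> convex hull P + (*\<^sub>R) l ` (convex hull Q)"
    by (auto simp: set_plus_def)
  finally show ?thesis .
qed

text \<open>The point \<open>l = 0\<close> is left out because the cellwise formulas break down
  there: that slice is carried by cells without generators from \<open>Q\<close>, which contribute
  nothing for positive \<open>l\<close>.\<close>

proposition polytope_sum_volume_polynomial:
  fixes P Q :: "(real^'n) set"
  assumes "finite P" "finite Q" "P \<noteq> {}" "Q \<noteq> {}"
  shows "\<exists>p. degree p \<le> CARD('n) \<and>
    (\<forall>l>0. vol (convex hull P + (*\<^sub>R) l ` (convex hull Q)) = poly p l)"
proof -
  define A where "A = P \<times> {(1::real,0::real)} \<union> Q \<times> {(0,1)}"
  have finA: "finite A" using assms by (simp add: A_def)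
  from simplicial_cone_decomposition[OF finA] obtain \<B>
    where B: "\<forall>S\<in>\<B>. S \<subseteq> A \<and> independent S"
      and cover: "convex_cone hull A = (\<Union>S\<in>\<B>. open_cone S)"
      and disj: "\<forall>S\<in>\<B>. \<forall>T\<in>\<B>. S \<noteq> T \<longrightarrow> open_cone S \<inter> open_cone T = {}"
    by (elim exE conjE) (rule that)
  have finB: "finite \<B>" using B finA by (intro finite_subset[of \<B> "Pow A"]) auto
  have "\<exists>c k. k \<le> CARD('n) \<and> (\<forall>l>0. {x. (x,1,l) \<in> open_cone S} \<in> lmeasurable \<and>
     vol {x. (x,1,l) \<in> open_cone S} = c * l ^ k)" if "S \<in> \<B>" for S
    using cell_volume[of S P Q] B that by (simp add: A_def)
  then obtain c k where ck: "\<And>S. S \<in> \<B> \<Longrightarrow> k S \<le> CARD('n)"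
    "\<And>S l. S \<in> \<B> \<Longrightarrow> l > 0 \<Longrightarrow> {x. (x,1,l) \<in> open_cone S} \<in> lmeasurable"
    "\<And>S l. S \<in> \<B> \<Longrightarrow> l > 0 \<Longrightarrow> vol {x. (x,1,l) \<in> open_cone S} = c S * l ^ k S"
    by metis
  define p where "p = (\<Sum>S\<in>\<B>. monom (c S) (k S))"
  have "degree p \<le> CARD('n)"
    unfolding p_def by (intro degree_sum_le finB) (use ck(1) degree_monom_le order_trans in blast)
  moreover have "vol (convex hull P + (*\<^sub>R) l ` (convex hull Q)) = poly p l" if l: "l > 0" for l
  proof -
    have "convex hull P + (*\<^sub>R) l ` (convex hull Q) = (\<Union>S\<in>\<B>. {x. (x,1,l) \<in> open_cone S})"
      using mem_cayley_cone[OF assms(3,4) l] cover by (auto simp: A_def)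
    also have "vol \<dots> = (\<Sum>S\<in>\<B>. vol {x. (x,1,l) \<in> open_cone S})"
    proof (rule measure_UNION_AE[OF finB])
      show "pairwise (\<lambda>S T. AE x in lebesgue. x \<notin> {x. (x,1,l) \<in> open_cone S} \<or> x \<notin> {x. (x,1,l) \<in> open_cone T}) \<B>"
        using disj by (fastforce simp: pairwise_def)
    qed (use ck(2) l in auto)
    also have "\<dots> = poly p l"
      using ck(3)[OF _ l] by (simp add: p_def poly_sum poly_monom)
    finally show ?thesis .
  qed
  ultimately show ?thesis by blast
qed

section \<open>Limits of Steiner polynomials: from polytopes to convex bodies\<close>

lemma poly_sum_coeff:
  assumes "degree (p :: real poly) \<le> n" shows "poly p x = (\<Sum>j\<le>n. coeff p j * x ^ j)"
  unfolding poly_altdef using assms by (intro sum.mono_neutral_left) (auto simp: coeff_eq_0)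

text \<open>Lagrange interpolation writes each coefficient as a fixed linear combination of n + 1
  values, so pointwise convergence carries over to coefficients. The nodes are 1, ..., n + 1 since
  convergence is given at positive points only.\<close>

lemma poly_coeff_tendsto:
  fixes p :: "nat \<Rightarrow> real poly" and f :: "real \<Rightarrow> real"
  assumes deg: "\<And>m. degree (p m) \<le> n" and lim: "\<And>x. x > 0 \<Longrightarrow> (\<lambda>m. poly (p m) x) \<longlonglongrightarrow> f x"
  obtains q where "degree q \<le> n" "\<And>x. x > 0 \<Longrightarrow> f x = poly q x"
    "\<And>j. (\<lambda>m. coeff (p m) j) \<longlonglongrightarrow> coeff q j"
proof -
  define \<ll> :: "nat \<Rightarrow> real poly" where
    "\<ll> i = (\<Prod>j\<in>{..n} - {i}. smult (1 / (real i - real j)) [:- real (Suc j), 1:])" for i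
  have deg_l: "degree (\<ll> i) \<le> n" if "i \<le> n" for i
  proof -
    have "degree (\<ll> i) \<le> (\<Sum>j\<in>{..n} - {i}. degree (smult (1 / (real i - real j)) [:- real (Suc j), 1:]))"
      unfolding \<ll>_def using degree_prod_sum_le[of "{..n} - {i}" "\<lambda>j. smult (1 / (real i - real j)) [:- real (Suc j), 1:]"]
      by (simp add: o_def)
    also have "\<dots> \<le> (\<Sum>j\<in>{..n} - {i}. 1)" by (intro sum_mono) simp
    also have "\<dots> \<le> n" using that by simp
    finally show ?thesis .
  qed
  have lin: "poly (smult c [:- a, 1:]) x = c * (x - a)" for c a x :: real by (simp add: algebra_simps)
  have l_node: "poly (\<ll> i) (real (Suc k)) = (if i = k then 1 else 0)" if "i \<le> n" "k \<le> n" for i k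
  proof (cases "i = k")
    case True
    have "poly (\<ll> i) (real (Suc k)) = (\<Prod>j\<in>{..n} - {i}. (1 / (real i - real j)) * (real k - real j))"
      unfolding \<ll>_def poly_prod lin by simp
    also have "\<dots> = (\<Prod>j\<in>{..n} - {i}. 1)" using True by (intro prod.cong) auto
    finally show ?thesis using True by simp
  next
    case False
    have "poly (\<ll> i) (real (Suc k)) = 0"
      unfolding \<ll>_def poly_prod lin using False that by (intro prod_zero) (auto intro!: bexI[of _ k])
    then show ?thesis using False by simp
  qed
  have interp: "P = (\<Sum>i\<le>n. smult (poly P (real (Suc i))) (\<ll> i))" if "degree P \<le> n" for P
  proof (rule poly_eqI_degree[of "(\<lambda>i. real (Suc i)) ` {..n}"])
    fix x assume "x \<in> (\<lambda>i. real (Suc i)) ` {..n}"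
    then obtain k where k: "k \<le> n" "x = real (Suc k)" by auto
    show "poly P x = poly (\<Sum>i\<le>n. smult (poly P (real (Suc i))) (\<ll> i)) x"
      unfolding k(2) poly_sum poly_smult using k(1) by (simp add: l_node if_distrib[of "\<lambda>u. _ * u"] del: of_nat_Suc cong: if_cong)
  next
    have "card ((\<lambda>i. real (Suc i)) ` {..n}) = Suc n" by (subst card_image) (auto simp: inj_on_def)
    moreover have "degree (\<Sum>i\<le>n. smult (poly P (real (Suc i))) (\<ll> i)) \<le> n"
      by (intro degree_sum_le) (simp_all add: deg_l)
    ultimately show "card ((\<lambda>i. real (Suc i)) ` {..n}) > degree P"
      "card ((\<lambda>i. real (Suc i)) ` {..n}) > degree (\<Sum>i\<le>n. smult (poly P (real (Suc i))) (\<ll> i))"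
      using that by linarith+
  qed
  define q where "q = (\<Sum>i\<le>n. smult (f (real (Suc i))) (\<ll> i))"
  have "degree q \<le> n"
    unfolding q_def by (intro degree_sum_le) (simp_all add: deg_l)
  moreover have co: "(\<lambda>m. coeff (p m) j) \<longlonglongrightarrow> coeff q j" for j
  proof -
    have "(\<lambda>m. \<Sum>i\<le>n. poly (p m) (real (Suc i)) * coeff (\<ll> i) j) \<longlonglongrightarrow> (\<Sum>i\<le>n. f (real (Suc i)) * coeff (\<ll> i) j)"
      by (intro tendsto_intros lim) simp
    moreover have "coeff (p m) j = (\<Sum>i\<le>n. poly (p m) (real (Suc i)) * coeff (\<ll> i) j)" for m
      by (subst interp[OF deg]) (simp add: coeff_sum)
    ultimately show ?thesis by (simp add: q_def coeff_sum)
  qed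
  moreover have "f x = poly q x" if "x > 0" for x
  proof -
    have "(\<lambda>m. poly (p m) x) \<longlonglongrightarrow> poly q x"
      unfolding poly_sum_coeff[OF deg] poly_sum_coeff[OF \<open>degree q \<le> n\<close>] by (intro tendsto_intros co)
    then show ?thesis using lim[OF that] LIMSEQ_unique by blast
  qed
  ultimately show ?thesis using that by blast
qed

lemma measure_scaleR: "vol ((*\<^sub>R) c ` S) = \<bar>c\<bar> ^ DIM('a) * vol (S :: 'a::euclidean_space set)"
  using measure_lebesgue_affine[of c 0 S] by simp

lemma convex_body_lmeasurable: "convex_body K \<Longrightarrow> K \<in> lmeasurable"
  by (simp add: convex_body_def lmeasurable_compact)

lemma convex_body_sum:
  assumes "convex_body K" "convex_body L" shows "convex_body (K + L)"
proof -
  have "K + L = (\<Union>x\<in>K. \<Union>y\<in>L. {x + y})" by (auto simp: set_plus_def)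
  then have "compact (K + L)" using assms compact_sums'[of K L] by (simp add: convex_body_def)
  moreover have "K + L \<noteq> {}" using assms by (auto simp: convex_body_def set_plus_def)
  ultimately show ?thesis using assms by (simp add: convex_body_def convex_set_plus)
qed

lemma convex_body_scale:
  assumes "convex_body K" shows "convex_body ((*\<^sub>R) c ` K)"
  using assms unfolding convex_body_def by (auto simp: compact_scaling convex_scaling)

lemma convex_body_translate:
  assumes "convex_body K" shows "convex_body ((+) a ` K)"
  using assms unfolding convex_body_def by (auto simp: compact_translation convex_translation)

lemma scale_set_plus: "(*\<^sub>R) c ` (A + B) = (*\<^sub>R) c ` A + (*\<^sub>R) c ` (B :: 'a::real_vector set)"
  by (force simp: set_plus_def scaleR_add_right image_iff)

lemma scale_scale: "(*\<^sub>R) a ` (*\<^sub>R) b ` S = (*\<^sub>R) (a * b) ` (S :: 'a::real_vector set)"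
  unfolding image_image by (rule image_cong) simp_all

lemma convex_sum_scale:
  assumes "convex K" "a \<ge> 0" "b \<ge> 0"
  shows "(*\<^sub>R) a ` K + (*\<^sub>R) b ` K = (*\<^sub>R) (a + b) ` (K :: 'a::real_vector set)"
proof
  show "(*\<^sub>R) (a + b) ` K \<subseteq> (*\<^sub>R) a ` K + (*\<^sub>R) b ` K"
    by (auto simp: set_plus_def scaleR_add_left)
  show "(*\<^sub>R) a ` K + (*\<^sub>R) b ` K \<subseteq> (*\<^sub>R) (a + b) ` K"
  proof
    fix z assume "z \<in> (*\<^sub>R) a ` K + (*\<^sub>R) b ` K"
    then obtain x y where xy: "x \<in> K" "y \<in> K" "z = a *\<^sub>R x + b *\<^sub>R y" by (auto simp: set_plus_def)
    show "z \<in> (*\<^sub>R) (a + b) ` K"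
    proof (cases "a + b = 0")
      case True then have "a = 0" "b = 0" using assms by auto
      then show ?thesis using xy by auto
    next
      case False
      then have ab: "a + b > 0" using assms by auto
      have "(a / (a + b)) *\<^sub>R x + (b / (a + b)) *\<^sub>R y \<in> K"
        using assms xy ab by (intro convexD) (auto simp: add_divide_distrib[symmetric])
      moreover have "z = (a + b) *\<^sub>R ((a / (a + b)) *\<^sub>R x + (b / (a + b)) *\<^sub>R y)"
        using ab xy by (simp add: scaleR_add_right)
      ultimately show ?thesis by blast
    qed
  qed
qed

lemma scale_subset_self:
  assumes "convex K" "0 \<in> K" "0 \<le> c" "c \<le> 1" shows "(*\<^sub>R) c ` K \<subseteq> (K :: 'a::real_vector set)"
  using convexD_alt[OF assms(1,2) _ assms(3,4)] by auto

lemma scale_mono: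
  assumes "convex K" "0 \<in> K" "0 \<le> c" "c \<le> d" shows "(*\<^sub>R) c ` K \<subseteq> (*\<^sub>R) d ` (K :: 'a::real_vector set)"
proof (cases "d = 0")
  case False
  then have "(*\<^sub>R) d ` (*\<^sub>R) (c / d) ` K \<subseteq> (*\<^sub>R) d ` K"
    using assms by (intro image_mono scale_subset_self) auto
  then show ?thesis using False by (simp add: scale_scale)
qed (use assms in auto)

text \<open>The shrunken body is a compact subset of the interior, hence covered by the interiors of
  finitely many boxes inside \<open>K\<close>; the vertices of these boxes generate the
  polytope.\<close>

lemma inner_polytope:
  fixes K :: "'a::euclidean_space set"
  assumes K: "convex_body K" and 0: "0 \<in> interior K" and c: "0 \<le> c" "c < 1"
  obtains P where "finite P" "P \<noteq> {}" "convex hull P \<subseteq> K" "(*\<^sub>R) c ` K \<subseteq> convex hull P"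
proof -
  have cK: "compact ((*\<^sub>R) c ` K)" using K by (auto simp: convex_body_def compact_scaling)
  have sub: "(*\<^sub>R) c ` K \<subseteq> interior K"
  proof
    fix y assume "y \<in> (*\<^sub>R) c ` K"
    then obtain x where x: "x \<in> K" "y = c *\<^sub>R x" by blast
    then show "y \<in> interior K"
      using mem_interior_convex_shrink[of K 0 x "1 - c"] K 0 c by (simp add: convex_body_def algebra_simps)
  qed
  have "\<exists>F. finite F \<and> x \<in> interior (convex hull F) \<and> convex hull F \<subseteq> K" if "x \<in> (*\<^sub>R) c ` K" for x
  proof -
    have "x \<in> interior K" using sub that by blast
    then obtain a b where ab: "cbox a b \<subseteq> interior K" "x \<in> box a b"
      using open_contains_cbox[OF open_interior] by metis
    obtain F where "finite F" "cbox a b = convex hull F" using closed_interval_as_convex_hull by blast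
    then show ?thesis using ab interior_subset[of K] interior_cbox[of a b] by (intro exI[of _ F]) auto
  qed
  then obtain F where F: "\<And>x. x \<in> (*\<^sub>R) c ` K \<Longrightarrow> finite (F x) \<and> x \<in> interior (convex hull (F x)) \<and> convex hull (F x) \<subseteq> K"
    by metis
  obtain X where X: "X \<subseteq> (*\<^sub>R) c ` K" "finite X" "(*\<^sub>R) c ` K \<subseteq> (\<Union>x\<in>X. interior (convex hull (F x)))"
  proof (rule compactE_image[OF cK, of "(*\<^sub>R) c ` K" "\<lambda>x. interior (convex hull (F x))"])
    show "(*\<^sub>R) c ` K \<subseteq> (\<Union>x\<in>(*\<^sub>R) c ` K. interior (convex hull F x))" using F by blast
  qed auto
  define P where "P = (\<Union>x\<in>X. F x)"
  show ?thesis
  proof (rule that)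
    show "finite P" using X F by (auto simp: P_def)
    show sub: "(*\<^sub>R) c ` K \<subseteq> convex hull P"
    proof
      fix y assume "y \<in> (*\<^sub>R) c ` K"
      then obtain x where "x \<in> X" "y \<in> convex hull (F x)" using X(3) interior_subset by blast
      then show "y \<in> convex hull P" using hull_mono[of "F x" P] by (auto simp: P_def)
    qed
    show "P \<noteq> {}" using sub K by (auto simp: convex_body_def)
    have "P \<subseteq> K"
    proof
      fix y assume "y \<in> P"
      then obtain x where "x \<in> X" "y \<in> F x" by (auto simp: P_def)
      then show "y \<in> K" using F[of x] X(1) hull_inc[of y "F x" convex] by blast
    qed
    then show "convex hull P \<subseteq> K" using K by (simp add: convex_body_def hull_minimal)
  qed
qed

lemma measure_convex_body_mono:
  "convex_body K \<Longrightarrow> convex_body L \<Longrightarrow> K \<subseteq> L \<Longrightarrow> vol K \<le> vol L"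
  by (intro vol_mono) (auto intro: convex_body_lmeasurable fmeasurableD)

text \<open>Closeness of bodies is measured by dilates. Sandwiching both summands between dilates by
  the same factors sandwiches the sum as well, and its volume then changes by at most the n-th
  powers of these factors.\<close>

lemma steiner_limit:
  fixes K E :: "(real^'n) set"
  assumes K: "convex_body K" and E: "convex_body E"
    and body: "\<And>m. convex_body (A m)" "\<And>m. convex_body (B m)"
    and c: "\<And>m. c m \<ge> 0" "c \<longlonglongrightarrow> 1" and d: "\<And>m. d m \<ge> 0" "d \<longlonglongrightarrow> 1"
    and sub: "\<And>m. (*\<^sub>R) (c m) ` K \<subseteq> A m" "\<And>m. A m \<subseteq> (*\<^sub>R) (d m) ` K"
      "\<And>m. (*\<^sub>R) (c m) ` E \<subseteq> B m" "\<And>m. B m \<subseteq> (*\<^sub>R) (d m) ` E"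
  shows "(\<lambda>m. vol (A m + (*\<^sub>R) l ` B m)) \<longlonglongrightarrow> vol (K + (*\<^sub>R) l ` E)"
proof (rule tendsto_sandwich)
  let ?S = "K + (*\<^sub>R) l ` E"
  have S: "convex_body ?S" "\<And>m. convex_body (A m + (*\<^sub>R) l ` B m)"
    by (intro convex_body_sum convex_body_scale K E body)+
  have eq: "(*\<^sub>R) r ` ?S = (*\<^sub>R) r ` K + (*\<^sub>R) l ` (*\<^sub>R) r ` E" for r
    by (simp add: scale_set_plus scale_scale mult.commute)
  show "\<forall>\<^sub>F m in sequentially. c m ^ CARD('n) * vol ?S \<le> vol (A m + (*\<^sub>R) l ` B m)"
  proof (rule always_eventually, rule allI)
    fix m
    have "(*\<^sub>R) (c m) ` ?S \<subseteq> A m + (*\<^sub>R) l ` B m"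
      unfolding eq by (intro set_plus_mono2 image_mono sub)
    from measure_convex_body_mono[OF convex_body_scale[OF S(1)] S(2) this]
    show "c m ^ CARD('n) * vol ?S \<le> vol (A m + (*\<^sub>R) l ` B m)"
      using c(1)[of m] by (simp add: measure_scaleR)
  qed
  show "\<forall>\<^sub>F m in sequentially. vol (A m + (*\<^sub>R) l ` B m) \<le> d m ^ CARD('n) * vol ?S"
  proof (rule always_eventually, rule allI)
    fix m
    have "A m + (*\<^sub>R) l ` B m \<subseteq> (*\<^sub>R) (d m) ` ?S"
      unfolding eq by (intro set_plus_mono2 image_mono sub)
    from measure_convex_body_mono[OF S(2) convex_body_scale[OF S(1)] this]
    show "vol (A m + (*\<^sub>R) l ` B m) \<le> d m ^ CARD('n) * vol ?S"
      using d(1)[of m] by (simp add: measure_scaleR)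
  qed
  show "(\<lambda>m. c m ^ CARD('n) * vol ?S) \<longlonglongrightarrow> vol ?S"
    using tendsto_mult[OF tendsto_power[OF c(2), of "CARD('n)"] tendsto_const[of "vol ?S"]] by simp
  show "(\<lambda>m. d m ^ CARD('n) * vol ?S) \<longlonglongrightarrow> vol ?S"
    using tendsto_mult[OF tendsto_power[OF d(2), of "CARD('n)"] tendsto_const[of "vol ?S"]] by simp
qed

lemma bounded_absorbed:
  fixes K :: "'a::euclidean_space set"
  assumes "0 \<in> interior K" "bounded E"
  obtains C where "C > 0" "E \<subseteq> (*\<^sub>R) C ` K"
proof -
  obtain r where r: "r > 0" "ball 0 r \<subseteq> K" using assms by (auto simp: mem_interior)
  obtain R where R: "R > 0" "E \<subseteq> ball 0 R" using bounded_subset_ballD[OF assms(2)] by blast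
  have "E \<subseteq> (*\<^sub>R) (R / r) ` K"
  proof
    fix x assume "x \<in> E"
    then have "norm x < R" using R by auto
    then have "norm ((r / R) *\<^sub>R x) < r" using r R by (simp add: field_simps)
    then have "(r / R) *\<^sub>R x \<in> K" using r by auto
    moreover have "x = (R / r) *\<^sub>R (r / R) *\<^sub>R x" using r R by simp
    ultimately show "x \<in> (*\<^sub>R) (R / r) ` K" by blast
  qed
  then show ?thesis using that r R by (meson divide_pos_pos)
qed

proposition steiner_polynomial_centred:
  fixes K E :: "(real^'n) set"
  assumes K: "convex_body K" "0 \<in> interior K" and E: "convex_body E" "0 \<in> interior E"
  shows "\<exists>p. degree p \<le> CARD('n) \<and> (\<forall>l\<ge>0. vol (K + (*\<^sub>R) l ` E) = poly p l)"
proof -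
  define c where "c m = 1 - 1 / real (Suc m)" for m
  have c: "0 \<le> c m" "c m < 1" for m by (auto simp: c_def)
  have clim: "c \<longlonglongrightarrow> 1"
    unfolding c_def using tendsto_diff[OF tendsto_const[of 1] LIMSEQ_inverse_real_of_nat]
    by (simp add: inverse_eq_divide)
  have "\<forall>m. \<exists>P. finite P \<and> P \<noteq> {} \<and> convex hull P \<subseteq> K \<and> (*\<^sub>R) (c m) ` K \<subseteq> convex hull P"
    using inner_polytope[OF K c] by metis
  then obtain P where P: "\<And>m. finite (P m)" "\<And>m. P m \<noteq> {}" "\<And>m. convex hull (P m) \<subseteq> K"
    "\<And>m. (*\<^sub>R) (c m) ` K \<subseteq> convex hull (P m)" by metis
  have "\<forall>m. \<exists>P. finite P \<and> P \<noteq> {} \<and> convex hull P \<subseteq> E \<and> (*\<^sub>R) (c m) ` E \<subseteq> convex hull P"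
    using inner_polytope[OF E c] by metis
  then obtain Q where Q: "\<And>m. finite (Q m)" "\<And>m. Q m \<noteq> {}" "\<And>m. convex hull (Q m) \<subseteq> E"
    "\<And>m. (*\<^sub>R) (c m) ` E \<subseteq> convex hull (Q m)" by metis
  have body: "convex_body (convex hull (P m))" "convex_body (convex hull (Q m))" for m
    using P(1,2) Q(1,2) by (auto simp: convex_body_def compact_convex_hull finite_imp_compact)
  have "\<forall>m. \<exists>p. degree p \<le> CARD('n) \<and>
    (\<forall>l>0. vol (convex hull P m + (*\<^sub>R) l ` (convex hull Q m)) = poly p l)"
    by (intro allI polytope_sum_volume_polynomial P Q)
  then obtain p where p: "\<And>m. degree (p m) \<le> CARD('n)"
    "\<And>m l. l > 0 \<Longrightarrow> vol (convex hull P m + (*\<^sub>R) l ` (convex hull Q m)) = poly (p m) l" by metis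
  have lim: "(\<lambda>m. vol (convex hull P m + (*\<^sub>R) l ` (convex hull Q m))) \<longlonglongrightarrow> vol (K + (*\<^sub>R) l ` E)" for l
  proof (rule steiner_limit[where c = c and d = "\<lambda>_. 1"])
    show "(\<lambda>_. 1) \<longlonglongrightarrow> (1 :: real)" by (rule tendsto_const)
  qed (simp_all add: P Q K E body c clim)
  have "(\<lambda>m. poly (p m) l) \<longlonglongrightarrow> vol (K + (*\<^sub>R) l ` E)" if "l > 0" for l
    using lim[of l] unfolding p(2)[OF that] .
  then obtain q where q: "degree q \<le> CARD('n)" "\<And>l. l > 0 \<Longrightarrow> vol (K + (*\<^sub>R) l ` E) = poly q l"
    using poly_coeff_tendsto[of p "CARD('n)" "\<lambda>l. vol (K + (*\<^sub>R) l ` E)", OF p(1)] by metis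
  obtain C where C: "C > 0" "E \<subseteq> (*\<^sub>R) C ` K"
    using bounded_absorbed[OF K(2)] E(1) by (metis convex_body_def compact_imp_bounded)
  have K0: "K + (*\<^sub>R) 0 ` E = K" using E(1) by (auto simp: set_plus_def convex_body_def)
  \<comment> \<open>So far the polynomial is identified only for positive \<open>l\<close>. The
    inclusions between K, K + l E and (1 + l C) K give continuity at 0.\<close>
  have "vol K = poly q 0"
  proof (rule LIMSEQ_unique)
    let ?l = "\<lambda>m. inverse (real (Suc m))"
    have "(\<lambda>m. poly q (?l m)) \<longlonglongrightarrow> poly q 0"
      by (intro tendsto_compose[OF poly_isCont[unfolded isCont_def]] LIMSEQ_inverse_real_of_nat)
    then show "(\<lambda>m. vol (K + (*\<^sub>R) (?l m) ` E)) \<longlonglongrightarrow> poly q 0"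
      by (subst q(2)) auto
    have K0': "M + (*\<^sub>R) 0 ` E = M" for M using E(1) by (auto simp: set_plus_def convex_body_def)
    have E0: "0 \<in> E" and cE: "convex E" using E interior_subset by (auto simp: convex_body_def)
    have dlim: "(\<lambda>m. 1 + ?l m * C) \<longlonglongrightarrow> 1 + 0 * C"
      by (intro tendsto_intros LIMSEQ_inverse_real_of_nat)
    have d1: "1 \<le> 1 + ?l m * C" for m using C by simp
    \<comment> \<open>The dummy summand with factor 0 makes this an instance of
      \<open>steiner_limit\<close>, in which the sums K + l E for l = 1/(m+1) approximate
      \<open>K\<close>.\<close>
    have "(\<lambda>m. vol (K + (*\<^sub>R) (?l m) ` E + (*\<^sub>R) 0 ` E)) \<longlonglongrightarrow> vol (K + (*\<^sub>R) 0 ` E)"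
    proof (rule steiner_limit[where c = "\<lambda>_. 1" and d = "\<lambda>m. 1 + ?l m * C"])
      show "convex_body (K + (*\<^sub>R) (?l m) ` E)" for m by (intro convex_body_sum convex_body_scale K E)
      show "(*\<^sub>R) 1 ` K \<subseteq> K + (*\<^sub>R) (?l m) ` E" for m
      proof
        fix x assume "x \<in> (*\<^sub>R) 1 ` K"
        with set_plus_intro[OF _ imageI[OF E0, of "(*\<^sub>R) (?l m)"], of x K]
        show "x \<in> K + (*\<^sub>R) (?l m) ` E" by simp
      qed
      have "K + (*\<^sub>R) (?l m) ` E \<subseteq> (*\<^sub>R) 1 ` K + (*\<^sub>R) (?l m) ` (*\<^sub>R) C ` K" for m
        by (intro set_plus_mono2 image_mono C) simp
      also have "(*\<^sub>R) 1 ` K + (*\<^sub>R) (?l m) ` (*\<^sub>R) C ` K = (*\<^sub>R) (1 + ?l m * C) ` K" for m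
        unfolding scale_scale using K(1) C by (intro convex_sum_scale) (auto simp: convex_body_def)
      finally show "K + (*\<^sub>R) (?l m) ` E \<subseteq> (*\<^sub>R) (1 + ?l m * C) ` K" for m .
      show "E \<subseteq> (*\<^sub>R) (1 + ?l m * C) ` E" for m using scale_mono[OF cE E0 _ d1] by simp
      show "0 \<le> 1 + ?l m * C" for m using d1[of m] by simp
    qed (use K E dlim in simp_all)
    then show "(\<lambda>m. vol (K + (*\<^sub>R) (?l m) ` E)) \<longlonglongrightarrow> vol K" unfolding K0' .
  qed
  then have "vol (K + (*\<^sub>R) l ` E) = poly q l" if "l \<ge> 0" for l
    using q(2)[of l] that K0 by (cases "l = 0") auto
  then show ?thesis using q(1) by blast
qed

lemma translate_sum: "((+) a ` K) + (*\<^sub>R) l ` ((+) b ` E) = (+) (a + l *\<^sub>R b) ` (K + (*\<^sub>R) l ` (E :: 'a::real_vector set))"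
  by (force simp: set_plus_def image_iff algebra_simps)

proposition steiner_polynomial:
  fixes K E :: "(real^'n) set"
  assumes K: "convex_body K" "interior K \<noteq> {}" and E: "convex_body E" "interior E \<noteq> {}"
  shows "\<exists>p. degree p \<le> CARD('n) \<and> (\<forall>l\<ge>0. vol (K + (*\<^sub>R) l ` E) = poly p l)"
proof -
  obtain a b where ab: "a \<in> interior K" "b \<in> interior E" using K E by blast
  have "0 \<in> interior ((+) (- a) ` K)" "0 \<in> interior ((+) (- b) ` E)"
    unfolding interior_translation using ab by (auto intro!: image_eqI[of _ _ a] image_eqI[of _ _ b])
  from steiner_polynomial_centred[OF convex_body_translate[OF K(1)] this(1) convex_body_translate[OF E(1)] this(2)]
  show ?thesis unfolding translate_sum measure_translation .
qed

text \<open>This discharges the \<open>THE\<close>: two admissible sequences give polynomials that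
  agree on a half-line, hence have equal coefficients, and the binomial factors up to the dimension
  are nonzero.\<close>

lemma quermassintegral_eq:
  fixes K E :: "(real^'n) set"
  assumes deg: "degree p \<le> CARD('n)" and p: "\<And>l. l \<ge> 0 \<Longrightarrow> vol (K + (*\<^sub>R) l ` E) = poly p l"
    and i: "i \<le> CARD('n)"
  shows "of_nat (CARD('n) choose i) * quermassintegral i K E = coeff p i"
proof -
  \<comment> \<open>Beyond the dimension the binomial coefficient is 0, and division by zero yields
    the required entry 0.\<close>
  define W where "W j = coeff p j / of_nat (CARD('n) choose j)" for j
  have W: "of_nat (CARD('n) choose j) * W j = coeff p j" if "j \<le> CARD('n)" for j
    using that by (simp add: W_def)
  have uniq: "V = W" if V: "(\<forall>j>CARD('n). V j = 0) \<and> (\<forall>l\<ge>0. vol (K + (*\<^sub>R) l ` E) =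
       (\<Sum>j\<le>CARD('n). of_nat (CARD('n) choose j) * V j * l ^ j))" for V
  proof -
    define q where "q = (\<Sum>j\<le>CARD('n). monom (of_nat (CARD('n) choose j) * V j) j)"
    have "poly q l = poly p l" if "l \<in> {0..}" for l
      using V p[of l] that by (simp add: q_def poly_sum poly_monom)
    then have "{0..} \<subseteq> {l. poly (q - p) l = 0}" by auto
    then have "infinite {l. poly (q - p) l = 0}" using infinite_Ici infinite_super by blast
    then have "q = p" using poly_roots_finite[of "q - p"] by auto
    then have cV: "coeff p j = of_nat (CARD('n) choose j) * V j" if "j \<le> CARD('n)" for j
      using that by (auto simp: q_def coeff_sum)
    have c0: "coeff p j = 0" if "j > CARD('n)" for j using deg that by (simp add: coeff_eq_0)
    have "V j = W j" for j
    proof (cases "j \<le> CARD('n)")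
      case True
      then have "real (CARD('n) choose j) \<noteq> 0" by simp
      then show ?thesis using cV[OF True] by (simp add: W_def)
    next
      case False
      then show ?thesis using V c0 by (simp add: W_def)
    qed
    then show ?thesis by blast
  qed
  have "quermassintegral i K E = W i"
    unfolding quermassintegral_def DIM_cart DIM_real mult_1_right
  proof (subst the_equality[where a = W])
    show "(\<forall>j>CARD('n). W j = 0) \<and> (\<forall>l\<ge>0. vol (K + (*\<^sub>R) l ` E) =
       (\<Sum>j\<le>CARD('n). of_nat (CARD('n) choose j) * W j * l ^ j))"
    proof (intro conjI allI impI)
      show "W j = 0" if "j > CARD('n)" for j using that by (simp add: W_def)
      show "vol (K + (*\<^sub>R) l ` E) = (\<Sum>j\<le>CARD('n). of_nat (CARD('n) choose j) * W j * l ^ j)"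
        if "l \<ge> 0" for l
        unfolding p[OF that] poly_sum_coeff[OF deg] by (intro sum.cong) (simp_all add: W)
    qed
  qed (use uniq in auto)
  then show ?thesis using W[OF i] by simp
qed

lemma relative_surface_area_eq:
  fixes K E :: "(real^'n) set"
  assumes "degree p \<le> CARD('n)" and "\<And>l. l \<ge> 0 \<Longrightarrow> vol (K + (*\<^sub>R) l ` E) = poly p l"
  shows "relative_surface_area K E = coeff p 1"
  using quermassintegral_eq[OF assms, of 1] by (simp add: relative_surface_area_def Suc_leI)

section \<open>The Brunn--Minkowski inequality\<close>

text \<open>After division by the right-hand side this is the arithmetic-geometric mean inequality
  for the ratios a/(a+b) and b/(a+b), whose means add up to 1.\<close>

lemma root_prod_superadditive:
  fixes a b :: "'i \<Rightarrow> real"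
  assumes S: "finite S" "S \<noteq> {}" and a: "\<And>i. i \<in> S \<Longrightarrow> a i > 0" and b: "\<And>i. i \<in> S \<Longrightarrow> b i > 0"
  shows "root (card S) (prod a S) + root (card S) (prod b S) \<le> root (card S) (\<Prod>i\<in>S. a i + b i)"
proof -
  let ?n = "card S"
  have n: "?n > 0" using S by (simp add: card_gt_0_iff)
  have amgm: "root ?n (prod f S) \<le> (\<Sum>i\<in>S. f i) / ?n" if "\<And>i. i \<in> S \<Longrightarrow> f i > 0" for f :: "'i \<Rightarrow> real"
  proof -
    have "(prod f S) powr (1 / ?n) \<le> (\<Sum>i\<in>S. f i / ?n)"
      using that by (intro arith_geom_mean S) (auto intro: less_imp_le)
    moreover have "prod f S > 0" using that by (intro prod_pos)
    ultimately show ?thesis using n by (simp add: root_powr_inverse sum_divide_distrib)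
  qed
  define c where "c i = a i + b i" for i
  have c: "c i > 0" if "i \<in> S" for i using a b that by (simp add: c_def add_pos_pos)
  have "root ?n (\<Prod>i\<in>S. a i / c i) + root ?n (\<Prod>i\<in>S. b i / c i) \<le> (\<Sum>i\<in>S. a i / c i) / ?n + (\<Sum>i\<in>S. b i / c i) / ?n"
    using a b c by (intro add_mono amgm divide_pos_pos)
  also have "\<dots> = (\<Sum>i\<in>S. a i / c i + b i / c i) / ?n" by (simp add: sum.distrib add_divide_distrib)
  also have "(\<Sum>i\<in>S. a i / c i + b i / c i) = (\<Sum>i\<in>S. 1)"
    using c by (intro sum.cong) (auto simp: add_divide_distrib[symmetric] c_def less_imp_neq[symmetric])
  also have "(\<Sum>i\<in>S. 1) / real ?n = 1" using n by simp
  finally have "(root ?n (prod a S) + root ?n (prod b S)) / root ?n (prod c S) \<le> 1"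
    by (simp add: prod_dividef real_root_divide add_divide_distrib)
  moreover have "root ?n (prod c S) > 0" using n c by (simp add: prod_pos)
  ultimately show ?thesis by (simp add: c_def)
qed


section \<open>Half-space cuts and one-dimensional marginals\<close>

lemma measure_pos_open:
  fixes A :: "'a::euclidean_space set"
  assumes "open A" "A \<noteq> {}" "A \<in> lmeasurable" shows "vol A > 0"
proof -
  have "\<not> negligible A" using assms open_not_negligible by blast
  then have "vol A \<noteq> 0" using negligible_iff_measure0[OF assms(3)] by simp
  then show ?thesis using zero_less_measure_iff by blast
qed

text \<open>As a measure on the line, the volume cut off by half-spaces becomes a distribution
  function, for which continuity criteria and uniqueness are available.\<close>

definition marginal :: "'a::euclidean_space set \<Rightarrow> 'a \<Rightarrow> real measure" where
  "marginal S u = distr (lebesgue_on S) borel (\<lambda>x. x \<bullet> u)"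

lemma measurable_inner_lebesgue_on [measurable]: "(\<lambda>x. x \<bullet> u) \<in> borel_measurable (lebesgue_on (S :: 'a::euclidean_space set))"
  by (intro measurable_restrict_space1 measurable_completion) simp

lemma finite_borel_measure_marginal:
  assumes "S \<in> lmeasurable" shows "finite_borel_measure (marginal S u)"
proof -
  interpret finite_measure "lebesgue_on S" using assms by (rule finite_measure_lebesgue_on)
  show ?thesis
    unfolding marginal_def
    by (intro finite_borel_measure.intro finite_measure_distr finite_borel_measure_axioms.intro) simp_all
qed

lemma measure_marginal:
  assumes "S \<in> lmeasurable" "B \<in> sets borel"
  shows "measure (marginal S u) B = vol (S \<inter> {x. x \<bullet> u \<in> B})"
proof -
  have S: "S \<in> sets lebesgue" using assms by (simp add: fmeasurableD)
  have "measure (marginal S u) B = measure (lebesgue_on S) ((\<lambda>x. x \<bullet> u) -` B \<inter> space (lebesgue_on S))"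
    unfolding marginal_def by (rule measure_distr) (use assms in simp_all)
  also have "(\<lambda>x. x \<bullet> u) -` B \<inter> space (lebesgue_on S) = S \<inter> {x. x \<bullet> u \<in> B}" by auto
  also have "measure (lebesgue_on S) \<dots> = vol (S \<inter> {x. x \<bullet> u \<in> B})"
    using S by (intro measure_restrict_space) auto
  finally show ?thesis .
qed

lemma hyperplane_Int_null:
  assumes "u \<noteq> 0" shows "vol (S \<inter> {x. x \<bullet> u = c}) = 0"
proof -
  have "negligible {x. u \<bullet> x = c}" using assms by (intro negligible_hyperplane) simp
  then have "negligible (S \<inter> {x. x \<bullet> u = c})" by (rule negligible_subset) (auto simp: inner_commute)
  then show ?thesis by (rule negligible_imp_measure0)
qed

text \<open>The marginal has no atoms because hyperplanes are null sets.\<close>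

lemma isCont_cdf_marginal:
  assumes S: "S \<in> lmeasurable" and u: "u \<noteq> 0"
  shows "isCont (cdf (marginal S u)) c"
proof -
  interpret finite_borel_measure "marginal S u" by (rule finite_borel_measure_marginal[OF S])
  show ?thesis unfolding isCont_cdf by (subst measure_marginal[OF S]) (auto simp: hyperplane_Int_null[OF u])
qed

lemma cdf_marginal:
  assumes "S \<in> lmeasurable" shows "cdf (marginal S u) c = vol (S \<inter> {x. x \<bullet> u \<le> c})"
  unfolding cdf_def using measure_marginal[OF assms, of "{..c}" u] by simp

lemma lmeasurable_halfspace_Int:
  assumes "S \<in> lmeasurable"
  shows "S \<inter> {x. x \<bullet> u \<le> c} \<in> lmeasurable" "S \<inter> {x. x \<bullet> u < c} \<in> lmeasurable"
    "S \<inter> {x. x \<bullet> u > c} \<in> lmeasurable" "S \<inter> {x. x \<bullet> u \<ge> c} \<in> lmeasurable"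
proof -
  have "{x. x \<bullet> u \<le> c} \<in> sets borel" "{x. x \<bullet> u < c} \<in> sets borel" "{x. x \<bullet> u > c} \<in> sets borel" "{x. x \<bullet> u \<ge> c} \<in> sets borel"
    by measurable
  then show "S \<inter> {x. x \<bullet> u \<le> c} \<in> lmeasurable" "S \<inter> {x. x \<bullet> u < c} \<in> lmeasurable"
    "S \<inter> {x. x \<bullet> u > c} \<in> lmeasurable" "S \<inter> {x. x \<bullet> u \<ge> c} \<in> lmeasurable"
    using assms by (auto intro!: fmeasurable_Int_fmeasurable)
qed

lemma measure_halfspace_split:
  assumes S: "S \<in> lmeasurable" and u: "u \<noteq> 0"
  shows "vol (S \<inter> {x. x \<bullet> u < c}) = vol (S \<inter> {x. x \<bullet> u \<le> c})"
    "vol (S \<inter> {x. x \<bullet> u > c}) = vol S - vol (S \<inter> {x. x \<bullet> u \<le> c})"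
    "vol (S \<inter> {x. x \<bullet> u \<ge> c}) = vol S - vol (S \<inter> {x. x \<bullet> u \<le> c})"
proof -
  note m = lmeasurable_halfspace_Int[OF S, where u = u and c = c]
  have neg: "negligible (S \<inter> {x. x \<bullet> u = c})"
    by (rule negligible_subset[OF negligible_hyperplane[of u c]]) (use u in \<open>auto simp: inner_commute\<close>)
  show 1: "vol (S \<inter> {x. x \<bullet> u < c}) = vol (S \<inter> {x. x \<bullet> u \<le> c})"
    by (rule measure_negligible_symdiff[OF m(1)], rule negligible_subset[OF neg]) auto
  have "S = (S \<inter> {x. x \<bullet> u > c}) \<union> (S \<inter> {x. x \<bullet> u \<le> c})" by auto
  moreover have "vol ((S \<inter> {x. x \<bullet> u > c}) \<union> (S \<inter> {x. x \<bullet> u \<le> c})) =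
      vol (S \<inter> {x. x \<bullet> u > c}) + vol (S \<inter> {x. x \<bullet> u \<le> c})"
    by (rule measure_Un2[OF m(3,1), THEN trans]) (auto intro: arg_cong[where f = "vol"])
  ultimately show 2: "vol (S \<inter> {x. x \<bullet> u > c}) = vol S - vol (S \<inter> {x. x \<bullet> u \<le> c})"
    by simp
  have "vol (S \<inter> {x. x \<bullet> u \<ge> c}) = vol (S \<inter> {x. x \<bullet> u > c})"
    by (rule measure_negligible_symdiff[OF m(3)], rule negligible_subset[OF neg]) auto
  with 2 show "vol (S \<inter> {x. x \<bullet> u \<ge> c}) = vol S - vol (S \<inter> {x. x \<bullet> u \<le> c})" by simp
qed

lemma halfspace_fraction:
  fixes S :: "'a::euclidean_space set"
  assumes S: "S \<in> lmeasurable" "bounded S" and u: "u \<noteq> 0" and t: "0 \<le> t" "t \<le> 1"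
  obtains c where "vol (S \<inter> {x. x \<bullet> u \<le> c}) = t * vol S"
proof -
  obtain R where R: "\<And>x. x \<in> S \<Longrightarrow> norm x \<le> R" using S(2) by (auto simp: bounded_iff)
  \<comment> \<open>The additional 1 puts \<open>S\<close> strictly between the two levels, so the
    half-space at level \<open>- r\<close> misses it.\<close>
  define r where "r = \<bar>R\<bar> * norm u + 1"
  have r: "\<bar>x \<bullet> u\<bar> < r" if "x \<in> S" for x
  proof -
    have "\<bar>x \<bullet> u\<bar> \<le> norm x * norm u" by (rule Cauchy_Schwarz_ineq2)
    also have "\<dots> \<le> \<bar>R\<bar> * norm u" using R[OF that] by (intro mult_right_mono) auto
    finally show ?thesis by (simp add: r_def)
  qed
  have "S \<inter> {x. x \<bullet> u \<le> - r} = {}" "S \<inter> {x. x \<bullet> u \<le> r} = S" using r by fastforce+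
  then have "cdf (marginal S u) (- r) = 0" "cdf (marginal S u) r = vol S"
    by (simp_all add: cdf_marginal[OF S(1)])
  moreover have "t * vol S \<le> vol S" "0 \<le> t * vol S"
    using t by (auto intro: mult_left_le_one_le)
  moreover have "- r \<le> r" by (simp add: r_def)
  ultimately obtain c where "cdf (marginal S u) c = t * vol S"
    using IVT[of "cdf (marginal S u)" "- r" "t * vol S" r] isCont_cdf_marginal[OF S(1) u] by auto
  then show ?thesis using that by (simp add: cdf_marginal[OF S(1)])
qed

section \<open>Brunn--Minkowski for finite unions of disjoint boxes\<close>

definition box_family :: "'a::euclidean_space set set \<Rightarrow> bool" where
  "box_family \<A> \<longleftrightarrow> finite \<A> \<and> (\<forall>S\<in>\<A>. S \<noteq> {} \<and> (\<exists>a b. S = box a b)) \<and> pairwise disjnt \<A>"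

lemma box_family_Union:
  assumes "box_family \<A>" shows "open (\<Union>\<A>)" "bounded (\<Union>\<A>)" "\<Union>\<A> \<in> lmeasurable"
proof -
  from assms show "open (\<Union>\<A>)" "bounded (\<Union>\<A>)" unfolding box_family_def by (auto intro!: open_Union bounded_Union)
  then show "\<Union>\<A> \<in> lmeasurable" by (intro lmeasurable_open)
qed

text \<open>Prepares the induction on the number of boxes: a cut never increases it, and a box that
  misses \<open>H\<close> lowers it because empty intersections are discarded.\<close>

lemma box_family_cut:
  fixes \<A> :: "'a::euclidean_space set set"
  assumes A: "box_family \<A>" and H: "\<And>a b. \<exists>a' b'. box a b \<inter> H = box a' b'"
  obtains \<B> where "box_family \<B>" "\<Union>\<B> = \<Union>\<A> \<inter> H" "card \<B> \<le> card \<A>"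
    "(\<exists>S\<in>\<A>. S \<inter> H = {}) \<longrightarrow> card \<B> < card \<A>"
proof
  let ?I = "(\<lambda>S. S \<inter> H) ` \<A>"
  have fin: "finite \<A>" using A by (simp add: box_family_def)
  have "\<exists>a b. S = box a b" if "S \<in> ?I" for S
    using that A H unfolding box_family_def by (metis (no_types, lifting) imageE)
  moreover have "pairwise disjnt (?I - {{}})"
    using A by (auto simp: box_family_def pairwise_def disjnt_def)
  ultimately show "box_family (?I - {{}})" using fin by (auto simp: box_family_def)
  show "\<Union>(?I - {{}}) = \<Union>\<A> \<inter> H" by auto
  have c: "card ?I \<le> card \<A>" by (rule card_image_le[OF fin])
  then show "card (?I - {{}}) \<le> card \<A>" using card_Diff1_le[of ?I "{}"] by linarith
  show "(\<exists>S\<in>\<A>. S \<inter> H = {}) \<longrightarrow> card (?I - {{}}) < card \<A>"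
  proof
    assume "\<exists>S\<in>\<A>. S \<inter> H = {}"
    then obtain S where "S \<in> \<A>" "S \<inter> H = {}" by blast
    then have "{} \<in> ?I" by (intro image_eqI[of _ _ S]) simp_all
    then have "card (?I - {{}}) < card ?I" using fin by (intro card_Diff1_less) auto
    then show "card (?I - {{}}) < card \<A>" using c by linarith
  qed
qed

lemma box_Int_halfspace:
  fixes i :: "'a::euclidean_space"
  assumes i: "i \<in> Basis"
  shows "\<exists>a' b'. box a b \<inter> {x. x \<bullet> i < c} = box a' b'" "\<exists>a' b'. box a b \<inter> {x. x \<bullet> i > c} = box a' b'"
proof -
  have "box a b \<inter> {x. x \<bullet> i < c} = box a (b + (min (b \<bullet> i) c - b \<bullet> i) *\<^sub>R i)"
    unfolding box_def using i by (auto simp: inner_add_left inner_Basis split: if_splits)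
  then show "\<exists>a' b'. box a b \<inter> {x. x \<bullet> i < c} = box a' b'" by blast
  have "box a b \<inter> {x. x \<bullet> i > c} = box (a + (max (a \<bullet> i) c - a \<bullet> i) *\<^sub>R i) b"
    unfolding box_def using i by (auto simp: inner_add_left inner_Basis split: if_splits)
  then show "\<exists>a' b'. box a b \<inter> {x. x \<bullet> i > c} = box a' b'" by blast
qed

lemma set_plus_UN: "A + B = (\<Union>x\<in>A. \<Union>y\<in>B. {x + y})"
  by (auto simp: set_plus_def)

lemma open_set_plus: "open A \<Longrightarrow> open B \<Longrightarrow> open (A + B :: 'a::real_normed_vector set)"
  unfolding set_plus_UN by (intro open_sums disjI1)

lemma bounded_set_plus: "bounded A \<Longrightarrow> bounded B \<Longrightarrow> bounded (A + B :: 'a::real_normed_vector set)"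
  unfolding set_plus_UN by (rule bounded_sums)

lemma lmeasurable_open_sum:
  fixes A B :: "'a::euclidean_space set"
  assumes "open A" "bounded A" "open B" "bounded B" shows "A + B \<in> lmeasurable"
  using assms by (intro lmeasurable_open bounded_set_plus open_set_plus)

abbreviation (input) vol_radius :: "'a::euclidean_space set \<Rightarrow> real" where
  "vol_radius S \<equiv> root DIM('a) (vol S)"

text \<open>The sum contains the box whose side lengths are the sums of the given ones, which
  reduces the claim to \<open>root_prod_superadditive\<close>.\<close>

lemma brunn_minkowski_box:
  fixes a b c d :: "'a::euclidean_space"
  assumes ne: "box a b \<noteq> {}" "box c d \<noteq> {}"
  shows "vol_radius (box a b) + vol_radius (box c d) \<le>
    vol_radius (box a b + box c d)"
proof -
  have ab: "a \<bullet> i < b \<bullet> i" and cd: "c \<bullet> i < d \<bullet> i" if "i \<in> Basis" for i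
    using ne that by (auto simp: box_ne_empty)
  have vol_box: "vol (box p q) = (\<Prod>i\<in>Basis. (q \<bullet> i - p \<bullet> i))" if "\<And>i. i \<in> Basis \<Longrightarrow> p \<bullet> i < q \<bullet> i" for p q :: 'a
    using that by (simp add: measure_lborel_box_eq inner_diff_left less_imp_le)
  have "box (a + c) (b + d) \<subseteq> box a b + box c d"
  proof
    fix x assume x: "x \<in> box (a + c) (b + d)"
    \<comment> \<open>The coordinate of \<open>x\<close> is split by using the same relative
      position in both intervals.\<close>
    define t where "t i = (x \<bullet> i - a \<bullet> i - c \<bullet> i) / ((b \<bullet> i - a \<bullet> i) + (d \<bullet> i - c \<bullet> i))" for i
    have t: "0 < t i" "t i < 1" if "i \<in> Basis" for i
      using x ab[OF that] cd[OF that] that by (auto simp: t_def mem_box inner_add_left field_simps)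
    have teq: "x \<bullet> i = a \<bullet> i + c \<bullet> i + t i * (b \<bullet> i - a \<bullet> i) + t i * (d \<bullet> i - c \<bullet> i)" if "i \<in> Basis" for i
    proof -
      have "(b \<bullet> i - a \<bullet> i) + (d \<bullet> i - c \<bullet> i) \<noteq> 0" using ab[OF that] cd[OF that] by linarith
      then have "t i * ((b \<bullet> i - a \<bullet> i) + (d \<bullet> i - c \<bullet> i)) = x \<bullet> i - a \<bullet> i - c \<bullet> i"
        by (simp add: t_def)
      then show ?thesis by (simp add: distrib_left)
    qed
    define y where "y = (\<Sum>i\<in>Basis. (a \<bullet> i + t i * (b \<bullet> i - a \<bullet> i)) *\<^sub>R i)"
    define z where "z = (\<Sum>i\<in>Basis. (c \<bullet> i + t i * (d \<bullet> i - c \<bullet> i)) *\<^sub>R i)"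
    have between: "0 < s \<Longrightarrow> s < 1 \<Longrightarrow> p < q \<Longrightarrow> p < p + s * (q - p) \<and> p + s * (q - p) < q" for s p q :: real
    proof -
      assume s: "0 < s" "s < 1" "p < q"
      then have "s * (q - p) < 1 * (q - p)" by (intro mult_strict_right_mono) auto
      moreover have "s * (q - p) > 0" using s by simp
      ultimately show ?thesis by simp
    qed
    have "y \<in> box a b" "z \<in> box c d" using between t ab cd by (auto simp: mem_box y_def z_def)
    moreover have "x = y + z"
      by (rule euclidean_eqI) (simp add: y_def z_def inner_add_left teq)
    ultimately show "x \<in> box a b + box c d" by (simp add: set_plus_intro)
  qed
  then have "vol (box (a + c) (b + d)) \<le> vol (box a b + box c d)"
    by (intro vol_mono lmeasurable_open_sum) (auto intro: open_box bounded_box)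
  moreover have "vol_radius (box a b) + vol_radius (box c d) \<le>
      vol_radius (box (a + c) (b + d))"
  proof -
    have "vol (box (a + c) (b + d)) = (\<Prod>i\<in>Basis. (b \<bullet> i - a \<bullet> i) + (d \<bullet> i - c \<bullet> i))"
      using ab cd by (subst vol_box) (auto simp: inner_add_left add_strict_mono algebra_simps)
    moreover have "vol (box a b) = (\<Prod>i\<in>Basis. b \<bullet> i - a \<bullet> i)" using ab by (rule vol_box)
    moreover have "vol (box c d) = (\<Prod>i\<in>Basis. d \<bullet> i - c \<bullet> i)" using cd by (rule vol_box)
    moreover have "root DIM('a) (\<Prod>i\<in>Basis. b \<bullet> i - a \<bullet> i) + root DIM('a) (\<Prod>i\<in>Basis. d \<bullet> i - c \<bullet> i) \<le>
        root DIM('a) (\<Prod>i\<in>Basis. (b \<bullet> i - a \<bullet> i) + (d \<bullet> i - c \<bullet> i))"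
      using ab cd by (intro root_prod_superadditive) auto
    ultimately show ?thesis by (simp only:)
  qed
  ultimately show ?thesis by (meson DIM_positive order_trans real_root_le_mono)
qed

lemma set_plus_halfspaces:
  "(A \<inter> {x. x \<bullet> u < c}) + (B \<inter> {x. x \<bullet> u < d}) \<subseteq> (A + B) \<inter> {x. x \<bullet> u < c + d}"
  "(A \<inter> {x. x \<bullet> u > c}) + (B \<inter> {x. x \<bullet> u > d}) \<subseteq> (A + B) \<inter> {x. x \<bullet> u > c + d}"
  by (auto simp: set_plus_def inner_add_left)

lemma box_family_separating_hyperplane:
  fixes \<A> :: "'a::euclidean_space set set"
  assumes A: "box_family \<A>" and ST: "S \<in> \<A>" "T \<in> \<A>" "S \<noteq> T"
  obtains i c S' T' where "i \<in> Basis" "S' \<in> \<A>" "T' \<in> \<A>" "S' \<inter> {x. x \<bullet> i > c} = {}" "T' \<inter> {x. x \<bullet> i < c} = {}"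
proof -
  obtain a b where S: "S = box a b" "S \<noteq> {}" using A ST unfolding box_family_def by blast
  obtain c d where T: "T = box c d" "T \<noteq> {}" using A ST unfolding box_family_def by blast
  have "S \<inter> T = {}" using A ST by (auto simp: box_family_def pairwise_def disjnt_def)
  then obtain i where i: "i \<in> Basis" "b \<bullet> i \<le> a \<bullet> i \<or> d \<bullet> i \<le> c \<bullet> i \<or> b \<bullet> i \<le> c \<bullet> i \<or> d \<bullet> i \<le> a \<bullet> i"
    using S T disjoint_interval(4)[of a b c d] by auto
  have "a \<bullet> i < b \<bullet> i" "c \<bullet> i < d \<bullet> i" using S T i by (auto simp: box_ne_empty)
  then consider "b \<bullet> i \<le> c \<bullet> i" | "d \<bullet> i \<le> a \<bullet> i" using i by linarith
  then show ?thesis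
  proof cases
    case 1
    have "S \<inter> {x. x \<bullet> i > b \<bullet> i} = {}" unfolding S(1) box_def using i(1) by fastforce
    moreover have "T \<inter> {x. x \<bullet> i < b \<bullet> i} = {}" unfolding T(1) box_def using i(1) 1 by fastforce
    ultimately show ?thesis using that[OF i(1) ST(1,2)] by blast
  next
    case 2
    have "T \<inter> {x. x \<bullet> i > d \<bullet> i} = {}" unfolding T(1) box_def using i(1) by fastforce
    moreover have "S \<inter> {x. x \<bullet> i < d \<bullet> i} = {}" unfolding S(1) box_def using i(1) 2 by fastforce
    ultimately show ?thesis using that[OF i(1) ST(2,1)] by blast
  qed
qed

text \<open>Turns Brunn--Minkowski for two pieces of the same proportion \<open>t\<close> into a
  volume bound linear in \<open>t\<close>, so that the bounds for \<open>t\<close> and 1 - t can be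
  added.\<close>

lemma root_scaled_power:
  assumes "n > 0" "a \<ge> 0" "b \<ge> 0" "t \<ge> 0" "v \<ge> 0" "root n (t * a) + root n (t * b) \<le> root n v"
  shows "t * (root n a + root n b) ^ n \<le> v"
proof -
  have "(root n t * (root n a + root n b)) ^ n \<le> root n v ^ n"
    using assms by (intro power_mono) (auto simp: real_root_mult distrib_left)
  then show ?thesis using assms by (simp add: power_mult_distrib)
qed

text \<open>Hadwiger and Ohmann's argument: cut the family with at least two members by a coordinate hyperplane
  separating two of its boxes, cut the other family in the same proportion, and apply the induction
  hypothesis on both sides.\<close>
lemma brunn_minkowski_box_family:
  fixes \<A> \<B> :: "'a::euclidean_space set set"
  assumes "box_family \<A>" "box_family \<B>" "\<A> \<noteq> {}" "\<B> \<noteq> {}"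
  shows "vol_radius (\<Union>\<A>) + vol_radius (\<Union>\<B>) \<le>
    vol_radius (\<Union>\<A> + \<Union>\<B>)"
  using assms
proof (induction "card \<A> + card \<B>" arbitrary: \<A> \<B> rule: less_induct)
  case less
  let ?n = "DIM('a)"
  \<comment> \<open>Stated for arbitrary families with their own induction hypothesis, so that it
    can also be applied with the two families exchanged.\<close>
  have step: "vol_radius (\<Union>\<A>) + vol_radius (\<Union>\<B>) \<le>
    vol_radius (\<Union>\<A> + \<Union>\<B>)"
    if A: "box_family \<A>" "\<A> \<noteq> {}" and B: "box_family \<B>" "\<B> \<noteq> {}" and ST: "S \<in> \<A>" "T \<in> \<A>" "S \<noteq> T"
      and IH: "\<And>\<A>' \<B>' :: 'a set set. \<lbrakk>card \<A>' + card \<B>' < card \<A> + card \<B>; box_family \<A>'; box_family \<B>'; \<A>' \<noteq> {}; \<B>' \<noteq> {}\<rbrakk> \<Longrightarrow>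
        vol_radius (\<Union>\<A>') + vol_radius (\<Union>\<B>') \<le>
        vol_radius (\<Union>\<A>' + \<Union>\<B>')"
    for \<A> \<B> :: "'a set set" and S T
  proof -
    define A B where "A = \<Union>\<A>" and "B = \<Union>\<B>"
    note mA = box_family_Union[OF A(1), folded A_def] and mB = box_family_Union[OF B(1), folded B_def]
    have vA: "vol A > 0"
      using A mA by (intro measure_pos_open) (auto simp: A_def box_family_def)
    have vB: "vol B > 0"
      using B mB by (intro measure_pos_open) (auto simp: B_def box_family_def)
    obtain i c S' T' where i: "i \<in> Basis" and S'T': "S' \<in> \<A>" "T' \<in> \<A>" and S': "S' \<inter> {x. x \<bullet> i > c} = {}"
      and T': "T' \<inter> {x. x \<bullet> i < c} = {}" by (rule box_family_separating_hyperplane[OF A(1) ST])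
    have i0: "i \<noteq> 0" using i by auto
    define t where "t = vol (A \<inter> {x. x \<bullet> i < c}) / vol A"
    have splitA: "vol (A \<inter> {x. x \<bullet> i < c}) = t * vol A"
      "vol (A \<inter> {x. x \<bullet> i > c}) = (1 - t) * vol A"
      using measure_halfspace_split[OF mA(3) i0, of c] vA by (auto simp: t_def algebra_simps)
    have neS: "S' \<noteq> {}" "T' \<noteq> {}" "open S'" "open T'" using A S'T' by (auto simp: box_family_def)
    have "A \<inter> {x. x \<bullet> i < c} \<noteq> {}"
    proof -
      \<comment> \<open>An open set in the closed half-space lies in its interior, so the cut leaves
        a piece of positive volume.\<close>
      have "S' \<subseteq> {x. x \<bullet> i \<le> c}" using S' by auto
      then have "S' \<subseteq> interior {x. x \<bullet> i \<le> c}" using neS interior_maximal by blast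
      also have "\<dots> = {x. x \<bullet> i < c}" using interior_halfspace_le[OF i0, of c] by (simp add: inner_commute)
      finally show ?thesis using neS S'T' by (auto simp: A_def)
    qed
    moreover have "open (A \<inter> {x. x \<bullet> i < c})" using mA by (intro open_Int open_Collect_less continuous_intros)
    ultimately have "vol (A \<inter> {x. x \<bullet> i < c}) > 0"
      using lmeasurable_halfspace_Int[OF mA(3)] by (intro measure_pos_open)
    then have t0: "t > 0" using vA by (simp add: t_def)
    have "A \<inter> {x. x \<bullet> i > c} \<noteq> {}"
    proof -
      have "T' \<subseteq> {x. x \<bullet> i \<ge> c}" using T' by auto
      then have "T' \<subseteq> interior {x. x \<bullet> i \<ge> c}" using neS interior_maximal by blast
      also have "\<dots> = {x. x \<bullet> i > c}" using interior_halfspace_ge[OF i0, of c] by (simp add: inner_commute)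
      finally show ?thesis using neS S'T' by (auto simp: A_def)
    qed
    moreover have "open (A \<inter> {x. x \<bullet> i > c})" using mA by (intro open_Int open_Collect_less continuous_intros)
    ultimately have "vol (A \<inter> {x. x \<bullet> i > c}) > 0"
      using lmeasurable_halfspace_Int[OF mA(3)] by (intro measure_pos_open)
    then have t1: "t < 1" using vA splitA by (simp add: zero_less_mult_iff)
    \<comment> \<open>The second family is cut in the same proportion: the heights \<open>c\<close>
      and \<open>d\<close> need not agree, since only their sum matters for A + B.\<close>
    obtain d where d: "vol (B \<inter> {x. x \<bullet> i \<le> d}) = t * vol B"
      using halfspace_fraction[OF mB(3,2) i0, of t] t0 t1 by auto
    have splitB: "vol (B \<inter> {x. x \<bullet> i < d}) = t * vol B"
      "vol (B \<inter> {x. x \<bullet> i > d}) = (1 - t) * vol B"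
      using measure_halfspace_split[OF mB(3) i0, of d] d by (auto simp: algebra_simps)
    have mAB: "A + B \<in> lmeasurable" by (intro lmeasurable_open_sum mA mB)
    have part: "s * (vol_radius A + vol_radius B) ^ ?n \<le> vol (A \<inter> H + B \<inter> H')"
      if s: "s > 0" and H: "\<And>a b. \<exists>a' b'. box a b \<inter> H = box a' b'" and H': "\<And>a b. \<exists>a' b'. box a b \<inter> H' = box a' b'"
        and sA: "vol (A \<inter> H) = s * vol A"
        and sB: "vol (B \<inter> H') = s * vol B"
        and miss: "\<exists>S\<in>\<A>. S \<inter> H = {}" for s H H'
    proof -
      obtain \<A>' where A': "box_family \<A>'" "\<Union>\<A>' = A \<inter> H" "card \<A>' < card \<A>"
        using box_family_cut[OF A(1) H] miss unfolding A_def by metis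
      obtain \<B>' where B': "box_family \<B>'" "\<Union>\<B>' = B \<inter> H'" "card \<B>' \<le> card \<B>"
        using box_family_cut[OF B(1) H'] unfolding B_def by metis
      have "vol (\<Union>\<A>') > 0" "vol (\<Union>\<B>') > 0"
        unfolding A'(2) B'(2) sA sB using s vA vB by simp_all
      then have "\<A>' \<noteq> {}" "\<B>' \<noteq> {}" by auto
      then have "vol_radius (\<Union>\<A>') + vol_radius (\<Union>\<B>') \<le>
        vol_radius (\<Union>\<A>' + \<Union>\<B>')" using A' B' by (intro IH) auto
      then show ?thesis unfolding A'(2) B'(2) sA sB using s by (intro root_scaled_power) auto
    qed
    have m1: "A \<inter> {x. x \<bullet> i < c} + B \<inter> {x. x \<bullet> i < d} \<in> lmeasurable"
      using mA mB by (intro lmeasurable_open_sum open_Int open_Collect_less continuous_intros bounded_Int) auto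
    have m2: "A \<inter> {x. x \<bullet> i > c} + B \<inter> {x. x \<bullet> i > d} \<in> lmeasurable"
      using mA mB by (intro lmeasurable_open_sum open_Int open_Collect_less continuous_intros bounded_Int) auto
    have "(vol_radius A + vol_radius B) ^ ?n =
       t * (vol_radius A + vol_radius B) ^ ?n +
       (1 - t) * (vol_radius A + vol_radius B) ^ ?n" by (simp add: algebra_simps)
    also have "\<dots> \<le> vol (A \<inter> {x. x \<bullet> i < c} + B \<inter> {x. x \<bullet> i < d}) +
       vol (A \<inter> {x. x \<bullet> i > c} + B \<inter> {x. x \<bullet> i > d})"
    proof (rule add_mono)
      show "t * (vol_radius A + vol_radius B) ^ ?n \<le>
        vol (A \<inter> {x. x \<bullet> i < c} + B \<inter> {x. x \<bullet> i < d})"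
        by (rule part[OF t0 box_Int_halfspace(1)[OF i] box_Int_halfspace(1)[OF i] splitA(1) splitB(1)])
          (use S'T' T' in blast)
      show "(1 - t) * (vol_radius A + vol_radius B) ^ ?n \<le>
        vol (A \<inter> {x. x \<bullet> i > c} + B \<inter> {x. x \<bullet> i > d})"
        by (rule part[OF _ box_Int_halfspace(2)[OF i] box_Int_halfspace(2)[OF i] splitA(2) splitB(2)])
          (use S'T' S' t1 in auto)
    qed
    \<comment> \<open>The two partial sums lie on opposite sides of the hyperplane at height c + d,
      so their volumes add inside A + B.\<close>
    also have "\<dots> \<le> vol ((A + B) \<inter> {x. x \<bullet> i < c + d}) + vol ((A + B) \<inter> {x. x \<bullet> i > c + d})"
      by (intro add_mono vol_mono set_plus_halfspaces lmeasurable_halfspace_Int mAB fmeasurableD m1 m2)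
    also have "\<dots> = vol (A + B)"
      using measure_halfspace_split[OF mAB i0, of "c + d"] by simp
    finally have "root ?n ((vol_radius A + vol_radius B) ^ ?n) \<le> vol_radius (A + B)"
      by simp
    then show ?thesis by (simp add: real_root_power_cancel A_def B_def)
  qed
  show ?case
  proof (cases "\<exists>S\<in>\<A>. \<exists>T\<in>\<A>. S \<noteq> T")
    case True
    then obtain S T where "S \<in> \<A>" "T \<in> \<A>" "S \<noteq> T" by blast
    then show ?thesis by (rule step[OF less.prems(1,3,2,4) _ _ _ less.hyps])
  next
    case A1: False
    show ?thesis
    proof (cases "\<exists>S\<in>\<B>. \<exists>T\<in>\<B>. S \<noteq> T")
      case True
      then obtain S T where ST: "S \<in> \<B>" "T \<in> \<B>" "S \<noteq> T" by blast
      have "vol_radius (\<Union>\<B>) + vol_radius (\<Union>\<A>) \<le>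
        vol_radius (\<Union>\<B> + \<Union>\<A>)"
        by (rule step[OF less.prems(2,4,1,3) ST], rule less.hyps) (simp_all add: add.commute)
      then show ?thesis by (simp only: add.commute)
    next
      case False
      obtain S where S: "S \<in> \<A>" using less.prems(3) by blast
      obtain T where T: "T \<in> \<B>" using less.prems(4) by blast
      have eq: "\<A> = {S}" "\<B> = {T}" using S T A1 False by auto
      obtain a b where "S = box a b" "S \<noteq> {}" using less.prems(1) S unfolding box_family_def by blast
      moreover obtain c d where "T = box c d" "T \<noteq> {}" using less.prems(2) T unfolding box_family_def by blast
      ultimately show ?thesis using brunn_minkowski_box[of a b c d] by (simp add: eq)
    qed
  qed
qed

section \<open>From box families to open sets and convex bodies\<close>

lemma box_family_inner_approx:
  fixes A :: "'a::euclidean_space set"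
  assumes A: "open A" "bounded A" and e: "e > 0"
  obtains \<A> where "box_family \<A>" "\<Union>\<A> \<subseteq> A" "vol A - e < vol (\<Union>\<A>)"
proof -
  obtain r where r': "r > 0" "A \<subseteq> ball 0 r" using bounded_subset_ballD[OF A(2)] by blast
  have r: "A \<subseteq> cbox (- (r *\<^sub>R One)) (r *\<^sub>R One)"
  proof
    fix x assume "x \<in> A"
    then have "norm x < r" using r' by auto
    then have "\<bar>x \<bullet> i\<bar> \<le> r" if "i \<in> Basis" for i using Basis_le_norm[OF that, of x] by linarith
    then show "x \<in> cbox (- (r *\<^sub>R One)) (r *\<^sub>R One)" by (auto simp: mem_box abs_le_iff) (metis minus_le_iff)
  qed
  have box: "box (- (r *\<^sub>R One)) (r *\<^sub>R One) \<noteq> ({} :: 'a set)" using r' by (simp add: box_ne_empty)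
  \<comment> \<open>Every covering box has its tag in \<open>A\<close>, where the gauge is
    \<open>A\<close> itself; hence the boxes stay inside \<open>A\<close>.\<close>
  define g where "g x = (if x \<in> A then A else UNIV)" for x
  have "gauge g" using A(1) by (auto simp: gauge_def g_def)
  from covering_lemma[OF r box this] obtain \<D> where D: "countable \<D>"
    "\<And>K. K \<in> \<D> \<Longrightarrow> interior K \<noteq> {} \<and> (\<exists>c d. K = cbox c d)"
    "pairwise (\<lambda>A B. interior A \<inter> interior B = {}) \<D>"
    "\<And>K. K \<in> \<D> \<Longrightarrow> \<exists>x \<in> A \<inter> K. K \<subseteq> g x" "A \<subseteq> \<Union>\<D>" by metis
  have sub: "K \<subseteq> A" if "K \<in> \<D>" for K using D(4)[OF that] by (auto simp: g_def)
  then have UD: "\<Union>\<D> = A" using D(5) by blast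
  have Am: "A \<in> lmeasurable" using A by (intro lmeasurable_open)
  have Dm: "K \<in> lmeasurable" if "K \<in> \<D>" for K using D(2)[OF that] by auto
  obtain \<D>' where D': "\<D>' \<subseteq> \<D>" "finite \<D>'" "vol (\<Union>\<D>) - e < vol (\<Union>\<D>')"
  proof (rule measure_countable_Union_approachable[OF D(1) e Dm])
    fix D' assume "D' \<subseteq> \<D>" "finite D'"
    then show "vol (\<Union>D') \<le> vol A"
      using sub Dm by (intro vol_mono fmeasurable.finite_Union Am) auto
  qed auto
  show ?thesis
  proof
    have "pairwise disjnt (interior ` \<D>')"
    proof (rule pairwiseI)
      fix X Y assume "X \<in> interior ` \<D>'" "Y \<in> interior ` \<D>'" "X \<noteq> Y"
      then obtain K L where KL: "K \<in> \<D>'" "L \<in> \<D>'" "X = interior K" "Y = interior L" "K \<noteq> L" by blast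
      then have "interior K \<inter> interior L = {}" using D'(1) pairwiseD[OF D(3), of K L] by blast
      then show "disjnt X Y" using KL by (simp add: disjnt_def)
    qed
    moreover have "\<exists>a b. interior K = box a b" if "K \<in> \<D>'" for K
      using D(2)[of K] D'(1) that interior_cbox by (metis subsetD)
    ultimately show "box_family (interior ` \<D>')"
      using D' D(2) by (auto simp: box_family_def)
    show "\<Union>(interior ` \<D>') \<subseteq> A" using sub D'(1) interior_subset by blast
    \<comment> \<open>The covering boxes may share boundary points; passing to their interiors makes
      them disjoint and loses only null sets.\<close>
    have "convex K" if "K \<in> \<D>'" for K using D(2)[of K] D'(1) that convex_box(1) by (metis subsetD)
    then have neg: "negligible (\<Union>K\<in>\<D>'. frontier K)"
      using D'(2) by (intro negligible_Union) (auto intro!: negligible_convex_frontier)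
    have "vol (\<Union>\<D>') = vol (\<Union>(interior ` \<D>'))"
    proof (rule measure_negligible_symdiff)
      show "\<Union>(interior ` \<D>') \<in> lmeasurable" using box_family_Union[OF \<open>box_family (interior ` \<D>')\<close>] by blast
      show "negligible (\<Union>(interior ` \<D>') - \<Union>\<D>' \<union> (\<Union>\<D>' - \<Union>(interior ` \<D>')))"
        by (rule negligible_subset[OF neg]) (use interior_subset closure_subset in \<open>fastforce simp: frontier_def\<close>)
    qed
    then show "vol A - e < vol (\<Union>(interior ` \<D>'))" using D'(3) UD by simp
  qed
qed

lemma brunn_minkowski_open:
  fixes A B :: "'a::euclidean_space set"
  assumes A: "open A" "bounded A" "A \<noteq> {}" and B: "open B" "bounded B" "B \<noteq> {}"
  shows "vol_radius A + vol_radius B \<le>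
    vol_radius (A + B)"
proof -
  let ?n = "DIM('a)"
  have Am: "A \<in> lmeasurable" "B \<in> lmeasurable" using A B by (auto intro: lmeasurable_open)
  have vpos: "vol A > 0" "vol B > 0" by (intro measure_pos_open A B Am)+
  define \<epsilon> where "\<epsilon> k = inverse (real (Suc k))" for k
  have e: "\<epsilon> k > 0" for k by (simp add: \<epsilon>_def)
  have elim: "\<epsilon> \<longlonglongrightarrow> 0" unfolding \<epsilon>_def by (rule LIMSEQ_inverse_real_of_nat)
  have lim: "(\<lambda>k. root ?n (vol A - \<epsilon> k) + root ?n (vol B - \<epsilon> k)) \<longlonglongrightarrow>
     root ?n (vol A - 0) + root ?n (vol B - 0)"
    by (intro tendsto_intros elim)
  have "\<forall>\<^sub>F k in sequentially. \<epsilon> k < min (vol A) (vol B)"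
    by (rule order_tendstoD(2)[OF elim]) (use vpos in simp)
  then have "\<forall>\<^sub>F k in sequentially. root ?n (vol A - \<epsilon> k) + root ?n (vol B - \<epsilon> k) \<le>
      vol_radius (A + B)"
  proof eventually_elim
    case (elim k)
    obtain \<A> where \<A>: "box_family \<A>" "\<Union>\<A> \<subseteq> A" "vol A - \<epsilon> k < vol (\<Union>\<A>)"
      using box_family_inner_approx[OF A(1,2) e] by metis
    obtain \<B> where \<B>: "box_family \<B>" "\<Union>\<B> \<subseteq> B" "vol B - \<epsilon> k < vol (\<Union>\<B>)"
      using box_family_inner_approx[OF B(1,2) e] by metis
    have "\<A> \<noteq> {}" "\<B> \<noteq> {}" using \<A>(3) \<B>(3) elim by auto
    have "root ?n (vol A - \<epsilon> k) + root ?n (vol B - \<epsilon> k) \<le>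
      vol_radius (\<Union>\<A>) + vol_radius (\<Union>\<B>)"
      using \<A>(3) \<B>(3) by (intro add_mono real_root_le_mono) auto
    also have "\<dots> \<le> vol_radius (\<Union>\<A> + \<Union>\<B>)"
      by (intro brunn_minkowski_box_family \<A>(1) \<B>(1)) fact+
    also have "\<dots> \<le> vol_radius (A + B)"
      by (intro real_root_le_mono vol_mono lmeasurable_open_sum A B
          box_family_Union[OF \<A>(1)] box_family_Union[OF \<B>(1)] set_plus_mono2 \<A>(2) \<B>(2)) simp
    finally show ?case .
  qed
  from tendsto_upperbound[OF lim this] show ?thesis by simp
qed

text \<open>Frontiers of convex sets are null, so interiors carry the full volume and the open case
  applies. If one interior is empty, that volume is 0, and the sum contains a translate of the other
  body.\<close>

theorem brunn_minkowski:
  fixes K L :: "'a::euclidean_space set"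
  assumes K: "convex_body K" and L: "convex_body L"
  shows "vol_radius K + vol_radius L \<le>
    vol_radius (K + L)"
proof -
  have sub: "vol M \<le> vol (M + N)" if M: "convex_body M" and N: "convex_body N" for M N :: "'a set"
  proof -
    obtain x where "x \<in> N" using N by (auto simp: convex_body_def)
    then have "(+) x ` M \<subseteq> M + N" by (auto simp: set_plus_def add.commute)
    moreover have "compact (M + N)" unfolding set_plus_UN using M N by (auto simp: convex_body_def intro: compact_sums')
    ultimately have "vol ((+) x ` M) \<le> vol (M + N)"
      using M by (intro vol_mono measurable_translation)
        (auto simp: convex_body_def intro: lmeasurable_compact)
    then show ?thesis by (simp add: measure_translation)
  qed
  have int: "vol (interior M) = vol M" if "convex_body M" for M :: "'a set"
    using that by (intro measure_interior) (auto simp: convex_body_def compact_imp_bounded negligible_convex_frontier)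
  consider "interior K = {}" | "interior L = {}" | "interior K \<noteq> {}" "interior L \<noteq> {}" by blast
  then show ?thesis
  proof cases
    case 1
    then have "vol K = 0" using int[OF K] by simp
    then show ?thesis using sub[OF L K] by (simp add: real_root_le_mono add.commute)
  next
    case 2
    then have "vol L = 0" using int[OF L] by simp
    then show ?thesis using sub[OF K L] by (simp add: real_root_le_mono)
  next
    case 3
    have c: "compact (K + L)" unfolding set_plus_UN using K L by (auto simp: convex_body_def intro: compact_sums')
    have b: "bounded (interior K)" "bounded (interior L)"
      using K L by (auto simp: convex_body_def intro: bounded_interior compact_imp_bounded)
    have "vol_radius K + vol_radius L \<le>
        vol_radius (interior K + interior L)"
      using brunn_minkowski_open[OF open_interior b(1) 3(1) open_interior b(2) 3(2)]
      unfolding int[OF K] int[OF L] .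
    also have "\<dots> \<le> vol_radius (K + L)"
      by (intro real_root_le_mono vol_mono lmeasurable_open_sum b set_plus_mono2
         interior_subset lmeasurable_compact c) auto
    finally show ?thesis .
  qed
qed

section \<open>The equality case\<close>

lemma subset_if_support_le:
  fixes K L :: "'a::euclidean_space set"
  assumes K: "convex_body K" and L: "convex_body L" and le: "\<And>u. support_function K u \<le> support_function L u"
  shows "K \<subseteq> L"
proof
  fix x assume x: "x \<in> K"
  show "x \<in> L"
  proof (rule ccontr)
    assume "x \<notin> L"
    then obtain a b where ab: "a \<bullet> x < b" "\<forall>y\<in>L. a \<bullet> y > b"
      using separating_hyperplane_closed_point[of L x] L by (auto simp: convex_body_def compact_imp_closed)
    have "bdd_above ((\<lambda>y. y \<bullet> - a) ` K)"
      using K by (intro compact_imp_bounded[THEN bounded_imp_bdd_above] compact_continuous_image continuous_intros) (auto simp: convex_body_def)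
    then have "x \<bullet> - a \<le> support_function K (- a)" unfolding support_function_def by (intro cSUP_upper x)
    also have "\<dots> \<le> support_function L (- a)" by (rule le)
    also have "\<dots> \<le> - b" unfolding support_function_def
      using L ab by (intro cSUP_least) (auto simp: convex_body_def inner_commute intro: less_imp_le)
    finally show False using ab(1) by (simp add: inner_commute)
  qed
qed

lemma support_attained:
  fixes K :: "'a::euclidean_space set"
  assumes "convex_body K"
  obtains x where "x \<in> K" "x \<bullet> u = support_function K u" "\<And>y. y \<in> K \<Longrightarrow> y \<bullet> u \<le> support_function K u"
proof -
  have "\<exists>x\<in>K. \<forall>y\<in>K. y \<bullet> u \<le> x \<bullet> u"
    using assms by (intro continuous_attains_sup continuous_intros) (auto simp: convex_body_def)
  then obtain x where x: "x \<in> K" "\<And>y. y \<in> K \<Longrightarrow> y \<bullet> u \<le> x \<bullet> u" by blast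
  have "support_function K u = x \<bullet> u" unfolding support_function_def
    using x by (intro cSup_eq_maximum) auto
  then show ?thesis using that x by metis
qed

lemma support_ge: "convex_body K \<Longrightarrow> y \<in> K \<Longrightarrow> y \<bullet> u \<le> support_function K u"
  using support_attained by metis

lemma support_le_iff:
  assumes "convex_body K" shows "support_function K u \<le> c \<longleftrightarrow> (\<forall>y\<in>K. y \<bullet> u \<le> c)"
  using support_attained[OF assms, of u] by (metis order_trans)

text \<open>Summing the hypothesis over a partition of mesh \<open>h\<close> gives the claim up to a shift by \<open>h\<close>.\<close>
lemma increments_le:
  fixes W V :: "real \<Rightarrow> real"
  assumes contW: "continuous_on {0<..<1} W"
    and inc: "\<And>m h. 0 < m - h \<Longrightarrow> m + h < 1 \<Longrightarrow> h > 0 \<Longrightarrow> W (m + h) - W m \<ge> V m - V (m - h)"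
    and ab: "0 < a" "a < b" "b < 1"
  shows "V b - V a \<le> W b - W a"
proof -
  define h where "h N = (b - a) / real (Suc N)" for N
  have hpos: "h N > 0" for N using ab by (simp add: h_def)
  have hlim: "h \<longlonglongrightarrow> 0"
    unfolding h_def using tendsto_mult[OF tendsto_const[of "b - a"] LIMSEQ_inverse_real_of_nat] by (simp add: divide_inverse)
  \<comment> \<open>The comparison interval for \<open>W\<close> ends at \<open>b + h N\<close>,
    which has to stay below 1.\<close>
  have ev: "\<forall>\<^sub>F N in sequentially. h N < 1 - b"
    by (rule order_tendstoD(2)[OF hlim]) (use ab in simp)
  have key: "W (b + h N) - W (a + h N) \<ge> V b - V a" if N: "h N < 1 - b" for N
  proof -
    have Nh: "real (Suc N) * h N = b - a" by (simp add: h_def)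
    have "k \<le> Suc N \<Longrightarrow> W (a + real k * h N + h N) - W (a + h N) \<ge> V (a + real k * h N) - V a" for k
    proof (induction k)
      case (Suc k)
      define m where "m = a + real (Suc k) * h N"
      have "real (Suc k) * h N \<le> real (Suc N) * h N" using Suc.prems hpos[of N] by (intro mult_right_mono) auto
      then have "m \<le> b" using Nh by (simp add: m_def)
      moreover have mk: "a + real k * h N = m - h N" by (simp add: m_def algebra_simps)
      moreover have "real k * h N \<ge> 0" using hpos[of N] by simp
      then have "0 < m - h N" using mk ab by linarith
      ultimately have "W (m + h N) - W m \<ge> V m - V (m - h N)"
        using inc[of m "h N"] N hpos[of N] ab by simp
      moreover have "W (m - h N + h N) - W (a + h N) \<ge> V (m - h N) - V a" using Suc mk by simp
      ultimately show ?case unfolding m_def[symmetric] by simp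
    qed simp
    from this[of "Suc N"] show ?thesis unfolding Nh by simp
  qed
  have Wb: "isCont W b" "isCont W a"
    using contW ab by (auto simp: continuous_on_eq_continuous_at)
  have "(\<lambda>N. b + h N) \<longlonglongrightarrow> b + 0" "(\<lambda>N. a + h N) \<longlonglongrightarrow> a + 0" by (intro tendsto_intros hlim)+
  then have "(\<lambda>N. W (b + h N) - W (a + h N)) \<longlonglongrightarrow> W b - W a"
    using Wb by (intro tendsto_diff isCont_tendsto_compose[of _ W]) auto
  moreover have "\<forall>\<^sub>F N in sequentially. V b - V a \<le> W (b + h N) - W (a + h N)"
    using ev by eventually_elim (rule key)
  ultimately show ?thesis by (rule tendsto_lowerbound) simp
qed

lemma interior_Int_halfspace_nonempty:
  fixes K :: "'a::euclidean_space set"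
  assumes K: "convex_body K" and "vol (K \<inter> H) > 0"
  shows "interior K \<inter> H \<noteq> {}"
proof
  assume "interior K \<inter> H = {}"
  then have "K \<inter> H \<subseteq> frontier K" using closure_subset by (auto simp: frontier_def)
  moreover have "negligible (frontier K)" using K by (simp add: convex_body_def negligible_convex_frontier)
  ultimately have "negligible (K \<inter> H)" using negligible_subset by blast
  then show False using assms(2) negligible_imp_measure0 by force
qed

text \<open>There are interior points below \<open>c'\<close> and above \<open>c\<close>. One of
  them, or a point of the segment joining them, lies in the open slab between the two levels, so the
  slab contains an open piece of \<open>K\<close>.\<close>

lemma halfspace_measure_strict:
  fixes K :: "'a::euclidean_space set"
  assumes K: "convex_body K" and u: "u \<noteq> 0" and c: "c < c'"
    and pos: "vol (K \<inter> {x. x \<bullet> u \<le> c'}) > 0"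
    and less: "vol (K \<inter> {x. x \<bullet> u \<le> c}) < vol K"
  shows "vol (K \<inter> {x. x \<bullet> u \<le> c}) < vol (K \<inter> {x. x \<bullet> u \<le> c'})"
proof -
  note Km = convex_body_lmeasurable[OF K]
  have "interior K \<inter> {x. x \<bullet> u < c'} \<noteq> {}"
    using interior_Int_halfspace_nonempty[OF K] measure_halfspace_split[OF Km u, of c'] pos by simp
  then obtain y where y: "y \<in> interior K" "y \<bullet> u < c'" by blast
  have "interior K \<inter> {x. x \<bullet> u > c} \<noteq> {}"
    using interior_Int_halfspace_nonempty[OF K] measure_halfspace_split[OF Km u, of c] less by simp
  then obtain z where z: "z \<in> interior K" "z \<bullet> u > c" by blast
  let ?S = "interior K \<inter> {x. x \<bullet> u > c} \<inter> {x. x \<bullet> u < c'}"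
  have "?S \<noteq> {}"
  proof (cases "y \<bullet> u > c \<or> z \<bullet> u < c'")
    case True then show ?thesis using y z by blast
  next
    case False
    \<comment> \<open>Chosen so that the point on the segment has height (c + c')/2.\<close>
    define t where "t = ((c + c') / 2 - y \<bullet> u) / (z \<bullet> u - y \<bullet> u)"
    have d: "z \<bullet> u - y \<bullet> u > 0" using False y z c by linarith
    have t: "0 \<le> t" "t \<le> 1" using False c d by (auto simp: t_def field_simps)
    define x where "x = (1 - t) *\<^sub>R y + t *\<^sub>R z"
    have "x \<in> interior K" unfolding x_def
      using convex_interior[of K] K t y z by (intro convexD) (auto simp: convex_body_def)
    moreover have "t * (z \<bullet> u - y \<bullet> u) = (c + c') / 2 - y \<bullet> u" using d by (simp add: t_def)
    then have "x \<bullet> u = (c + c') / 2" by (simp add: x_def inner_add_left algebra_simps)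
    ultimately show ?thesis using c by auto
  qed
  moreover have "open ?S" by (intro open_Int open_interior open_Collect_less continuous_intros)
  moreover have "bounded ?S" using K by (auto simp: convex_body_def intro: bounded_Int bounded_interior compact_imp_bounded)
  ultimately have S: "vol ?S > 0" "?S \<in> lmeasurable" using measure_pos_open lmeasurable_open by blast+
  have m: "K \<inter> {x. x \<bullet> u \<le> c} \<in> lmeasurable" "K \<inter> {x. x \<bullet> u \<le> c'} \<in> lmeasurable"
    by (intro lmeasurable_halfspace_Int Km)+
  have "vol (K \<inter> {x. x \<bullet> u \<le> c}) + vol ?S = vol (K \<inter> {x. x \<bullet> u \<le> c} \<union> ?S)"
  proof (rule measure_Un2[OF m(1) S(2), symmetric, THEN trans[rotated]])
    have "?S - K \<inter> {x. x \<bullet> u \<le> c} = ?S" by auto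
    then show "vol (K \<inter> {x. x \<bullet> u \<le> c}) + vol ?S =
      vol (K \<inter> {x. x \<bullet> u \<le> c}) + vol (?S - K \<inter> {x. x \<bullet> u \<le> c})" by simp
  qed
  also have "\<dots> \<le> vol (K \<inter> {x. x \<bullet> u \<le> c'})"
    using c interior_subset[of K] by (intro vol_mono fmeasurable.Un m S) force+
  finally show ?thesis using S by simp
qed

text \<open>A point of \<open>K\<close> beyond the half-space is a limit of interior points, so an
  open piece of positive volume would be cut off.\<close>

lemma full_measure_halfspace:
  fixes K :: "'a::euclidean_space set"
  assumes K: "convex_body K" and int: "interior K \<noteq> {}" and u: "u \<noteq> 0"
    and full: "vol (K \<inter> {x. x \<bullet> u \<le> c}) = vol K"
  shows "K \<subseteq> {x. x \<bullet> u \<le> c}"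
proof (rule ccontr)
  assume "\<not> K \<subseteq> {x. x \<bullet> u \<le> c}"
  then obtain y where "y \<in> K" "\<not> y \<bullet> u \<le> c" by blast
  then have y: "y \<in> K" "y \<bullet> u > c" by simp_all
  have op: "open {x. x \<bullet> u > c}" by (intro open_Collect_less continuous_intros)
  have "closure (interior K) = closure K" using K int by (simp add: convex_closure_interior convex_body_def)
  then have "y \<in> closure (interior K)" using y closure_subset by blast
  then have ne: "{x. x \<bullet> u > c} \<inter> interior K \<noteq> {}" using op y open_Int_closure_eq_empty by blast
  have "bounded (interior K)" using K by (auto simp: convex_body_def intro: bounded_interior compact_imp_bounded)
  then have m: "{x. x \<bullet> u > c} \<inter> interior K \<in> lmeasurable" using op by (intro lmeasurable_open) (auto intro: bounded_Int)
  have "0 < vol ({x. x \<bullet> u > c} \<inter> interior K)"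
    using op by (intro measure_pos_open ne m) auto
  also have "\<dots> \<le> vol (K \<inter> {x. x \<bullet> u > c})"
    using interior_subset[of K] by (intro vol_mono m lmeasurable_halfspace_Int convex_body_lmeasurable K) auto
  also have "\<dots> = 0" using measure_halfspace_split[OF convex_body_lmeasurable[OF K] u, of c] full by simp
  finally show False by simp
qed

lemma convex_body_halfspace:
  fixes K :: "'a::euclidean_space set"
  assumes K: "convex_body K" and H: "closed H" "convex H" and pos: "vol (K \<inter> H) > 0"
  shows "convex_body (K \<inter> H)"
  using assms unfolding convex_body_def by (auto intro: compact_Int_closed convex_Int)

section \<open>Quantiles of two bodies of equal volume with equality in Brunn--Minkowski\<close>

context
  fixes K L :: "'a::euclidean_space set" and v :: real and u :: 'a
  assumes K: "convex_body K" and L: "convex_body L" and v: "v > 0"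
    and vK: "vol K = v" and vL: "vol L = v"
    and vKL: "vol (K + L) = 2 ^ DIM('a) * v" and u: "u \<noteq> 0"
begin

abbreviation (input) low :: "'a set \<Rightarrow> real \<Rightarrow> real" where
  "low M c \<equiv> vol (M \<inter> {x. x \<bullet> u \<le> c})"

lemma low_mono: "convex_body M \<Longrightarrow> c \<le> d \<Longrightarrow> low M c \<le> low M d"
  by (intro vol_mono lmeasurable_halfspace_Int convex_body_lmeasurable) auto

text \<open>The lower pieces at \<open>wx\<close> and \<open>vy\<close> put at least (x + y)^n v of
  K + L below wx + vy. The upper pieces at \<open>wm\<close> and \<open>vm\<close> put at least 2^n
  (1 - m^n) v above wm + vm; as the total is 2^n v, at most (2 m)^n v = (x + y)^n v lies below. The
  reverse strict order of the heights would contradict strict growth of the volume cut off.\<close>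

lemma quantile_sum_ge:
  assumes x: "0 < x" "x < 1" and y: "0 < y" "y < 1" and m: "m = (x + y) / 2"
    and wx: "low K wx = x ^ DIM('a) * v" and vy: "low L vy = y ^ DIM('a) * v"
    and wm: "low K wm = m ^ DIM('a) * v" and vm: "low L vm = m ^ DIM('a) * v"
  shows "wm + vm \<le> wx + vy"
proof (rule ccontr)
  assume "\<not> wm + vm \<le> wx + vy"
  then have lt: "wx + vy < wm + vm" by simp
  let ?n = "DIM('a)"
  have KL: "convex_body (K + L)" by (intro convex_body_sum K L)
  have m01: "0 < m" "m < 1" using x y m by auto
  have mn: "m ^ ?n < 1" using m01 by (simp add: power_less_one_iff)
  have hs: "closed {x. x \<bullet> u \<le> c}" "convex {x. x \<bullet> u \<le> c}" "closed {x. x \<bullet> u \<ge> c}" "convex {x. x \<bullet> u \<ge> c}" for c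
    by (auto simp: inner_commute[of _ u] convex_halfspace_le convex_halfspace_ge intro!: closed_Collect_le continuous_intros)
  have "(x + y) ^ ?n * v \<le> low (K + L) (wx + vy)"
  proof -
    have b: "convex_body (K \<inter> {x. x \<bullet> u \<le> wx})" "convex_body (L \<inter> {x. x \<bullet> u \<le> vy})"
      using wx vy x y v by (auto intro!: convex_body_halfspace K L hs)
    have "root ?n (x ^ ?n * v) + root ?n (y ^ ?n * v) \<le> vol_radius (K \<inter> {x. x \<bullet> u \<le> wx} + L \<inter> {x. x \<bullet> u \<le> vy})"
      using brunn_minkowski[OF b] wx vy by simp
    also have "\<dots> \<le> root ?n (low (K + L) (wx + vy))"
    proof (intro real_root_le_mono vol_mono lmeasurable_halfspace_Int convex_body_lmeasurable KL convex_body_sum b)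
      show "K \<inter> {x. x \<bullet> u \<le> wx} + L \<inter> {x. x \<bullet> u \<le> vy} \<subseteq> (K + L) \<inter> {x. x \<bullet> u \<le> wx + vy}"
        by (auto simp: set_plus_def inner_add_left intro: add_mono)
    qed simp
    finally have "(x + y) * root ?n v \<le> root ?n (low (K + L) (wx + vy))"
      using x y by (simp add: real_root_mult real_root_power_cancel distrib_right)
    then have "((x + y) * root ?n v) ^ ?n \<le> root ?n (low (K + L) (wx + vy)) ^ ?n"
      using x y v by (intro power_mono) auto
    then show ?thesis using v by (simp add: power_mult_distrib)
  qed
  moreover have "low (K + L) (wm + vm) \<le> (x + y) ^ ?n * v"
  proof -
    have ge: "vol (K \<inter> {x. x \<bullet> u \<ge> wm}) = (1 - m ^ ?n) * v" "vol (L \<inter> {x. x \<bullet> u \<ge> vm}) = (1 - m ^ ?n) * v"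
      using measure_halfspace_split(3)[OF convex_body_lmeasurable[OF K] u, of wm]
        measure_halfspace_split(3)[OF convex_body_lmeasurable[OF L] u, of vm] vK vL wm vm by (simp_all add: algebra_simps)
    have b: "convex_body (K \<inter> {x. x \<bullet> u \<ge> wm})" "convex_body (L \<inter> {x. x \<bullet> u \<ge> vm})"
      using ge mn v by (auto intro!: convex_body_halfspace K L hs)
    have "root ?n ((1 - m ^ ?n) * v) + root ?n ((1 - m ^ ?n) * v) \<le> vol_radius (K \<inter> {x. x \<bullet> u \<ge> wm} + L \<inter> {x. x \<bullet> u \<ge> vm})"
      using brunn_minkowski[OF b] ge by simp
    also have "\<dots> \<le> vol_radius ((K + L) \<inter> {x. x \<bullet> u \<ge> wm + vm})"
    proof (intro real_root_le_mono vol_mono lmeasurable_halfspace_Int convex_body_lmeasurable KL convex_body_sum b)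
      show "K \<inter> {x. x \<bullet> u \<ge> wm} + L \<inter> {x. x \<bullet> u \<ge> vm} \<subseteq> (K + L) \<inter> {x. x \<bullet> u \<ge> wm + vm}"
        by (auto simp: set_plus_def inner_add_left intro: add_mono)
    qed simp
    finally have "2 * root ?n ((1 - m ^ ?n) * v) \<le> vol_radius ((K + L) \<inter> {x. x \<bullet> u \<ge> wm + vm})" by simp
    then have "(2 * root ?n ((1 - m ^ ?n) * v)) ^ ?n \<le> vol_radius ((K + L) \<inter> {x. x \<bullet> u \<ge> wm + vm}) ^ ?n"
      using mn v by (intro power_mono) auto
    then have "2 ^ ?n * ((1 - m ^ ?n) * v) \<le> vol ((K + L) \<inter> {x. x \<bullet> u \<ge> wm + vm})"
      using mn v by (simp add: power_mult_distrib)
    also have "\<dots> = 2 ^ ?n * v - low (K + L) (wm + vm)"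
      using measure_halfspace_split(3)[OF convex_body_lmeasurable[OF KL] u, of "wm + vm"] vKL by simp
    finally have "low (K + L) (wm + vm) \<le> (2 * m) ^ ?n * v" by (simp add: algebra_simps power_mult_distrib)
    moreover have "2 * m = x + y" using m by simp
    ultimately show ?thesis by (simp only:)
  qed
  \<comment> \<open>Strict growth needs a positive portion at the upper level and a portion that is
    not full at the lower level; the latter comes from x + y < 2.\<close>
  moreover have "low (K + L) (wx + vy) < low (K + L) (wm + vm)"
  proof (rule halfspace_measure_strict[OF KL u lt])
    have "0 < (x + y) ^ ?n * v" using x y v by simp
    also have "\<dots> \<le> low (K + L) (wx + vy)" by fact
    also have "\<dots> \<le> low (K + L) (wm + vm)" using lt by (intro low_mono KL) simp
    finally show "0 < low (K + L) (wm + vm)" .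
    have "low (K + L) (wx + vy) \<le> low (K + L) (wm + vm)" using lt by (intro low_mono KL) simp
    also have "\<dots> \<le> (x + y) ^ ?n * v" by fact
    also have "\<dots> < 2 ^ ?n * v" using x y v by (intro mult_strict_right_mono power_strict_mono) auto
    finally show "low (K + L) (wx + vy) < vol (K + L)" by (simp add: vKL)
  qed
  ultimately show False by simp
qed

text \<open>\<open>W\<close> is an arbitrary choice of quantiles. The volume cut off grows strictly
  through the level \<open>W x\<close>, so a nearby fraction cannot have its quantile on the wrong
  side of a given height.\<close>

lemma quantile_continuous:
  assumes M: "convex_body M" "vol M = v" and W: "\<And>x. 0 < x \<Longrightarrow> x < 1 \<Longrightarrow> low M (W x) = x ^ DIM('a) * v"
  shows "continuous_on {0<..<1} W"
proof -
  have "isCont W x" if x: "0 < x" "x < 1" for x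
    unfolding isCont_def
  proof (rule order_tendstoI)
    let ?f = "\<lambda>y. y ^ DIM('a) * v"
    have f: "(?f \<longlongrightarrow> ?f x) (at x)" by (intro tendsto_intros)
    have fx: "0 < ?f x" "?f x < v" using x v by (auto simp: power_less_one_iff)
    have ev: "\<forall>\<^sub>F y in at x. y \<in> {0<..<1}" using x by (intro eventually_at_in_open') auto
    fix a
    {
      assume "a < W x"
      have "low M a < ?f x"
      proof (cases "low M a < v")
        case True
        then have "low M a < low M (W x)"
          using W[OF x] fx M \<open>a < W x\<close> by (intro halfspace_measure_strict u) auto
        then show ?thesis using W[OF x] by simp
      next
        case False
        then have "v \<le> low M (W x)" using low_mono[OF M(1), of a "W x"] \<open>a < W x\<close> by simp
        then have "v \<le> ?f x" using W[OF x] by linarith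
        then show ?thesis using fx by linarith
      qed
      from order_tendstoD(1)[OF f this] ev show "\<forall>\<^sub>F y in at x. a < W y"
      proof eventually_elim
        case (elim y)
        then have "low M a < low M (W y)" using W[of y] by simp
        then show ?case using low_mono[OF M(1), of "W y" a] by (meson linorder_not_le)
      qed
    next
      assume "W x < a"
      have "?f x < low M a"
      proof -
        have "low M (W x) \<le> low M a" using \<open>W x < a\<close> by (intro low_mono M) simp
        then have "0 < low M a" using W[OF x] fx by simp
        then have "low M (W x) < low M a"
          using W[OF x] fx M \<open>W x < a\<close> by (intro halfspace_measure_strict u) auto
        then show ?thesis using W[OF x] by simp
      qed
      from order_tendstoD(2)[OF f this] ev show "\<forall>\<^sub>F y in at x. W y < a"
      proof eventually_elim
        case (elim y)
        then have "low M (W y) < low M a" using W[of y] by simp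
        then show ?case using low_mono[OF M(1), of a "W y"] by (meson linorder_not_le)
      qed
    }
  qed
  then show ?thesis by (simp add: continuous_on_eq_continuous_at)
qed

text \<open>The quantile functions of the two bodies differ by a constant; the distribution
  functions are then shifts of each other, as every difference between them would leave room for a
  quantile.\<close>

lemma marginal_shift: "\<exists>c. \<forall>s. low K s = low L (s - c)"
proof -
  let ?n = "DIM('a)"
  have Kb: "bounded K" "bounded L" using K L by (auto simp: convex_body_def compact_imp_bounded)
  have "\<exists>c. low K c = x ^ ?n * v" if "0 < x" "x < 1" for x
    using halfspace_fraction[OF convex_body_lmeasurable[OF K] Kb(1) u, of "x ^ ?n"] that vK
    by (metis less_imp_le power_le_one zero_le_power)
  then obtain W where W: "\<And>x. 0 < x \<Longrightarrow> x < 1 \<Longrightarrow> low K (W x) = x ^ ?n * v" by metis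
  have "\<exists>c. low L c = x ^ ?n * v" if "0 < x" "x < 1" for x
    using halfspace_fraction[OF convex_body_lmeasurable[OF L] Kb(2) u, of "x ^ ?n"] that vL
    by (metis less_imp_le power_le_one zero_le_power)
  then obtain V where V: "\<And>x. 0 < x \<Longrightarrow> x < 1 \<Longrightarrow> low L (V x) = x ^ ?n * v" by metis
  have contW: "continuous_on {0<..<1} W" by (rule quantile_continuous[OF K vK W])
  have contV: "continuous_on {0<..<1} V" by (rule quantile_continuous[OF L vL V])
  have sum: "W m + V m \<le> W x + V y" if "0 < x" "x < 1" "0 < y" "y < 1" "m = (x + y) / 2" for x y m
    using that by (intro quantile_sum_ge[where x = x and y = y and m = m] W V) auto
  \<comment> \<open>The midpoint inequality is used with (m + h, m - h) and with the arguments
    exchanged; \<open>increments_le\<close> turns these into inequalities in both directions between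
    the increments of \<open>W\<close> and \<open>V\<close>.\<close>
  have incW: "W (m + h) - W m \<ge> V m - V (m - h)" if "0 < m - h" "m + h < 1" "h > 0" for m h
    using sum[of "m + h" "m - h" m] that by simp
  have incV: "V (m + h) - V m \<ge> W m - W (m - h)" if "0 < m - h" "m + h < 1" "h > 0" for m h
    using sum[of "m - h" "m + h" m] that by simp
  have eq: "W a - V a = W b - V b" if "0 < a" "a < b" "b < 1" for a b
    using increments_le[OF contW incW that] increments_le[OF contV incV that] by simp
  define c where "c = W (1/2) - V (1/2)"
  have c: "W x = V x + c" if "0 < x" "x < 1" for x
  proof (cases "x = 1/2")
    case False
    then consider "x < 1/2" | "1/2 < x" by linarith
    then show ?thesis
    proof cases
      case 1 then show ?thesis using eq[of x "1/2"] that by (simp add: c_def)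
    next
      case 2 then show ?thesis using eq[of "1/2" x] that by (simp add: c_def)
    qed
  next
    case True
    show ?thesis unfolding True c_def by simp
  qed
  \<comment> \<open>As \<open>x\<close> runs through (0,1), the level x^n v takes every value
    strictly between 0 and v; the midpoint of p and q is such a value.\<close>
  have between: "\<exists>x. 0 < x \<and> x < 1 \<and> p < x ^ ?n * v \<and> x ^ ?n * v < q" if "0 \<le> p" "p < q" "q \<le> v" for p q
  proof -
    define r where "r = (p + q) / 2 / v"
    have r: "0 < r" "r < 1" "p < r * v" "r * v < q" using that v by (auto simp: r_def field_simps)
    have "0 < root ?n r" "root ?n r < 1" "root ?n r ^ ?n = r" using r by (auto simp: real_root_lt_1_iff)
    then show ?thesis using r by metis
  qed
  have le_v: "low M s \<le> vol M" "0 \<le> low M s" if "convex_body M" for M s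
    using that by (simp_all add: vol_mono[OF Int_lower1 lmeasurable_halfspace_Int(1)] convex_body_lmeasurable)
  have "low K s = low L (s - c)" for s
  proof (rule ccontr)
    assume "low K s \<noteq> low L (s - c)"
    then consider "low L (s - c) < low K s" | "low K s < low L (s - c)" by linarith
    then show False
    proof cases
      case 1
      then obtain x where x: "0 < x" "x < 1" "low L (s - c) < x ^ ?n * v" "x ^ ?n * v < low K s"
        using between[OF le_v(2)[OF L]] le_v(1)[OF K] vK by metis
      have "W x < s"
      proof (rule ccontr)
        assume "\<not> W x < s"
        then have "low K s \<le> low K (W x)" by (intro low_mono K) simp
        then show False using W[OF x(1,2)] x(4) by simp
      qed
      then have "low L (V x) \<le> low L (s - c)" using c[of x] x by (intro low_mono L) simp
      then show False using V[of x] x by simp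
    next
      case 2
      then obtain x where x: "0 < x" "x < 1" "low K s < x ^ ?n * v" "x ^ ?n * v < low L (s - c)"
        using between[OF le_v(2)[OF K]] le_v(1)[OF L] vL by metis
      have "V x < s - c"
      proof (rule ccontr)
        assume "\<not> V x < s - c"
        then have "low L (s - c) \<le> low L (V x)" by (intro low_mono L) simp
        then show False using V[OF x(1,2)] x(4) by simp
      qed
      then have "low K (W x) \<le> low K s" using c[of x] x by (intro low_mono K) simp
      then show False using W[of x] x by simp
    qed
  qed
  then show ?thesis by blast
qed

end

section \<open>Centroids and the equality case\<close>

lemma integrable_inner_lebesgue_on:
  fixes K :: "'a::euclidean_space set"
  assumes K: "convex_body K" shows "integrable (lebesgue_on K) (\<lambda>x. x)"
proof -
  interpret finite_measure "lebesgue_on K" by (rule finite_measure_lebesgue_on[OF convex_body_lmeasurable[OF K]])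
  obtain R where R: "\<And>x. x \<in> K \<Longrightarrow> norm x \<le> R"
    using K compact_imp_bounded[of K] unfolding convex_body_def bounded_iff by blast
  show ?thesis
  proof (rule integrable_const_bound[of _ R])
    show "AE x in lebesgue_on K. norm x \<le> R" using R by (intro AE_I2) simp
    show "(\<lambda>x. x) \<in> borel_measurable (lebesgue_on K)"
      by (intro measurable_restrict_space1 measurable_completion) simp
  qed
qed

text \<open>Equal distribution functions make the marginal of \<open>K\<close> the shifted marginal
  of \<open>L\<close>; integrating the identity against both expresses the shift by first
  moments.\<close>

lemma marginal_shift_integral:
  fixes K L :: "'a::euclidean_space set"
  assumes K: "convex_body K" and L: "convex_body L"
    and shift: "\<And>s. vol (K \<inter> {x. x \<bullet> u \<le> s}) = vol (L \<inter> {x. x \<bullet> u \<le> s - c})"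
  shows "integral\<^sup>L (lebesgue_on K) (\<lambda>x. x) \<bullet> u = integral\<^sup>L (lebesgue_on L) (\<lambda>x. x) \<bullet> u + c * vol L"
proof -
  note m = convex_body_lmeasurable[OF K] convex_body_lmeasurable[OF L]
  interpret KM: finite_borel_measure "marginal K u" by (rule finite_borel_measure_marginal[OF m(1)])
  interpret LM: finite_borel_measure "marginal L u" by (rule finite_borel_measure_marginal[OF m(2)])
  define N where "N = distr (marginal L u) borel (\<lambda>s. s + c)"
  have sets: "sets (marginal L u) = sets borel" by (simp add: marginal_def)
  have meas: "(\<lambda>s. s + c) \<in> measurable (marginal L u) borel"
    unfolding measurable_cong_sets[OF sets refl] by simp
  have N: "finite_borel_measure N"
    unfolding N_def by (intro finite_borel_measure.intro LM.finite_measure_distr meas finite_borel_measure_axioms.intro) simp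
  have "cdf N s = cdf (marginal K u) s" for s
  proof -
    have "cdf N s = measure (marginal L u) ((\<lambda>s. s + c) -` {..s} \<inter> space (marginal L u))"
      unfolding cdf_def N_def by (rule measure_distr[OF meas]) simp
    also have "(\<lambda>s. s + c) -` {..s} \<inter> space (marginal L u) = {..s - c}" by (auto simp: marginal_def)
    also have "measure (marginal L u) {..s - c} = vol (L \<inter> {x. x \<bullet> u \<le> s - c})"
      using measure_marginal[OF m(2), of "{..s - c}" u] by simp
    also have "\<dots> = cdf (marginal K u) s" by (simp add: cdf_marginal[OF m(1)] shift)
    finally show ?thesis .
  qed
  then have eq: "marginal K u = N"
    by (intro cdf_unique' N finite_borel_measure_marginal m) auto
  interpret LF: finite_measure "lebesgue_on L" by (rule finite_measure_lebesgue_on[OF m(2)])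
  have int: "integrable (lebesgue_on L) (\<lambda>x. x \<bullet> u)" using integrable_inner_lebesgue_on[OF L] by simp
  have mi: "(\<lambda>x. x \<bullet> u) \<in> measurable (lebesgue_on M) borel" for M :: "'a set" by (rule measurable_inner_lebesgue_on)
  have "integral\<^sup>L (lebesgue_on K) (\<lambda>x. x) \<bullet> u = integral\<^sup>L (lebesgue_on K) (\<lambda>x. x \<bullet> u)"
    using integrable_inner_lebesgue_on[OF K] by simp
  also have "\<dots> = integral\<^sup>L (marginal K u) (\<lambda>s. s)"
    unfolding marginal_def by (rule integral_distr[OF mi, symmetric]) simp
  also have "\<dots> = integral\<^sup>L (marginal L u) (\<lambda>s. s + c)"
    unfolding eq N_def by (rule integral_distr[OF meas]) simp
  also have "\<dots> = integral\<^sup>L (lebesgue_on L) (\<lambda>x. x \<bullet> u + c)"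
    unfolding marginal_def by (rule integral_distr[OF mi]) simp
  also have "\<dots> = integral\<^sup>L (lebesgue_on L) (\<lambda>x. x \<bullet> u) + c * vol L"
    using int by (subst Bochner_Integration.integral_add) (auto simp: measure_restrict_space fmeasurableD m)
  also have "integral\<^sup>L (lebesgue_on L) (\<lambda>x. x \<bullet> u) = integral\<^sup>L (lebesgue_on L) (\<lambda>x. x) \<bullet> u"
    using integrable_inner_lebesgue_on[OF L] by simp
  finally show ?thesis .
qed

lemma support_translate:
  assumes "convex_body L" shows "support_function ((+) p ` L) u = support_function L u + p \<bullet> u"
proof -
  obtain x where x: "x \<in> L" "x \<bullet> u = support_function L u" "\<And>y. y \<in> L \<Longrightarrow> y \<bullet> u \<le> support_function L u"
    using support_attained[OF assms] by metis
  have "support_function ((+) p ` L) u = (p + x) \<bullet> u"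
    unfolding support_function_def image_image
  proof (rule cSup_eq_maximum)
    show "(p + x) \<bullet> u \<in> (\<lambda>y. (p + y) \<bullet> u) ` L" using x(1) by (rule imageI)
    show "y \<le> (p + x) \<bullet> u" if "y \<in> (\<lambda>y. (p + y) \<bullet> u) ` L" for y
      using that x(2,3) by (auto simp: inner_add_left)
  qed
  then show ?thesis using x by (simp add: inner_add_left)
qed

text \<open>The vector \<open>p\<close> is the difference of the centroids, hence the same for all
  directions. The support value is the lowest level at which a half-space contains the full volume,
  so shifted marginals in direction \<open>u\<close> mean support values that differ by
  \<open>p \<bullet> u\<close>.\<close>

theorem brunn_minkowski_equality:
  fixes K L :: "'a::euclidean_space set"
  assumes K: "convex_body K" "interior K \<noteq> {}" and L: "convex_body L" "interior L \<noteq> {}"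
    and eqv: "vol L = vol K"
    and sum: "vol (K + L) = 2 ^ DIM('a) * vol K"
  shows "\<exists>p. K = (+) p ` L"
proof -
  define v where "v = vol K"
  have "v > 0"
  proof -
    have "0 < vol (interior K)"
      using K by (intro measure_pos_open lmeasurable_interior) (auto simp: convex_body_def compact_imp_bounded)
    also have "\<dots> \<le> v" unfolding v_def using K interior_subset
      by (intro vol_mono lmeasurable_interior convex_body_lmeasurable) (auto simp: convex_body_def compact_imp_bounded)
    finally show ?thesis .
  qed
  have vK: "vol K = v" and vL: "vol L = v" and vKL: "vol (K + L) = 2 ^ DIM('a) * v"
    using eqv sum by (auto simp: v_def)
  define p where "p = (integral\<^sup>L (lebesgue_on K) (\<lambda>x. x) - integral\<^sup>L (lebesgue_on L) (\<lambda>x. x)) /\<^sub>R v"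
  have supp: "support_function K u = support_function ((+) p ` L) u" for u
  proof (cases "u = 0")
    case True
    have "K \<noteq> {}" "L \<noteq> {}" using K L by (auto simp: convex_body_def)
    then show ?thesis unfolding support_function_def True by simp
  next
    case False
    obtain c where c: "\<And>s. vol (K \<inter> {x. x \<bullet> u \<le> s}) = vol (L \<inter> {x. x \<bullet> u \<le> s - c})"
      using marginal_shift[OF K(1) L(1) \<open>v > 0\<close> vK vL vKL False] by blast
    have "c = p \<bullet> u" using marginal_shift_integral[OF K(1) L(1) c] \<open>v > 0\<close>
      by (simp add: p_def vL inner_diff_left field_simps)
    have KU: "K \<inter> {x. x \<bullet> u \<le> support_function K u} = K" and LU: "L \<inter> {x. x \<bullet> u \<le> support_function L u} = L"
      using support_ge[OF K(1)] support_ge[OF L(1)] by blast+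
    have "K \<subseteq> {x. x \<bullet> u \<le> support_function L u + c}"
      by (rule full_measure_halfspace[OF K False]) (use c LU vK vL in simp)
    then have 1: "support_function K u \<le> support_function L u + c"
      unfolding support_le_iff[OF K(1)] by blast
    have "L \<subseteq> {x. x \<bullet> u \<le> support_function K u - c}"
      by (rule full_measure_halfspace[OF L False]) (use c[of "support_function K u"] KU vK vL in simp)
    then have 2: "support_function L u \<le> support_function K u - c"
      unfolding support_le_iff[OF L(1)] by blast
    from 1 2 show ?thesis unfolding support_translate[OF L(1)] \<open>c = p \<bullet> u\<close> by simp
  qed
  have pL: "convex_body ((+) p ` L)" by (rule convex_body_translate[OF L(1)])
  have "K \<subseteq> (+) p ` L" by (rule subset_if_support_le[OF K(1) pL]) (simp add: supp)
  moreover have "(+) p ` L \<subseteq> K" by (rule subset_if_support_le[OF pL K(1)]) (simp add: supp)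
  ultimately show ?thesis by blast
qed

section \<open>Relative surface area and support functions\<close>

text \<open>Extend \<open>u\<close>, \<open>v\<close> to a basis. In the coordinates given by inner
  products with this basis the set lies in a box with two sides \<open>w\<close> and all others
  bounded by \<open>R\<close>; the constant therefore does not depend on the position
  \<open>a\<close>, \<open>b\<close> of the strips.\<close>

lemma measure_double_strip:
  fixes u v :: "real^'n"
  assumes uv: "u \<noteq> v" "independent {u, v}"
  shows "\<exists>C. \<forall>a b w. w > 0 \<longrightarrow>
    {x. norm x \<le> R \<and> a \<le> x \<bullet> u \<and> x \<bullet> u \<le> a + w \<and> b \<le> x \<bullet> v \<and> x \<bullet> v \<le> b + w} \<in> lmeasurable \<and>
    vol {x. norm x \<le> R \<and> a \<le> x \<bullet> u \<and> x \<bullet> u \<le> a + w \<and> b \<le> x \<bullet> v \<and> x \<bullet> v \<le> b + w} \<le> C * w\<^sup>2"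
proof -
  obtain B where B: "{u, v} \<subseteq> B" "independent B" "span B = (UNIV :: (real^'n) set)"
    using maximal_independent_subset_extend[OF subset_UNIV uv(2)] by (metis top.extremum_uniqueI)
  have finB: "finite B" using B(2) independent_imp_finite by blast
  have "card B = CARD('n)" using B(2,3) dim_eq_card_independent[OF B(2)] dim_span[of B] by (simp add: dim_UNIV)
  then obtain f :: "'n \<Rightarrow> real^'n" where f: "bij_betw f UNIV B"
    using finite_same_card_bij[OF finite finB] by metis
  define T where "T x = (\<chi> k. x \<bullet> f k)" for x :: "real^'n"
  have linT: "linear T" unfolding T_def
    by (rule linearI) (auto simp: vec_eq_iff inner_add_left)
  have "inj T"
  proof (rule linear_injective_0[OF linT, THEN iffD2], intro allI impI)
    fix x assume "T x = 0"
    then have "x \<bullet> b = 0" if "b \<in> B" for b using f that by (auto simp: T_def vec_eq_iff bij_betw_def)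
    then have "orthogonal x x" using B(3) by (intro orthogonal_to_span[of x B]) (auto simp: orthogonal_def)
    then show "x = 0" by (simp add: orthogonal_self)
  qed
  then obtain g where g: "linear g" "\<And>x. g (T x) = x"
    using linear_injective_left_inverse[OF linT] by (metis comp_apply id_apply)
  obtain m where m: "\<And>S. S \<in> lmeasurable \<Longrightarrow> g ` S \<in> lmeasurable \<and> vol (g ` S) = m * vol S"
    using linear_scales_volume[OF g(1)] unfolding scales_volume_def by blast
  define M where "M = \<bar>R\<bar> * (\<Sum>b\<in>B. norm b)"
  have M: "M \<ge> 0" by (simp add: M_def sum_nonneg)
  define J where "J = {k. f k \<in> {u, v}}"
  have "inj f" using f by (simp add: bij_betw_def)
  have "J = f -` {u, v}" by (auto simp: J_def)
  then have cardJ: "card J = 2"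
    using card_vimage_inj[OF \<open>inj f\<close>, of "{u,v}"] f B(1) uv(1) by (auto simp: bij_betw_def)
  let ?S = "\<lambda>a b w. {x. norm x \<le> R \<and> a \<le> x \<bullet> u \<and> x \<bullet> u \<le> a + w \<and> b \<le> x \<bullet> v \<and> x \<bullet> v \<le> b + w}"
  have S: "?S a b w \<in> lmeasurable" for a b w
  proof (rule lmeasurable_compact)
    have "?S a b w = cball 0 R \<inter> {x. a \<le> x \<bullet> u} \<inter> {x. x \<bullet> u \<le> a + w} \<inter> {x. b \<le> x \<bullet> v} \<inter> {x. x \<bullet> v \<le> b + w}"
      by auto
    also have "compact \<dots>"
      by (intro compact_Int_closed compact_cball closed_Collect_le continuous_intros)
    finally show "compact (?S a b w)" .
  qed
  have bound: "vol (?S a b w) \<le> \<bar>m\<bar> * (2 * M) ^ card (- J) * w\<^sup>2" if w: "w > 0" for a b w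
  proof -
    define lo where "lo = (\<chi> k. if f k = u then a else if f k = v then b else - M)"
    define hi where "hi = (\<chi> k. if f k = u then a + w else if f k = v then b + w else M)"
    have sub: "?S a b w \<subseteq> g ` cbox lo hi"
    proof
      fix x assume x: "x \<in> ?S a b w"
      have "\<bar>x \<bullet> f k\<bar> \<le> M" for k
      proof -
        have "\<bar>x \<bullet> f k\<bar> \<le> norm x * norm (f k)" by (rule Cauchy_Schwarz_ineq2)
        also have "\<dots> \<le> \<bar>R\<bar> * (\<Sum>b\<in>B. norm b)"
        proof (rule mult_mono)
          show "norm (f k) \<le> (\<Sum>b\<in>B. norm b)" using f finB by (intro member_le_sum) (auto simp: bij_betw_def)
        qed (use x in auto)
        finally show ?thesis by (simp add: M_def)
      qed
      then have "- M \<le> x \<bullet> f k" "x \<bullet> f k \<le> M" for k by (auto simp: abs_le_iff) (metis minus_le_iff)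
      then have "T x \<in> cbox lo hi" using x by (auto simp: mem_box_cart T_def lo_def hi_def)
      then show "x \<in> g ` cbox lo hi" using g(2) by (metis imageI)
    qed
    have "lo $ k \<le> hi $ k" for k using w M by (auto simp: lo_def hi_def)
    then have "vol (cbox lo hi) = (\<Prod>k\<in>UNIV. hi $ k - lo $ k)"
      by (auto simp: content_cbox_if_cart interval_eq_empty_cart) (meson linorder_not_less)
    also have "\<dots> = (\<Prod>k\<in>UNIV. if k \<in> J then w else 2 * M)"
      by (intro prod.cong) (auto simp: hi_def lo_def J_def)
    also have "\<dots> = w\<^sup>2 * (2 * M) ^ card (- J)" by (simp add: prod.If_cases cardJ Compl_eq)
    finally have box: "vol (cbox lo hi) = w\<^sup>2 * (2 * M) ^ card (- J)" .
    have "vol (?S a b w) \<le> vol (g ` cbox lo hi)"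
      using sub S m[OF lmeasurable_cbox] by (intro vol_mono) auto
    also have "\<dots> = m * (w\<^sup>2 * (2 * M) ^ card (- J))" using m[OF lmeasurable_cbox, of lo hi] box by simp
    \<comment> \<open>The absolute value makes up for the sign of \<open>m\<close>, which
      \<open>scales_volume\<close> does not provide.\<close>
    also have "\<dots> \<le> \<bar>m\<bar> * (w\<^sup>2 * (2 * M) ^ card (- J))" using M by (intro mult_right_mono) auto
    finally show ?thesis by (simp add: ac_simps)
  qed
  show ?thesis using S bound by blast
qed

lemma unit_vectors_independent:
  fixes u v :: "'a::euclidean_space"
  assumes "norm u = 1" "norm v = 1" "u \<noteq> v" "v \<noteq> - u"
  shows "independent {u, v}"
proof -
  have "u \<notin> span {v}"
  proof
    assume "u \<in> span {v}"
    then obtain c where c: "u = c *\<^sub>R v" by (auto simp: span_singleton)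
    then have "\<bar>c\<bar> = 1" using assms by simp
    then have "c = 1 \<or> c = -1" by linarith
    then show False using c assms by auto
  qed
  moreover have "v \<noteq> 0" using assms by auto
  ultimately show ?thesis using assms by (simp add: independent_insert)
qed

text \<open>Divide by \<open>t\<close> and let \<open>t\<close> tend to 0. This is how volume
  estimates with a quadratic error become inequalities between relative surface areas.\<close>

lemma poly_coeff1_nonpos:
  fixes d :: "real poly"
  assumes 0: "poly d 0 = 0" and \<delta>: "\<delta> > 0" and le: "\<And>t. 0 < t \<Longrightarrow> t < \<delta> \<Longrightarrow> poly d t \<le> C * t\<^sup>2"
  shows "coeff d 1 \<le> 0"
proof -
  obtain q where q: "d = pCons 0 q" using 0 by (metis pCons_cases poly_0_coeff_0 coeff_pCons_0)
  have "((\<lambda>t. poly q t) \<longlongrightarrow> poly q 0) (at_right 0)"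
    using poly_isCont[of 0 q] by (simp add: isCont_def filterlim_at_split)
  moreover have "((\<lambda>t. C * t) \<longlongrightarrow> C * 0) (at_right (0::real))" by (intro tendsto_intros)
  moreover have "\<forall>\<^sub>F t in at_right 0. poly q t \<le> C * t"
  proof -
    have "poly q t \<le> C * t" if "0 < t" "t < \<delta>" for t
      using le[OF that] that by (simp add: q power2_eq_square)
    then show ?thesis using \<delta> unfolding eventually_at_right_field by blast
  qed
  ultimately have "poly q 0 \<le> C * 0"
    by (intro tendsto_le[of "at_right 0" "\<lambda>t. C * t" _ "poly q"]) auto
  then show ?thesis by (simp add: q poly_0_coeff_0)
qed

lemma convex_body_zero_ball:
  fixes K :: "'a::euclidean_space set"
  assumes "convex_body K" "0 \<in> interior K"
  obtains r where "r > 0" "\<And>u. norm u = 1 \<Longrightarrow> r \<le> support_function K u"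
proof -
  obtain r where r: "r > 0" "ball 0 r \<subseteq> K" using assms by (auto simp: mem_interior)
  have "r / 2 \<le> support_function K u" if "norm u = 1" for u
  proof -
    have "(r / 2) *\<^sub>R u \<in> K" using r that by auto
    from support_ge[OF assms(1) this, of u] show ?thesis using that by (simp add: dot_square_norm)
  qed
  then show ?thesis using that r by (metis half_gt_zero)
qed

text \<open>At a point of the larger sum at most one facet inequality of \<open>P\<close> is nearly active, apart from points close
  to the faces of codimension two; moving such a point back by a support point of \<open>E\<close> leads into \<open>P\<close>.\<close>

lemma polytope_sum_difference:
  fixes P E L :: "(real^'n) set"
  assumes P: "convex_body P" "0 \<in> interior P" and F: "finite F" "F \<subseteq> sphere 0 1" and PF: "determines F P"
    and E: "convex_body E" "0 \<in> E" and L: "convex_body L"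
    and eq: "\<And>u. u \<in> F \<Longrightarrow> support_function L u = support_function E u"
  shows "\<exists>C \<delta>. \<delta> > 0 \<and> (\<forall>l. 0 < l \<and> l < \<delta> \<longrightarrow>
    vol (P + (*\<^sub>R) l ` L) \<le> vol (P + (*\<^sub>R) l ` E) + C * l\<^sup>2)"
proof -
  obtain r where r: "r > 0" "\<And>u. norm u = 1 \<Longrightarrow> r \<le> support_function P u"
    using convex_body_zero_ball[OF P] by blast
  have nF: "norm u = 1" if "u \<in> F" for u using F that by auto
  obtain R0 where R0: "\<And>x. x \<in> E \<Longrightarrow> norm x \<le> R0" "R0 > 0"
    using E(1) compact_imp_bounded[of E] unfolding convex_body_def bounded_pos by metis
  obtain R1 where R1: "\<And>x. x \<in> P \<Longrightarrow> norm x \<le> R1" "R1 > 0"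
    using P(1) compact_imp_bounded[of P] unfolding convex_body_def bounded_pos by metis
  obtain R2 where R2: "\<And>x. x \<in> L \<Longrightarrow> norm x \<le> R2" "R2 > 0"
    using L compact_imp_bounded[of L] unfolding convex_body_def bounded_pos by metis
  \<comment> \<open>In a direction that is not nearly active the slack \<open>c * l\<close> has to
    absorb \<open>l * ?e u\<close> and the inner product of \<open>u\<close> with the subtracted
    point of l E, each at most \<open>l * R0\<close>.\<close>
  define c where "c = 2 * R0"
  have cpos: "c > 0" using R0 by (simp add: c_def)
  let ?h = "support_function P" and ?e = "support_function E"
  have e0: "0 \<le> ?e u" for u using support_ge[OF E, of u] by simp
  have eR: "?e u \<le> R0" "y \<in> E \<Longrightarrow> \<bar>y \<bullet> u\<bar> \<le> R0" if "u \<in> F" for u y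
  proof -
    show b: "\<bar>y \<bullet> u\<bar> \<le> R0" if "y \<in> E" for y
      using Cauchy_Schwarz_ineq2[of y u] nF[OF \<open>u \<in> F\<close>] R0(1)[OF that] by simp
    show "?e u \<le> R0" unfolding support_le_iff[OF E(1)] using b by (meson abs_le_D1)
  qed
  \<comment> \<open>The points within \<open>c * l\<close> of the hyperplanes supporting P + l E in
    two given directions.\<close>
  define Z where "Z p l = {x :: real^'n. norm x \<le> R1 + R2 \<and> (?h (fst p) + l * ?e (fst p) - c * l) \<le> x \<bullet> fst p \<and>
      x \<bullet> fst p \<le> (?h (fst p) + l * ?e (fst p) - c * l) + c * l \<and> (?h (snd p) + l * ?e (snd p) - c * l) \<le> x \<bullet> snd p \<and>
      x \<bullet> snd p \<le> (?h (snd p) + l * ?e (snd p) - c * l) + c * l}" for p l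
  \<comment> \<open>Antipodal pairs have to be left out because the strips would be parallel; for
    small \<open>l\<close> no point is nearly active in both directions of such a pair.\<close>
  define \<P> where "\<P> = {p \<in> F \<times> F. fst p \<noteq> snd p \<and> fst p \<noteq> - snd p}"
  have fin: "finite \<P>" using F by (simp add: \<P>_def)
  have "\<exists>C. \<forall>l>0. Z p l \<in> lmeasurable \<and> vol (Z p l) \<le> C * (c * l)\<^sup>2" if "p \<in> \<P>" for p
  proof -
    have "fst p \<noteq> snd p" "independent {fst p, snd p}"
      using that nF unit_vectors_independent[of "fst p" "snd p"] minus_minus[of "snd p"]
      by (auto simp: \<P>_def) (metis minus_minus)
    from measure_double_strip[OF this, of "R1 + R2"] show ?thesis unfolding Z_def using cpos by (meson mult_pos_pos)
  qed
  then obtain C where C: "\<And>p l. p \<in> \<P> \<Longrightarrow> l > 0 \<Longrightarrow> Z p l \<in> lmeasurable"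
    "\<And>p l. p \<in> \<P> \<Longrightarrow> l > 0 \<Longrightarrow> vol (Z p l) \<le> C p * (c * l)\<^sup>2" by metis
  \<comment> \<open>The bound r/c rules out antipodal nearly active pairs; the bound 1 keeps the
    norms below R1 + R2.\<close>
  define \<delta> where "\<delta> = min 1 (r / c)"
  have "vol (P + (*\<^sub>R) l ` L) \<le> vol (P + (*\<^sub>R) l ` E) + (\<Sum>p\<in>\<P>. C p * c\<^sup>2) * l\<^sup>2"
    if l: "0 < l" "l < \<delta>" for l
  proof -
    have body: "convex_body (P + (*\<^sub>R) l ` L)" "convex_body (P + (*\<^sub>R) l ` E)"
      by (intro convex_body_sum convex_body_scale P E L)+
    have lc: "c * l < r" "l < 1" using l cpos by (auto simp: \<delta>_def field_simps)
    have cover: "P + (*\<^sub>R) l ` L \<subseteq> (P + (*\<^sub>R) l ` E) \<union> (\<Union>p\<in>\<P>. Z p l)"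
    proof
      fix x assume "x \<in> P + (*\<^sub>R) l ` L"
      then obtain y z where yz: "y \<in> P" "z \<in> L" "x = y + l *\<^sub>R z" by (auto simp: set_plus_def)
      have nx: "norm x \<le> R1 + R2"
      proof -
        have "norm x \<le> norm y + l * norm z" using yz l norm_triangle_ineq[of y "l *\<^sub>R z"] by simp
        also have "\<dots> \<le> R1 + 1 * R2" using R1 R2 yz lc l by (intro add_mono mult_mono) auto
        finally show ?thesis by simp
      qed
      have xu: "x \<bullet> u \<le> ?h u + l * ?e u" if "u \<in> F" for u
        using support_ge[OF P(1) yz(1), of u] support_ge[OF L yz(2), of u] l eq[OF that]
        by (simp add: yz(3) inner_add_left add_mono mult_left_mono)
      define N where "N = {u \<in> F. x \<bullet> u > ?h u + l * ?e u - c * l}"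
      show "x \<in> (P + (*\<^sub>R) l ` E) \<union> (\<Union>p\<in>\<P>. Z p l)"
      proof (cases "\<exists>u\<in>N. \<exists>v\<in>N. u \<noteq> v")
        case True
        then obtain u v where uv: "u \<in> N" "v \<in> N" "u \<noteq> v" by blast
        have uvF: "u \<in> F" "v \<in> F" using uv by (auto simp: N_def)
        have "u \<noteq> - v"
        proof
          assume "u = - v"
          then have "x \<bullet> u + x \<bullet> v = 0" by simp
          moreover have "x \<bullet> u > ?h u + l * ?e u - c * l" "x \<bullet> v > ?h v + l * ?e v - c * l" using uv by (auto simp: N_def)
          moreover have "0 \<le> l * ?e u" "0 \<le> l * ?e v" using l e0 by simp_all
          ultimately show False using r(2)[OF nF[OF uvF(1)]] r(2)[OF nF[OF uvF(2)]] lc by linarith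
        qed
        then have "(u, v) \<in> \<P>" using uvF uv by (simp add: \<P>_def)
        moreover have "x \<in> Z (u, v) l"
          using uv nx xu[OF uvF(1)] xu[OF uvF(2)] by (simp add: Z_def N_def)
        ultimately show ?thesis by blast
      next
        case False
        \<comment> \<open>At most one direction is nearly active here, so a single support point of
          \<open>E\<close> serves all of \<open>N\<close>.\<close>
        have "\<exists>y\<in>E. \<forall>u\<in>N. y \<bullet> u = ?e u"
        proof (cases "N = {}")
          case True then show ?thesis using E by blast
        next
          case N: False
          then obtain u where u: "u \<in> N" by blast
          then have "N = {u}" using False by auto
          then show ?thesis using support_attained[OF E(1), of u] by auto
        qed
        then obtain y' where y': "y' \<in> E" "\<And>u. u \<in> N \<Longrightarrow> y' \<bullet> u = ?e u" by blast
        have "(x - l *\<^sub>R y') \<bullet> u \<le> ?h u" if u: "u \<in> F" for u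
        proof (cases "u \<in> N")
          case True
          then show ?thesis using xu[OF u] y'(2)[OF True] by (simp add: inner_diff_left)
        next
          case False
          then have "x \<bullet> u \<le> ?h u + l * ?e u - c * l" using u by (auto simp: N_def)
          moreover have "l * ?e u \<le> l * R0" using eR(1)[OF u] l by (intro mult_left_mono) auto
          moreover have "l * (- (y' \<bullet> u)) \<le> l * R0" using eR(2)[OF u y'(1)] l by (intro mult_left_mono) auto
          ultimately show ?thesis by (simp add: inner_diff_left c_def algebra_simps)
        qed
        then have "x - l *\<^sub>R y' \<in> P" using PF unfolding determines_def by blast
        moreover have "l *\<^sub>R y' \<in> (*\<^sub>R) l ` E" using y' by blast
        ultimately have "(x - l *\<^sub>R y') + l *\<^sub>R y' \<in> P + (*\<^sub>R) l ` E" by (rule set_plus_intro)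
        then show ?thesis by simp
      qed
    qed
    have ZU: "(\<Union>p\<in>\<P>. Z p l) \<in> lmeasurable" using C(1) l fin by (intro fmeasurable.finite_UN) auto
    have "vol (P + (*\<^sub>R) l ` L) \<le> vol ((P + (*\<^sub>R) l ` E) \<union> (\<Union>p\<in>\<P>. Z p l))"
      using cover by (intro vol_mono fmeasurable.Un ZU convex_body_lmeasurable body)
    also have "\<dots> \<le> vol (P + (*\<^sub>R) l ` E) + vol (\<Union>p\<in>\<P>. Z p l)"
      by (intro measure_Un_le fmeasurableD ZU convex_body_lmeasurable body)
    also have "vol (\<Union>p\<in>\<P>. Z p l) \<le> (\<Sum>p\<in>\<P>. vol (Z p l))"
      using C(1) l fin by (intro measure_UNION_le) (auto intro: fmeasurableD)
    also have "\<dots> \<le> (\<Sum>p\<in>\<P>. C p * (c * l)\<^sup>2)" using C(2) l by (intro sum_mono) auto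
    also have "\<dots> = (\<Sum>p\<in>\<P>. C p * c\<^sup>2) * l\<^sup>2" unfolding power_mult_distrib sum_distrib_right by (simp add: mult.assoc)
    finally show ?thesis by simp
  qed
  moreover have "\<delta> > 0" using r cpos by (simp add: \<delta>_def)
  ultimately show ?thesis by blast
qed

section \<open>Comparing relative surface areas through linear coefficients\<close>

lemma convex_body_sum_zero_scale:
  "convex_body E \<Longrightarrow> K + (*\<^sub>R) 0 ` E = (K :: 'a::euclidean_space set)"
  by (auto simp: set_plus_def convex_body_def)

lemma steiner_poly_exists:
  fixes K E :: "(real^'n) set"
  assumes "convex_body K" "interior K \<noteq> {}" "convex_body E" "interior E \<noteq> {}"
  obtains p where "degree p \<le> CARD('n)" "\<And>l. l \<ge> 0 \<Longrightarrow> vol (K + (*\<^sub>R) l ` E) = poly p l"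
    "poly p 0 = vol K" "relative_surface_area K E = coeff p 1"
proof -
  obtain p where p: "degree p \<le> CARD('n)" "\<And>l. l \<ge> 0 \<Longrightarrow> vol (K + (*\<^sub>R) l ` E) = poly p l"
    using steiner_polynomial[OF assms] by blast
  have "poly p 0 = vol K" using p(2)[of 0] unfolding convex_body_sum_zero_scale[OF assms(3)] by simp
  then show ?thesis using that p relative_surface_area_eq[OF p] by blast
qed

lemma relative_surface_area_mono:
  fixes K E L :: "(real^'n) set"
  assumes K: "convex_body K" "interior K \<noteq> {}" and E: "convex_body E" "interior E \<noteq> {}"
    and L: "convex_body L" "E \<subseteq> L"
  shows "relative_surface_area K E \<le> relative_surface_area K L"
proof -
  have iL: "interior L \<noteq> {}" using E L interior_mono by blast
  obtain p where p: "\<And>l. l \<ge> 0 \<Longrightarrow> vol (K + (*\<^sub>R) l ` E) = poly p l"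
    "poly p 0 = vol K" "relative_surface_area K E = coeff p 1"
    using steiner_poly_exists[OF K E] by metis
  obtain q where q: "\<And>l. l \<ge> 0 \<Longrightarrow> vol (K + (*\<^sub>R) l ` L) = poly q l"
    "poly q 0 = vol K" "relative_surface_area K L = coeff q 1"
    using steiner_poly_exists[OF K L(1) iL] by metis
  have "coeff (p - q) 1 \<le> 0"
  proof (rule poly_coeff1_nonpos[of _ 1 0])
    fix t :: real assume "0 < t" "t < 1"
    have "vol (K + (*\<^sub>R) t ` E) \<le> vol (K + (*\<^sub>R) t ` L)"
      by (intro measure_convex_body_mono convex_body_sum convex_body_scale K E L set_plus_mono2 image_mono subset_refl)
    then show "poly (p - q) t \<le> 0 * t\<^sup>2" using p(1)[of t] q(1)[of t] \<open>0 < t\<close> by simp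
  qed (use p q in auto)
  then show ?thesis using p q by simp
qed

text \<open>One inequality is monotonicity; the other holds because the larger sum exceeds the
  smaller one by a volume of second order in \<open>l\<close>.\<close>

lemma polytope_relative_surface_area_eq:
  fixes P E L :: "(real^'n) set"
  assumes P: "convex_body P" "0 \<in> interior P" and F: "finite F" "F \<subseteq> sphere 0 1" and PF: "determines F P"
    and E: "convex_body E" "0 \<in> interior E" and L: "convex_body L" "E \<subseteq> L"
    and eq: "\<And>u. u \<in> F \<Longrightarrow> support_function L u = support_function E u"
  shows "relative_surface_area P L = relative_surface_area P E"
proof (rule antisym)
  have iP: "interior P \<noteq> {}" and iE: "interior E \<noteq> {}" and iL: "interior L \<noteq> {}"
    using P E L interior_mono by blast+
  show "relative_surface_area P E \<le> relative_surface_area P L"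
    by (rule relative_surface_area_mono[OF P(1) iP E(1) iE L])
  obtain p where p: "\<And>l. l \<ge> 0 \<Longrightarrow> vol (P + (*\<^sub>R) l ` E) = poly p l"
    "poly p 0 = vol P" "relative_surface_area P E = coeff p 1"
    using steiner_poly_exists[OF P(1) iP E(1) iE] by metis
  obtain q where q: "\<And>l. l \<ge> 0 \<Longrightarrow> vol (P + (*\<^sub>R) l ` L) = poly q l"
    "poly q 0 = vol P" "relative_surface_area P L = coeff q 1"
    using steiner_poly_exists[OF P(1) iP L(1) iL] by metis
  have "0 \<in> E" using E interior_subset by blast
  from polytope_sum_difference[OF P F PF E(1) this L(1) eq] obtain C \<delta> where
    C: "\<delta> > 0" "\<And>l. 0 < l \<Longrightarrow> l < \<delta> \<Longrightarrow> vol (P + (*\<^sub>R) l ` L) \<le> vol (P + (*\<^sub>R) l ` E) + C * l\<^sup>2"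
    by blast
  have "coeff (q - p) 1 \<le> 0"
  proof (rule poly_coeff1_nonpos[of _ \<delta> C])
    fix t :: real assume t: "0 < t" "t < \<delta>"
    show "poly (q - p) t \<le> C * t\<^sup>2" using C(2)[OF t] p(1)[of t] q(1)[of t] t by simp
  qed (use p q C in auto)
  then show "relative_surface_area P L \<le> relative_surface_area P E" using p q by simp
qed

text \<open>\<open>K\<close> lies in the interior of d K, so each frontier point of d K violates
  some inequality from \<Omega>, and by compactness finitely many directions are enough. The set
  they cut out is connected, meets d K and avoids its frontier.\<close>

lemma outer_body_finite_approx:
  fixes K :: "'a::euclidean_space set"
  assumes K: "convex_body K" "0 \<in> interior K" and det: "determines \<Omega> K" and d: "d > 1"
  obtains F where "finite F" "F \<subseteq> \<Omega>" "outer_body F K \<subseteq> (*\<^sub>R) d ` K"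
proof -
  let ?dK = "(*\<^sub>R) d ` K"
  have dK: "convex_body ?dK" by (rule convex_body_scale[OF K(1)])
  have int: "K \<subseteq> interior ?dK"
  proof
    fix x assume x: "x \<in> K"
    have "(1 / d) *\<^sub>R x \<in> interior K"
      using mem_interior_convex_shrink[of K 0 x "1 - 1 / d"] K x d by (simp add: convex_body_def algebra_simps)
    then have "d *\<^sub>R ((1 / d) *\<^sub>R x) \<in> (*\<^sub>R) d ` interior K" by (rule imageI)
    then show "x \<in> interior ?dK" using d by (simp add: interior_injective_linear_image linear_scaleR inj_on_def)
  qed
  have comp: "compact (frontier ?dK)" using dK by (simp add: convex_body_def compact_frontier)
  have cover: "frontier ?dK \<subseteq> (\<Union>u\<in>\<Omega>. {x. x \<bullet> u > support_function K u})"
  proof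
    fix x assume x: "x \<in> frontier ?dK"
    then have "x \<notin> K" using int by (auto simp: frontier_def)
    then show "x \<in> (\<Union>u\<in>\<Omega>. {x. x \<bullet> u > support_function K u})"
      using det unfolding determines_def by fastforce
  qed
  obtain F where F: "F \<subseteq> \<Omega>" "finite F" "frontier ?dK \<subseteq> (\<Union>u\<in>F. {x. x \<bullet> u > support_function K u})"
    by (rule compactE_image[OF comp, of \<Omega> "\<lambda>u. {x. x \<bullet> u > support_function K u}"])
      (auto intro!: open_Collect_less continuous_intros cover)
  have "outer_body F K \<subseteq> ?dK"
  proof (rule ccontr)
    assume neg: "\<not> outer_body F K \<subseteq> ?dK"
    have "convex (outer_body F K)"
      unfolding outer_body_def by (auto simp: convex_def inner_add_left intro: convex_bound_le)
    then have "connected (outer_body F K)" by (rule convex_connected)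
    moreover have "K \<subseteq> outer_body F K" using support_ge[OF K(1)] by (auto simp: outer_body_def)
    then have "outer_body F K \<inter> ?dK \<noteq> {}" using int interior_subset K(1) unfolding convex_body_def by blast
    moreover have "outer_body F K - ?dK \<noteq> {}" using neg by blast
    ultimately have "outer_body F K \<inter> frontier ?dK \<noteq> {}" by (rule connected_Int_frontier)
    then obtain x where "x \<in> outer_body F K" "x \<in> frontier ?dK" by blast
    with F(3) show False by (fastforce simp: outer_body_def)
  qed
  then show ?thesis using that F by blast
qed

section \<open>Outer bodies, translations and the passage to arbitrary determined bodies\<close>

lemma mem_translate_iff: "x \<in> (+) a ` S \<longleftrightarrow> x - a \<in> (S :: 'a::ab_group_add set)"
  by (auto intro!: image_eqI[of _ _ "x - a"])

lemma outer_body_superset: "convex_body E \<Longrightarrow> E \<subseteq> outer_body \<Omega> E"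
  using support_ge by (auto simp: outer_body_def)

lemma closed_convex_outer_body: "closed (outer_body \<Omega> E)" "convex (outer_body \<Omega> E)"
proof -
  have "outer_body \<Omega> E = (\<Inter>u\<in>\<Omega>. {x. x \<bullet> u \<le> support_function E u})" by (auto simp: outer_body_def)
  then show "closed (outer_body \<Omega> E)"
    by (simp only:) (intro closed_INT ballI closed_Collect_le continuous_intros)
  show "convex (outer_body \<Omega> E)"
    unfolding outer_body_def by (auto simp: convex_def inner_add_left intro: convex_bound_le)
qed

lemma support_outer_body:
  assumes "convex_body E" "convex_body (outer_body \<Omega> E)" "u \<in> \<Omega>"
  shows "support_function (outer_body \<Omega> E) u = support_function E u"
proof (rule antisym)
  show "support_function (outer_body \<Omega> E) u \<le> support_function E u"
    unfolding support_le_iff[OF assms(2)] using assms(3) by (auto simp: outer_body_def)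
  show "support_function E u \<le> support_function (outer_body \<Omega> E) u"
    unfolding support_le_iff[OF assms(1)] using support_ge[OF assms(2)] outer_body_superset[OF assms(1)] by blast
qed

text \<open>This makes the outer body itself a competitor in the minimization.\<close>

lemma determines_outer_body:
  assumes "convex_body E" "convex_body (outer_body \<Omega> E)"
  shows "determines \<Omega> (outer_body \<Omega> E)"
  using support_outer_body[OF assms] unfolding determines_def outer_body_def by auto

lemma relative_surface_area_translate:
  fixes K E :: "'a::euclidean_space set"
  shows "relative_surface_area ((+) a ` K) ((+) b ` E) = relative_surface_area K E"
  unfolding relative_surface_area_def quermassintegral_def translate_sum measure_translation ..

lemma determines_translate:
  assumes "convex_body K" "determines \<Omega> K" shows "determines \<Omega> ((+) a ` K)"
proof -
  have K: "x \<in> K \<longleftrightarrow> (\<forall>u\<in>\<Omega>. x \<bullet> u \<le> support_function K u)" for x using assms(2) unfolding determines_def by blast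
  have "x \<in> (+) a ` K \<longleftrightarrow> (\<forall>u\<in>\<Omega>. x \<bullet> u \<le> support_function ((+) a ` K) u)" for x
    unfolding support_translate[OF assms(1)] mem_translate_iff K by (simp add: inner_diff_left algebra_simps)
  then show ?thesis unfolding determines_def by blast
qed

lemma outer_body_translate:
  assumes "convex_body E" shows "outer_body \<Omega> ((+) b ` E) = (+) b ` outer_body \<Omega> E"
proof -
  have "x \<in> outer_body \<Omega> ((+) b ` E) \<longleftrightarrow> x \<in> (+) b ` outer_body \<Omega> E" for x
    unfolding mem_translate_iff outer_body_def support_translate[OF assms] by (simp add: inner_diff_left algebra_simps)
  then show ?thesis by blast
qed

lemma centred_translate:
  assumes "interior K \<noteq> {}" obtains a where "0 \<in> interior ((+) a ` (K :: 'a::euclidean_space set))"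
proof -
  obtain x where "x \<in> interior K" using assms by blast
  then have "0 \<in> interior ((+) (- x) ` K)" unfolding interior_translation by (auto intro!: image_eqI[of _ _ x])
  then show ?thesis using that by blast
qed

text \<open>The polytopes \<open>P m\<close> use only directions from \<Omega>, on which the support
  functions of \<open>E\<close> and its outer body coincide, and they lie between \<open>K\<close>
  and \<open>d m\<close> times \<open>K\<close>. So the polytope case applies to each of them and
  survives in the limit.\<close>

lemma relative_surface_area_outer_body_centred:
  fixes K E :: "(real^'n) set"
  assumes K: "convex_body K" "0 \<in> interior K" and det: "determines \<Omega> K" and \<Omega>: "\<Omega> \<subseteq> sphere 0 1"
    and E: "convex_body E" "0 \<in> interior E" and L: "convex_body (outer_body \<Omega> E)"
  shows "relative_surface_area K (outer_body \<Omega> E) = relative_surface_area K E"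
proof -
  let ?L = "outer_body \<Omega> E"
  note EL = outer_body_superset[OF E(1), of \<Omega>]
  have L0: "0 \<in> interior ?L" using E(2) interior_mono[OF EL] by blast
  define d where "d m = 1 + inverse (real (Suc m))" for m
  have d: "d m > 1" for m by (simp add: d_def)
  have dlim: "d \<longlonglongrightarrow> 1"
    unfolding d_def using tendsto_add[OF tendsto_const[of 1] LIMSEQ_inverse_real_of_nat] by simp
  have "\<forall>m. \<exists>F. finite F \<and> F \<subseteq> \<Omega> \<and> outer_body F K \<subseteq> (*\<^sub>R) (d m) ` K"
    using outer_body_finite_approx[OF K det d] by metis
  then obtain F where F: "\<And>m. finite (F m)" "\<And>m. F m \<subseteq> \<Omega>" "\<And>m. outer_body (F m) K \<subseteq> (*\<^sub>R) (d m) ` K" by metis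
  define P where "P m = outer_body (F m) K" for m
  have KP: "K \<subseteq> P m" for m unfolding P_def by (rule outer_body_superset[OF K(1)])
  have P: "convex_body (P m)" for m
  proof -
    have "bounded (P m)" using F(3)[of m] convex_body_scale[OF K(1), of "d m"]
      unfolding P_def convex_body_def by (meson bounded_subset compact_imp_bounded)
    then show ?thesis using closed_convex_outer_body[of "F m" K] KP[of m] K(1)
      unfolding convex_body_def P_def[symmetric] compact_eq_bounded_closed by blast
  qed
  have P0: "0 \<in> interior (P m)" for m using K(2) interior_mono[OF KP] by blast
  have eq: "relative_surface_area (P m) ?L = relative_surface_area (P m) E" for m
  proof (rule polytope_relative_surface_area_eq[OF P P0 F(1)[of m] _ _ E L EL])
    show "F m \<subseteq> sphere 0 1" using F(2) \<Omega> by blast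
    show "determines (F m) (P m)" using determines_outer_body[OF K(1)] P unfolding P_def by blast
    show "support_function ?L u = support_function E u" if "u \<in> F m" for u
      using support_outer_body[OF E(1) L] F(2)[of m] that by blast
  qed
  have conv: "(\<lambda>m. relative_surface_area (P m) M) \<longlonglongrightarrow> relative_surface_area K M"
    if M: "convex_body M" "0 \<in> interior M" for M :: "(real^'n) set"
  proof -
    have M0: "0 \<in> M" using M interior_subset by blast
    have "\<exists>p. degree p \<le> CARD('n) \<and> (\<forall>l\<ge>0. vol (P m + (*\<^sub>R) l ` M) = poly p l)" for m
      using P P0 M by (intro steiner_polynomial) auto
    then obtain p where p: "\<And>m. degree (p m) \<le> CARD('n)"
      "\<And>m l. l \<ge> 0 \<Longrightarrow> vol (P m + (*\<^sub>R) l ` M) = poly (p m) l" by metis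
    have Mc: "convex M" using M by (simp add: convex_body_def)
    have lim: "(\<lambda>m. vol (P m + (*\<^sub>R) l ` M)) \<longlonglongrightarrow> vol (K + (*\<^sub>R) l ` M)" for l
    proof (rule steiner_limit[where c = "\<lambda>_. 1" and d = d])
      show "P m \<subseteq> (*\<^sub>R) (d m) ` K" for m unfolding P_def by (rule F(3))
      show "M \<subseteq> (*\<^sub>R) (d m) ` M" for m using scale_mono[OF Mc M0, of 1 "d m"] d[of m] by simp
      show "0 \<le> d m" for m using d[of m] by simp
    qed (simp_all add: K M P KP dlim)
    have plim: "(\<lambda>m. poly (p m) l) \<longlonglongrightarrow> vol (K + (*\<^sub>R) l ` M)" if "l > 0" for l
      using lim[of l] p(2)[of l] that by simp
    obtain q where q: "\<And>l. l > 0 \<Longrightarrow> vol (K + (*\<^sub>R) l ` M) = poly q l"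
      "\<And>j. (\<lambda>m. coeff (p m) j) \<longlonglongrightarrow> coeff q j"
      using poly_coeff_tendsto[OF p(1) plim] by metis
    have iK: "interior K \<noteq> {}" "interior M \<noteq> {}" using K M by blast+
    obtain s where s: "\<And>l. l \<ge> 0 \<Longrightarrow> vol (K + (*\<^sub>R) l ` M) = poly s l" "relative_surface_area K M = coeff s 1"
      using steiner_poly_exists[OF K(1) iK(1) M(1) iK(2)] by metis
    \<comment> \<open>The limit of the coefficients belongs to a polynomial known only for positive
      \<open>l\<close>; infinitely many common values identify it with the Steiner polynomial of
      \<open>K\<close>.\<close>
    have "{0<..} \<subseteq> {l. poly (q - s) l = 0}" using q(1) s(1) by auto
    then have "infinite {l. poly (q - s) l = 0}" using infinite_Ioi infinite_super by blast
    then have "q = s" using poly_roots_finite[of "q - s"] by auto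
    have "relative_surface_area (P m) M = coeff (p m) 1" for m by (rule relative_surface_area_eq[OF p])
    then show ?thesis using q(2)[of 1] s(2) \<open>q = s\<close> by simp
  qed
  show ?thesis
    using LIMSEQ_unique[OF conv[OF L L0]] conv[OF E] unfolding eq by blast
qed

proposition relative_surface_area_outer_body:
  fixes K E :: "(real^'n) set"
  assumes K: "convex_body K" "interior K \<noteq> {}" and det: "determines \<Omega> K" and \<Omega>: "\<Omega> \<subseteq> sphere 0 1"
    and E: "convex_body E" "interior E \<noteq> {}" and L: "convex_body (outer_body \<Omega> E)"
  shows "relative_surface_area K (outer_body \<Omega> E) = relative_surface_area K E"
proof -
  obtain a where a: "0 \<in> interior ((+) a ` K)" using centred_translate[OF K(2)] .
  obtain b where b: "0 \<in> interior ((+) b ` E)" using centred_translate[OF E(2)] .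
  have "relative_surface_area ((+) a ` K) (outer_body \<Omega> ((+) b ` E)) = relative_surface_area ((+) a ` K) ((+) b ` E)"
    by (intro relative_surface_area_outer_body_centred convex_body_translate K E a b determines_translate det \<Omega>)
      (simp add: outer_body_translate E convex_body_translate L)
  then show ?thesis by (simp add: outer_body_translate E relative_surface_area_translate)
qed

section \<open>Minkowski's first inequality with its equality case\<close>

lemma coeff_1_power_linear: "coeff ([:a, b:] ^ n) (Suc 0) = real n * a ^ (n - 1) * b" for a b :: real
proof -
  have "coeff ([:a, b:] ^ n) (Suc 0) = poly (pderiv ([:a, b:] ^ n)) 0" by (simp add: poly_0_coeff_0 coeff_pderiv)
  also have "\<dots> = real n * a ^ (n - 1) * b" by (cases n) (simp_all add: pderiv_power_Suc pderiv_pCons del: power_Suc)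
  finally show ?thesis .
qed

lemma convex_body_volume_pos:
  assumes "convex_body K" "interior K \<noteq> {}" shows "vol (K :: 'a::euclidean_space set) > 0"
proof -
  have b: "bounded K" using assms by (simp add: convex_body_def compact_imp_bounded)
  have "0 < vol (interior K)" using assms b by (intro measure_pos_open lmeasurable_interior) auto
  also have "\<dots> \<le> vol K"
    using assms b by (intro vol_mono lmeasurable_interior convex_body_lmeasurable interior_subset)
  finally show ?thesis .
qed

lemma root_volume_scale:
  fixes K :: "'a::euclidean_space set"
  assumes "l \<ge> 0" shows "root DIM('a) (vol ((*\<^sub>R) l ` K)) = l * root DIM('a) (vol K)"
  using assms by (simp add: measure_scaleR real_root_mult real_root_power_cancel)

text \<open>Brunn--Minkowski bounds the volume of K + t L below by (k + t l)^n, with equality at t =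
  0; comparing linear coefficients gives the inequality. In the equality case k + t l is the tangent
  at 0 of the concave function of \<open>t\<close> given by the volume radius, hence also an upper
  bound, and Brunn--Minkowski holds with equality.\<close>

proposition minkowski_first_inequality:
  fixes K L :: "(real^'n) set"
  assumes K: "convex_body K" "interior K \<noteq> {}" and L: "convex_body L" "interior L \<noteq> {}"
  defines "k \<equiv> root CARD('n) (vol K)" and "l \<equiv> root CARD('n) (vol L)"
  shows "real CARD('n) * k ^ (CARD('n) - 1) * l \<le> relative_surface_area K L"
    and "relative_surface_area K L = real CARD('n) * k ^ (CARD('n) - 1) * l \<Longrightarrow> homothetic K L"
proof -
  let ?n = "CARD('n)"
  have BM: "root ?n (vol M) + root ?n (vol N) \<le> root ?n (vol (M + N))"
    if "convex_body M" "convex_body N" for M N :: "(real^'n) set" using brunn_minkowski[OF that] by simp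
  have rs: "root ?n (vol ((*\<^sub>R) t ` M)) = t * root ?n (vol M)" if "t \<ge> 0" for t and M :: "(real^'n) set"
    using root_volume_scale[OF that, of M] by simp
  have pw: "root ?n (vol S) ^ ?n = vol S" for S :: "(real^'n) set" by simp
  have kpos: "k > 0" "l > 0" using convex_body_volume_pos K L by (simp_all add: k_def l_def)
  have kn: "k ^ ?n = vol K" "l ^ ?n = vol L" by (simp_all add: k_def l_def)
  obtain p where p: "\<And>t. t \<ge> 0 \<Longrightarrow> vol (K + (*\<^sub>R) t ` L) = poly p t"
    "poly p 0 = vol K" "relative_surface_area K L = coeff p 1"
    using steiner_poly_exists[OF K L] by metis
  \<comment> \<open>A linear lower bound for the volume radius that is exact at 0 has slope at most
    the derivative of the volume radius there.\<close>
  have tangent: "real ?n * k ^ (?n - 1) * b \<le> coeff p 1"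
    if b: "\<And>t. 0 < t \<Longrightarrow> t < 1 \<Longrightarrow> 0 \<le> k + t * b \<and> k + t * b \<le> root ?n (vol (K + (*\<^sub>R) t ` L))" for b
  proof -
    have "coeff ([:k, b:] ^ ?n - p) 1 \<le> 0"
    proof (rule poly_coeff1_nonpos[of _ 1 0])
      show "poly ([:k, b:] ^ ?n - p) 0 = 0" by (simp add: p kn)
      fix t :: real assume t: "0 < t" "t < 1"
      have "(k + t * b) ^ ?n \<le> root ?n (vol (K + (*\<^sub>R) t ` L)) ^ ?n"
        using b[OF t] by (intro power_mono) auto
      then show "poly ([:k, b:] ^ ?n - p) t \<le> 0 * t\<^sup>2" using p(1)[of t] t unfolding pw by simp
    qed simp
    then show ?thesis by (simp add: coeff_1_power_linear)
  qed
  show "real ?n * k ^ (?n - 1) * l \<le> relative_surface_area K L"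
    unfolding p(3)
  proof (rule tangent)
    fix t :: real assume t: "0 < t" "t < 1"
    have "k + t * l \<le> root ?n (vol (K + (*\<^sub>R) t ` L))"
      using BM[OF K(1) convex_body_scale[OF L(1), of t]] rs[of t L] t by (simp add: k_def l_def)
    then show "0 \<le> k + t * l \<and> k + t * l \<le> root ?n (vol (K + (*\<^sub>R) t ` L))" using kpos t by simp
  qed
  assume eq: "relative_surface_area K L = real ?n * k ^ (?n - 1) * l"
  have upper: "root ?n (vol (K + (*\<^sub>R) s ` L)) \<le> k + s * l" if s: "s > 0" for s
  proof -
    define g where "g = root ?n (vol (K + (*\<^sub>R) s ` L))"
    have KsL: "convex_body (K + (*\<^sub>R) s ` L)" by (intro convex_body_sum convex_body_scale K L)
    have g0: "g \<ge> 0" by (simp add: g_def)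
    \<comment> \<open>Concavity along the segment from \<open>K\<close> to K + s L, whose point at
      parameter \<open>t\<close> is K + t s L: the chord slope g - k is compared with the derivative
      at 0.\<close>
    have "coeff ([:k, (g - k):] ^ ?n - pcompose p [:0, s:]) 1 \<le> 0"
    proof (rule poly_coeff1_nonpos[of _ 1 0])
      show "poly ([:k, (g - k):] ^ ?n - pcompose p [:0, s:]) 0 = 0" by (simp add: p kn poly_pcompose)
      fix t :: real assume t: "0 < t" "t < 1"
      have "(1 - t) * k + t * g \<le> root ?n (vol ((*\<^sub>R) (1 - t) ` K + (*\<^sub>R) t ` (K + (*\<^sub>R) s ` L)))"
        using BM[OF convex_body_scale[OF K(1), of "1 - t"] convex_body_scale[OF KsL, of t]] rs[of "1 - t" K] rs[of t "K + (*\<^sub>R) s ` L"] t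
        by (simp add: k_def g_def)
      also have "(*\<^sub>R) (1 - t) ` K + (*\<^sub>R) t ` (K + (*\<^sub>R) s ` L) = K + (*\<^sub>R) (t * s) ` L"
        using convex_sum_scale[of K "1 - t" t] K(1) t
        by (simp add: scale_set_plus scale_scale add.assoc[symmetric] convex_body_def)
      finally have "((1 - t) * k + t * g) ^ ?n \<le> root ?n (vol (K + (*\<^sub>R) (t * s) ` L)) ^ ?n"
        using t g0 kpos by (intro power_mono) auto
      then show "poly ([:k, (g - k):] ^ ?n - pcompose p [:0, s:]) t \<le> 0 * t\<^sup>2"
        using p(1)[of "t * s"] t s unfolding pw by (simp add: poly_pcompose algebra_simps)
    qed simp
    moreover have "coeff (pcompose p [:0, s:]) 1 = s * coeff p 1"
      by (simp add: coeff_pcompose_linear)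
    ultimately have "real ?n * k ^ (?n - 1) * (g - k) \<le> s * (real ?n * k ^ (?n - 1) * l)"
      using eq p(3) by (simp add: coeff_1_power_linear)
    then have "(real ?n * k ^ (?n - 1)) * (g - k) \<le> (real ?n * k ^ (?n - 1)) * (s * l)" by (simp add: algebra_simps)
    then have "g - k \<le> s * l" using kpos by (subst (asm) mult_le_cancel_left_pos) auto
    then show ?thesis by (simp add: g_def)
  qed
  \<comment> \<open>This factor gives s L the volume of \<open>K\<close>, as
    \<open>brunn_minkowski_equality\<close> requires.\<close>
  define s where "s = k / l"
  have s: "s > 0" "s * l = k" using kpos by (simp_all add: s_def)
  have sL: "convex_body ((*\<^sub>R) s ` L)" by (rule convex_body_scale[OF L(1)])
  have isL: "interior ((*\<^sub>R) s ` L) \<noteq> {}"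
    using L(2) s by (simp add: interior_injective_linear_image linear_scaleR inj_on_def)
  have vsL: "vol ((*\<^sub>R) s ` L) = vol K"
  proof -
    have "vol ((*\<^sub>R) s ` L) = s ^ ?n * l ^ ?n" using s(1) by (simp add: measure_scaleR kn)
    also have "\<dots> = (s * l) ^ ?n" by (rule power_mult_distrib[symmetric])
    finally show ?thesis unfolding s(2) kn .
  qed
  have "root ?n (vol (K + (*\<^sub>R) s ` L)) = 2 * k"
  proof (rule antisym)
    show "root ?n (vol (K + (*\<^sub>R) s ` L)) \<le> 2 * k" using upper[OF s(1)] s(2) by simp
    show "2 * k \<le> root ?n (vol (K + (*\<^sub>R) s ` L))" using BM[OF K(1) sL] vsL by (simp add: k_def)
  qed
  then have "root ?n (vol (K + (*\<^sub>R) s ` L)) ^ ?n = 2 ^ ?n * vol K"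
    by (simp add: power_mult_distrib kn)
  then have "vol (K + (*\<^sub>R) s ` L) = 2 ^ DIM(real^'n) * vol K" by simp
  from brunn_minkowski_equality[OF K sL isL vsL this] obtain q where q: "K = (+) q ` (*\<^sub>R) s ` L" by blast
  have "L = (\<lambda>y. (1 / s) *\<^sub>R y + (- (1 / s)) *\<^sub>R q) ` K"
    unfolding q image_image using s by (simp add: scaleR_add_right)
  then show "homothetic K L" unfolding homothetic_def using s by (intro exI[of _ "1 / s"] exI[of _ "(- (1 / s)) *\<^sub>R q"]) simp
qed

section \<open>Tangential bodies and isoperimetric quotients\<close>

text \<open>If \<open>R\<close> bounds the norms in \<open>E\<close>, every \<open>x\<close> in the
  outer body satisfies x \<bullet> w \<le> R on \<Omega>, hence on its convex hull, which contains a
  ball of radius \<open>r\<close>. Testing with the multiple of \<open>x\<close> on that sphere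
  gives norm x \<le> R/r.\<close>

lemma outer_body_convex_body:
  fixes E :: "'a::euclidean_space set"
  assumes E: "convex_body E" and \<Omega>: "\<Omega> \<subseteq> sphere 0 1" "0 \<in> interior (convex hull \<Omega>)"
  shows "convex_body (outer_body \<Omega> E)"
proof -
  obtain r where r: "r > 0" "cball 0 r \<subseteq> convex hull \<Omega>" using \<Omega>(2) by (auto simp: mem_interior_cball)
  obtain R where R: "\<And>y. y \<in> E \<Longrightarrow> norm y \<le> R"
    using E compact_imp_bounded[of E] unfolding convex_body_def bounded_iff by blast
  have hR: "support_function E u \<le> R" if "u \<in> \<Omega>" for u
    unfolding support_le_iff[OF E]
  proof
    fix y assume "y \<in> E"
    have "y \<bullet> u \<le> norm y * norm u" by (rule norm_cauchy_schwarz)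
    then show "y \<bullet> u \<le> R" using R[OF \<open>y \<in> E\<close>] \<Omega>(1) that by auto
  qed
  have "norm x \<le> R / r" if x: "x \<in> outer_body \<Omega> E" for x
  proof (cases "x = 0")
    case True
    have "\<Omega> \<noteq> {}" using \<Omega>(2) by auto
    obtain y where "y \<in> E" using E by (auto simp: convex_body_def)
    then have "0 \<le> R" using R[of y] norm_ge_zero[of y] by linarith
    then show ?thesis using True r by simp
  next
    case False
    have "\<Omega> \<subseteq> {w. x \<bullet> w \<le> R}" using x hR by (force simp: outer_body_def)
    then have "convex hull \<Omega> \<subseteq> {w. x \<bullet> w \<le> R}" by (intro hull_minimal convex_halfspace_le)
    moreover have "(r / norm x) *\<^sub>R x \<in> cball 0 r" using r False by simp
    ultimately have "x \<bullet> ((r / norm x) *\<^sub>R x) \<le> R" using r by blast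
    then have "r * norm x \<le> R" using False by (simp add: dot_square_norm power2_eq_square)
    then show ?thesis using r by (simp add: field_simps)
  qed
  then have "bounded (outer_body \<Omega> E)" by (auto simp: bounded_iff)
  moreover have "outer_body \<Omega> E \<noteq> {}" using outer_body_superset[OF E] E unfolding convex_body_def by blast
  ultimately show ?thesis
    using closed_convex_outer_body[of \<Omega> E] by (simp add: convex_body_def compact_eq_bounded_closed)
qed

lemma support_function_lipschitz:
  fixes E :: "'a::euclidean_space set"
  assumes E: "convex_body E" and R: "\<And>y. y \<in> E \<Longrightarrow> norm y \<le> R"
  shows "support_function E u \<le> support_function E v + R * norm (u - v)"
proof -
  obtain y where y: "y \<in> E" "y \<bullet> u = support_function E u" using support_attained[OF E] by metis
  have "y \<bullet> u = y \<bullet> v + y \<bullet> (u - v)" by (simp add: inner_diff_right)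
  also have "\<dots> \<le> support_function E v + norm y * norm (u - v)"
    by (intro add_mono support_ge[OF E y(1)] norm_cauchy_schwarz)
  also have "\<dots> \<le> support_function E v + R * norm (u - v)" using R[OF y(1)] by (intro add_mono mult_right_mono) auto
  finally show ?thesis using y by simp
qed

lemma continuous_support_function:
  fixes E :: "'a::euclidean_space set"
  assumes E: "convex_body E" shows "continuous_on UNIV (support_function E)"
proof -
  obtain R where R: "\<And>y. y \<in> E \<Longrightarrow> norm y \<le> R" "R > 0"
    using E compact_imp_bounded[of E] unfolding convex_body_def bounded_pos by blast
  have "\<bar>support_function E u - support_function E v\<bar> \<le> R * norm (u - v)" for u v
    using support_function_lipschitz[OF E R(1), of u v] support_function_lipschitz[OF E R(1), of v u]
    by (simp add: norm_minus_commute abs_le_iff)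
  then have "R-lipschitz_on UNIV (support_function E)" using R(2)
    by (intro lipschitz_onI) (auto simp: dist_norm)
  then show ?thesis by (rule lipschitz_on_continuous_on)
qed

text \<open>\<Omega> need not be closed, so an active constraint at a frontier point may exist only
  in the limit. It is found by maximizing x \<bullet> u minus the support function of
  \<open>E\<close> over the closure of \<Omega>; its hyperplane supports both bodies.\<close>

lemma tangential_outer_body:
  fixes E :: "'a::euclidean_space set"
  assumes E: "convex_body E" "interior E \<noteq> {}" and \<Omega>: "\<Omega> \<subseteq> sphere 0 1" "0 \<in> interior (convex hull \<Omega>)"
  shows "tangential_body (outer_body \<Omega> E) E"
  unfolding tangential_body_def
proof (intro conjI ballI)
  let ?L = "outer_body \<Omega> E"
  show L: "convex_body ?L" by (rule outer_body_convex_body[OF E(1) \<Omega>])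
  show EL: "E \<subseteq> ?L" by (rule outer_body_superset[OF E(1)])
  show "interior ?L \<noteq> {}" using E interior_mono[OF EL] by blast
  fix x assume x: "x \<in> frontier ?L"
  define K where "K = closure \<Omega>"
  have Ksph: "K \<subseteq> sphere 0 1" unfolding K_def using \<Omega>(1) by (intro closure_minimal) auto
  have "compact K" unfolding K_def using \<Omega>(1) by (intro compact_closure[THEN iffD2] bounded_subset[OF bounded_sphere])
  moreover have "\<Omega> \<noteq> {}" using \<Omega>(2) by auto
  then have "K \<noteq> {}" using closure_subset[of \<Omega>] by (auto simp: K_def)
  moreover have hc: "continuous_on S (support_function E)" for S
    using continuous_support_function[OF E(1)] continuous_on_subset by blast
  then have "continuous_on K (\<lambda>u. x \<bullet> u - support_function E u)" by (intro continuous_intros)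
  ultimately have "\<exists>u\<in>K. \<forall>w\<in>K. x \<bullet> w - support_function E w \<le> x \<bullet> u - support_function E u"
    by (rule continuous_attains_sup)
  then obtain u where u: "u \<in> K" "\<And>w. w \<in> K \<Longrightarrow> x \<bullet> w - support_function E w \<le> x \<bullet> u - support_function E u" by blast
  have le: "y \<bullet> w \<le> support_function E w" if y: "y \<in> ?L" and w: "w \<in> K" for y w
  proof -
    have "closed {w. y \<bullet> w \<le> support_function E w}" by (intro closed_Collect_le continuous_intros hc)
    moreover have "\<Omega> \<subseteq> {w. y \<bullet> w \<le> support_function E w}" using y by (auto simp: outer_body_def)
    ultimately have "K \<subseteq> {w. y \<bullet> w \<le> support_function E w}" unfolding K_def by (rule closure_minimal[rotated])
    then show ?thesis using w by blast
  qed
  have xL: "x \<in> ?L" using x L by (auto simp: frontier_def convex_body_def compact_imp_closed)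
  have xu: "x \<bullet> u = support_function E u"
  proof (rule ccontr)
    assume "x \<bullet> u \<noteq> support_function E u"
    then have e: "support_function E u - x \<bullet> u > 0" using le[OF xL u(1)] by simp
    \<comment> \<open>If even the tightest constraint has slack, that slack is a radius by which
      \<open>x\<close> can move in every direction, the constraint vectors being unit
      vectors.\<close>
    have "ball x (support_function E u - x \<bullet> u) \<subseteq> ?L"
    proof
      fix y assume y: "y \<in> ball x (support_function E u - x \<bullet> u)"
      have "y \<bullet> w \<le> support_function E w" if "w \<in> \<Omega>" for w
      proof -
        have wK: "w \<in> K" using that closure_subset by (auto simp: K_def)
        have "(y - x) \<bullet> w \<le> norm (y - x) * norm w" by (rule norm_cauchy_schwarz)
        also have "\<dots> = dist x y" using Ksph wK by (auto simp: dist_norm norm_minus_commute)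
        also have "\<dots> < support_function E u - x \<bullet> u" using y by simp
        also have "\<dots> \<le> support_function E w - x \<bullet> w" using u(2)[OF wK] by simp
        finally show ?thesis by (simp add: inner_diff_left)
      qed
      then show "y \<in> ?L" by (simp add: outer_body_def)
    qed
    then have "x \<in> interior ?L" unfolding mem_interior using e by blast
    then show False using x by (simp add: frontier_def)
  qed
  have u0: "u \<noteq> 0" using Ksph u(1) by auto
  define H where "H = {y. y \<bullet> u = support_function E u}"
  have "supporting_hyperplane H ?L" unfolding supporting_hyperplane_def H_def
    using u0 xu xL le[OF _ u(1)] by (intro exI[of _ u] exI[of _ "support_function E u"]) auto
  moreover have "supporting_hyperplane H E"
  proof -
    obtain z where "z \<in> E" "z \<bullet> u = support_function E u" using support_attained[OF E(1)] by metis
    then show ?thesis unfolding supporting_hyperplane_def H_def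
      using u0 support_ge[OF E(1)] by (intro exI[of _ u] exI[of _ "support_function E u"]) auto
  qed
  moreover have "x \<in> H" using xu by (simp add: H_def)
  ultimately show "\<exists>H. x \<in> H \<and> supporting_hyperplane H ?L \<and> supporting_hyperplane H E" by blast
qed

section \<open>Relative surface area and isoperimetric quotient under homotheties\<close>

lemma relative_surface_area_self:
  fixes L :: "(real^'n) set"
  assumes L: "convex_body L"
  shows "relative_surface_area L L = real CARD('n) * vol L"
proof -
  define p where "p = smult (vol L) ([:1, 1:] ^ CARD('n))"
  have "relative_surface_area L L = coeff p 1"
  proof (rule relative_surface_area_eq)
    show "degree p \<le> CARD('n)" unfolding p_def
      using degree_power_le[of "[:1, 1:] :: real poly" "CARD('n)"] by (intro order_trans[OF degree_smult_le]) simp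
    fix t :: real assume t: "t \<ge> 0"
    have "L + (*\<^sub>R) t ` L = (*\<^sub>R) (1 + t) ` L"
      using convex_sum_scale[of L 1 t] L t by (simp add: convex_body_def)
    then show "vol (L + (*\<^sub>R) t ` L) = poly p t" using t by (simp add: measure_scaleR p_def)
  qed
  then show ?thesis by (simp add: p_def coeff_1_power_linear)
qed

lemma relative_surface_area_scale:
  fixes K E :: "(real^'n) set"
  assumes K: "convex_body K" "interior K \<noteq> {}" and E: "convex_body E" "interior E \<noteq> {}" and a: "a > 0"
  shows "relative_surface_area ((*\<^sub>R) a ` K) E = a ^ (CARD('n) - 1) * relative_surface_area K E"
proof -
  obtain p where p: "degree p \<le> CARD('n)" "\<And>l. l \<ge> 0 \<Longrightarrow> vol (K + (*\<^sub>R) l ` E) = poly p l"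
    "relative_surface_area K E = coeff p 1" using steiner_poly_exists[OF K E] by metis
  define q where "q = smult (a ^ CARD('n)) (pcompose p [:0, 1 / a:])"
  have "relative_surface_area ((*\<^sub>R) a ` K) E = coeff q 1"
  proof (rule relative_surface_area_eq)
    show "degree q \<le> CARD('n)" unfolding q_def
      using p(1) degree_pcompose_le[of p "[:0, 1 / a:]"] a by (intro order_trans[OF degree_smult_le]) simp
    fix l :: real assume l: "l \<ge> 0"
    have "(*\<^sub>R) a ` K + (*\<^sub>R) l ` E = (*\<^sub>R) a ` (K + (*\<^sub>R) (l / a) ` E)"
      using a by (simp add: scale_set_plus scale_scale)
    then show "vol ((*\<^sub>R) a ` K + (*\<^sub>R) l ` E) = poly q l"
      using p(2)[of "l / a"] l a by (simp add: measure_scaleR q_def poly_pcompose)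
  qed
  also have "\<dots> = a ^ CARD('n) * (1 / a) * coeff p 1" by (simp add: q_def coeff_pcompose_linear)
  also have "a ^ CARD('n) * (1 / a) = a ^ (CARD('n) - 1)" using a by (simp add: power_diff)
  finally show ?thesis using p by simp
qed

lemma determines_scale:
  fixes K :: "'a::euclidean_space set"
  assumes K: "convex_body K" "determines \<Omega> K" and a: "a > 0" shows "determines \<Omega> ((*\<^sub>R) a ` K)"
proof -
  have mem: "x \<in> K \<longleftrightarrow> (\<forall>u\<in>\<Omega>. x \<bullet> u \<le> support_function K u)" for x using K(2) unfolding determines_def by blast
  have supp: "support_function ((*\<^sub>R) a ` K) u = a * support_function K u" for u
  proof -
    obtain x where x: "x \<in> K" "x \<bullet> u = support_function K u" "\<And>y. y \<in> K \<Longrightarrow> y \<bullet> u \<le> support_function K u"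
      using support_attained[OF K(1)] by metis
    have "support_function ((*\<^sub>R) a ` K) u = (a *\<^sub>R x) \<bullet> u" unfolding support_function_def image_image
    proof (rule cSup_eq_maximum)
      show "(a *\<^sub>R x) \<bullet> u \<in> (\<lambda>y. (a *\<^sub>R y) \<bullet> u) ` K" using x(1) by (rule imageI)
      show "y \<le> (a *\<^sub>R x) \<bullet> u" if "y \<in> (\<lambda>y. (a *\<^sub>R y) \<bullet> u) ` K" for y using that x a by auto
    qed
    then show ?thesis using x by simp
  qed
  have "x \<in> (*\<^sub>R) a ` K \<longleftrightarrow> (\<forall>u\<in>\<Omega>. x \<bullet> u \<le> support_function ((*\<^sub>R) a ` K) u)" for x
  proof -
    have "x \<in> (*\<^sub>R) a ` K \<longleftrightarrow> (1 / a) *\<^sub>R x \<in> K" using a by (auto intro!: image_eqI[of _ _ "(1 / a) *\<^sub>R x"])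
    then show ?thesis unfolding mem supp using a by (simp add: pos_divide_le_eq mult.commute)
  qed
  then show ?thesis unfolding determines_def by blast
qed

lemma isoperimetric_quotient_homothetic:
  fixes K L E :: "(real^'n) set"
  assumes K: "convex_body K" "interior K \<noteq> {}" and E: "convex_body E" "interior E \<noteq> {}" and h: "homothetic K L"
  shows "isoperimetric_quotient L E = isoperimetric_quotient K E"
proof -
  obtain a x where a: "a > 0" and L: "L = (\<lambda>y. a *\<^sub>R y + x) ` K" using h unfolding homothetic_def by blast
  have L': "L = (+) x ` (*\<^sub>R) a ` K" unfolding L image_image by (simp add: add.commute)
  have "relative_surface_area L E = relative_surface_area ((*\<^sub>R) a ` K) E"
    using relative_surface_area_translate[of x "(*\<^sub>R) a ` K" 0 E] by (simp add: L')
  then have S: "relative_surface_area L E = a ^ (CARD('n) - 1) * relative_surface_area K E"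
    using relative_surface_area_scale[OF K E a] by simp
  have V: "vol L = a ^ CARD('n) * vol K" unfolding L' measure_translation using a by (simp add: measure_scaleR)
  \<comment> \<open>Surface area scales with a^(n-1) and volume with a^n, so numerator and
    denominator of the quotient acquire the same factor.\<close>
  have "(a ^ (CARD('n) - 1)) ^ CARD('n) = (a ^ CARD('n)) ^ (CARD('n) - 1)" by (simp add: power_mult[symmetric] mult.commute)
  then show ?thesis using a
    by (simp add: isoperimetric_quotient_def S V power_mult_distrib)
qed

lemma homothetic_sym:
  assumes "homothetic K L" shows "homothetic L (K :: 'a::euclidean_space set)"
proof -
  obtain a x where a: "a > 0" and L: "L = (\<lambda>y. a *\<^sub>R y + x) ` K" using assms unfolding homothetic_def by blast
  have "K = (\<lambda>y. (1 / a) *\<^sub>R y + (- (1 / a)) *\<^sub>R x) ` L"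
    unfolding L image_image using a by (simp add: scaleR_add_right)
  then show ?thesis unfolding homothetic_def using a by (intro exI[of _ "1 / a"] exI[of _ "(- (1 / a)) *\<^sub>R x"]) simp
qed

theorem corollary4p14:
  fixes E \<Omega> :: "(real ^ 'n) set"
  assumes "convex_body E" and "interior E \<noteq> {}"
    and "\<Omega> \<subseteq> sphere 0 1" and "0 \<in> interior (convex hull \<Omega>)"
  shows "tangential_body (outer_body \<Omega> E) E \<and>
    (\<forall>K :: (real ^ 'n) set. convex_body K \<and> interior K \<noteq> {} \<longrightarrow>
       (isoperimetric_minimizer \<Omega> E K \<longleftrightarrow> homothetic K (outer_body \<Omega> E))) \<and>
    isoperimetric_minimizer \<Omega> E (outer_body \<Omega> E) \<and>
    isoperimetric_quotient (outer_body \<Omega> E) E =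
      of_nat CARD('n) ^ CARD('n) * measure lebesgue (outer_body \<Omega> E)"
proof -
  let ?n = "CARD('n)" and ?I = "\<lambda>K. isoperimetric_quotient K E"
  define L where "L = outer_body \<Omega> E"
  have tang: "tangential_body L E" unfolding L_def by (rule tangential_outer_body[OF assms])
  have L: "convex_body L" "interior L \<noteq> {}" using tang by (auto simp: tangential_body_def)
  have LD: "determines \<Omega> L" unfolding L_def by (rule determines_outer_body[OF assms(1) L(1)[unfolded L_def]])
  \<comment> \<open>For competitors the reference body \<open>E\<close> may be replaced by
    \<open>L\<close>, which is itself a competitor; this turns the problem into Minkowski's
    inequality for \<open>K\<close> and \<open>L\<close>.\<close>
  have surf: "relative_surface_area K L = relative_surface_area K E"
    if "convex_body K" "interior K \<noteq> {}" "determines \<Omega> K" for K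
    unfolding L_def by (rule relative_surface_area_outer_body[OF that assms(3,1,2) L(1)[unfolded L_def]])
  define l where "l = root ?n (vol L)"
  have vL: "vol L > 0" by (rule convex_body_volume_pos[OF L])
  have l: "l > 0" "l ^ ?n = vol L" using vL by (simp_all add: l_def)
  have IL: "?I L = real ?n ^ ?n * vol L"
  proof -
    have "vol L ^ ?n = vol L * vol L ^ (?n - 1)"
      by (simp add: power_eq_if)
    then show ?thesis unfolding isoperimetric_quotient_def surf[OF L LD, symmetric] relative_surface_area_self[OF L(1)]
      using vL by (simp add: power_mult_distrib)
  qed
  have lower: "?I L \<le> ?I K" and eq: "?I K = ?I L \<Longrightarrow> homothetic K L"
    if K: "convex_body K" "interior K \<noteq> {}" "determines \<Omega> K" for K
  proof -
    define k where "k = root ?n (vol K)"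
    have vK: "vol K > 0" by (rule convex_body_volume_pos[OF K(1,2)])
    have k: "k > 0" "k ^ ?n = vol K" using vK by (simp_all add: k_def)
    let ?S = "relative_surface_area K L"
    have S: "real ?n * k ^ (?n - 1) * l \<le> ?S"
      using minkowski_first_inequality(1)[OF K(1,2) L] by (simp add: k_def l_def)
    \<comment> \<open>With vol K = k^n the denominator becomes the n-th power of k^(n-1), which
      cancels when Minkowski's inequality is raised to the power n.\<close>
    have IK: "?I K = ?S ^ ?n / (k ^ (?n - 1)) ^ ?n"
      unfolding isoperimetric_quotient_def surf[OF K] k(2)[symmetric]
      by (simp add: power_mult[symmetric] mult.commute)
    have base: "(real ?n * k ^ (?n - 1) * l) ^ ?n / (k ^ (?n - 1)) ^ ?n = ?I L"
      using k l by (simp add: IL power_mult_distrib)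
    have pos: "0 \<le> real ?n * k ^ (?n - 1) * l" using k l by simp
    show "?I L \<le> ?I K"
      unfolding base[symmetric] IK using k by (intro divide_right_mono power_mono S pos) simp
    assume "?I K = ?I L"
    then have "?S ^ ?n = (real ?n * k ^ (?n - 1) * l) ^ ?n"
      unfolding base[symmetric] IK using k by simp
    moreover have "0 \<le> ?S" using pos S by (rule order_trans)
    ultimately have "?S = real ?n * k ^ (?n - 1) * l" by (rule power_eq_imp_eq_base[OF _ _ pos]) simp
    then show "homothetic K L" using minkowski_first_inequality(2)[OF K(1,2) L] by (simp add: k_def l_def)
  qed
  \<comment> \<open>\<open>L\<close> is admissible and attains the lower bound, so the minimizers
    are the admissible bodies with the same quotient as \<open>L\<close>.\<close>
  have min_iff: "isoperimetric_minimizer \<Omega> E K \<longleftrightarrow> convex_body K \<and> interior K \<noteq> {} \<and> determines \<Omega> K \<and> ?I K = ?I L" for K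
  proof -
    have "isoperimetric_minimizer \<Omega> E K \<longleftrightarrow> convex_body K \<and> interior K \<noteq> {} \<and> determines \<Omega> K \<and>
      (\<forall>M. convex_body M \<longrightarrow> interior M \<noteq> {} \<longrightarrow> determines \<Omega> M \<longrightarrow> ?I K \<le> ?I M)"
      by (auto simp: isoperimetric_minimizer_def is_arg_min_def not_less)
    also have "\<dots> \<longleftrightarrow> convex_body K \<and> interior K \<noteq> {} \<and> determines \<Omega> K \<and> ?I K = ?I L"
    proof (intro conj_cong refl iffI allI impI)
      assume K: "convex_body K" "interior K \<noteq> {}" "determines \<Omega> K"
      show "?I K = ?I L" if min: "\<forall>M. convex_body M \<longrightarrow> interior M \<noteq> {} \<longrightarrow> determines \<Omega> M \<longrightarrow> ?I K \<le> ?I M"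
      proof (rule antisym)
        show "?I K \<le> ?I L" using min L LD by simp
      qed (rule lower[OF K])
      show "?I K \<le> ?I M" if "?I K = ?I L" "convex_body M" "interior M \<noteq> {}" "determines \<Omega> M" for M
        unfolding that(1) by (rule lower[OF that(2-4)])
    qed
    finally show ?thesis .
  qed
  have minL: "isoperimetric_minimizer \<Omega> E L" unfolding min_iff using L LD by simp
  have "isoperimetric_minimizer \<Omega> E K \<longleftrightarrow> homothetic K L" if K: "convex_body K" "interior K \<noteq> {}" for K
  proof
    assume "isoperimetric_minimizer \<Omega> E K"
    then show "homothetic K L" unfolding min_iff using eq by blast
  next
    assume h: "homothetic K L"
    obtain a x where a: "a > 0" and "K = (\<lambda>y. a *\<^sub>R y + x) ` L"
      using homothetic_sym[OF h] unfolding homothetic_def by blast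
    then have KL: "K = (+) x ` (*\<^sub>R) a ` L" unfolding image_image by (simp add: add.commute)
    have "determines \<Omega> K" unfolding KL
      by (intro determines_translate determines_scale convex_body_scale L LD a)
    moreover have "?I K = ?I L" using isoperimetric_quotient_homothetic[OF K assms(1,2) h] by simp
    ultimately show "isoperimetric_minimizer \<Omega> E K" unfolding min_iff using K by simp
  qed
  then show ?thesis using tang minL IL unfolding L_def by simp
qed

end
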